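(* Let $\mu\in\mathcal{M}$ be such that $\int_0^\infty |h_\mu(t+s)|^2\,ds<\infty$ for all $t>0$. For $f\in L^2(\mathbb{R}_+)$ let $$F(t)=\int_0^\infty h_\mu(t+s)f(s)\,ds,\quad t>0$$ (the integral converges absolutely). (i) We have $\operatorname{Dom}\Gamma_\mu=\{f\in L^2(\mathbb{R}_+): F\in L^2(\mathbb{R}_+)\}$. Moreover, if $F\in L^2(\mathbb{R}_+)$, then $\Gamma_\mu f=F$. (ii) We have $C^\infty_{\mathrm{comp}}(\mathbb{R}_+)\subset\operatorname{Dom}\Gamma_\mu$, and $C^\infty_{\mathrm{comp}}(\mathbb{R}_+)$ is dense in $\operatorname{Dom}\Gamma_\mu$ in the graph norm of $\Gamma_\mu$. In other words, the restriction $\Gamma_\mu|_{C^\infty_{\mathrm{comp}}(\mathbb{R}_+)}$ is essentially self-adjoint.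
   Context: $\mathbb{R}_+=(0,\infty)$. $\mathcal{M}$ is the class of positive Borel measures $\mu$ on $\mathbb{R}$ with $\operatorname{supp}\mu\subset[0,\infty)$, $\mu(\{0\})=0$ and $\int_0^\infty e^{-tx}\,d\mu(x)<\infty$ for all $t>0$. For $\mu\in\mathcal{M}$, $h_\mu(t)=\int_0^\infty e^{-tx}\,d\mu(x)$, $t>0$. For $f\in L^2(\mathbb{R}_+)$, $\mathcal{L}f(x)=\int_0^\infty e^{-tx}f(t)\,dt$, $x>0$. The quadratic form $Q_\mu[f]=\int_0^\infty|\mathcal{L}f(x)|^2\,d\mu(x)$ with domain $\{f\in L^2(\mathbb{R}_+): Q_\mu[f]<\infty\}$ is densely defined, non-negative and closed, and the Hankel operator $\Gamma_\mu$ is by definition the (positive semi-definite) self-adjoint operator on $L^2(\mathbb{R}_+)$ corresponding to the form $Q_\mu$. $C^\infty_{\mathrm{comp}}(\mathbb{R}_+)$ is the set of infinitely smooth functions with compact support in $(0,\infty)$. The graph norm of an operator $A$ is $(\|f\|^2+\|Af\|^2)^{1/2}$. *)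

theory Defs
  imports "HOL-Analysis.Analysis"
begin

section \<open>Square integrable functions and unbounded operators\<close>

text \<open>
  Elements of complex \<open>L\<^sup>2(M)\<close> are handled through representatives, so equality in \<open>L\<^sup>2(M)\<close> is
  equality almost everywhere. An unbounded operator is its graph, a set of pairs of
  representatives.
\<close>

type_synonym 'a l2_operator = "(('a \<Rightarrow> complex) \<times> ('a \<Rightarrow> complex)) set"

definition L2 :: "'a measure \<Rightarrow> ('a \<Rightarrow> complex) set" where
  "L2 M = {f. f \<in> borel_measurable M \<and> integrable M (\<lambda>x. (cmod (f x))\<^sup>2)}"

definition l2_inner :: "'a measure \<Rightarrow> ('a \<Rightarrow> complex) \<Rightarrow> ('a \<Rightarrow> complex) \<Rightarrow> complex" where
  "l2_inner M f g = (\<integral>x. f x * cnj (g x) \<partial>M)"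

definition l2_norm :: "'a measure \<Rightarrow> ('a \<Rightarrow> complex) \<Rightarrow> real" where
  "l2_norm M f = sqrt (\<integral>x. (cmod (f x))\<^sup>2 \<partial>M)"

text \<open>
  The value of an operator at a point of its domain. For the graph of an operator on \<open>L\<^sup>2(M)\<close> the
  choice of representative matters only up to null sets.
\<close>

definition op_app :: "'a l2_operator \<Rightarrow> ('a \<Rightarrow> complex) \<Rightarrow> ('a \<Rightarrow> complex)" where
  "op_app T f = (SOME g. (f, g) \<in> T)"

definition op_restrict :: "'a l2_operator \<Rightarrow> ('a \<Rightarrow> complex) set \<Rightarrow> 'a l2_operator" where
  "op_restrict T S = {(f, g) \<in> T. f \<in> S}"

definition graph_norm :: "'a measure \<Rightarrow> 'a l2_operator \<Rightarrow> ('a \<Rightarrow> complex) \<Rightarrow> real" where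
  "graph_norm M T f = sqrt ((l2_norm M f)\<^sup>2 + (l2_norm M (op_app T f))\<^sup>2)"

definition densely_defined :: "'a measure \<Rightarrow> 'a l2_operator \<Rightarrow> bool" where
  "densely_defined M T \<longleftrightarrow>
     Domain T \<subseteq> L2 M \<and> (\<forall>f\<in>L2 M. \<forall>e>0. \<exists>g\<in>Domain T. l2_norm M (\<lambda>x. f x - g x) < e)"

definition op_symmetric :: "'a measure \<Rightarrow> 'a l2_operator \<Rightarrow> bool" where
  "op_symmetric M T \<longleftrightarrow> (\<forall>(f, f')\<in>T. \<forall>(g, g')\<in>T. l2_inner M f' g = l2_inner M f g')"

definition op_adjoint :: "'a measure \<Rightarrow> 'a l2_operator \<Rightarrow> 'a l2_operator" where
  "op_adjoint M T =
     {(g, g'). g \<in> L2 M \<and> g' \<in> L2 M \<and> (\<forall>(f, f')\<in>T. l2_inner M f' g = l2_inner M f g')}"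

definition op_closure :: "'a measure \<Rightarrow> 'a l2_operator \<Rightarrow> 'a l2_operator" where
  "op_closure M T =
     {(f, f'). f \<in> L2 M \<and> f' \<in> L2 M \<and>
        (\<forall>e>0. \<exists>(g, g')\<in>T. l2_norm M (\<lambda>x. f x - g x) < e \<and> l2_norm M (\<lambda>x. f' x - g' x) < e)}"

definition self_adjoint :: "'a measure \<Rightarrow> 'a l2_operator \<Rightarrow> bool" where
  "self_adjoint M T \<longleftrightarrow> densely_defined M T \<and> op_adjoint M T = T"

definition essentially_self_adjoint :: "'a measure \<Rightarrow> 'a l2_operator \<Rightarrow> bool" where
  "essentially_self_adjoint M T \<longleftrightarrow>
     densely_defined M T \<and> op_symmetric M T \<and> self_adjoint M (op_closure M T)"

text \<open>
  The operator corresponding to a sesquilinear form \<open>q\<close> with domain \<open>D\<close> (first representation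
  theorem): \<open>f\<close> is mapped to \<open>g\<close> iff \<open>f \<in> D\<close> and \<open>q(f, \<phi>) = \<langle>g, \<phi>\<rangle>\<close> for all \<open>\<phi> \<in> D\<close>.
\<close>

definition form_operator ::
  "'a measure \<Rightarrow> ('a \<Rightarrow> complex) set \<Rightarrow> (('a \<Rightarrow> complex) \<Rightarrow> ('a \<Rightarrow> complex) \<Rightarrow> complex)
     \<Rightarrow> 'a l2_operator" where
  "form_operator M D q = {(f, g). f \<in> D \<and> g \<in> L2 M \<and> (\<forall>\<phi>\<in>D. q f \<phi> = l2_inner M g \<phi>)}"


section \<open>Hankel operators\<close>

text \<open>
  Functions on \<open>(0, \<infinity>)\<close> are total functions on the reals whose values on \<open>(-\<infinity>, 0]\<close> are irrelevant.
\<close>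

abbreviation Rplus :: "real measure" where
  "Rplus \<equiv> restrict_space lborel {0<..}"

definition measure_support :: "real measure \<Rightarrow> real set" where
  "measure_support \<mu> = {x. \<forall>U. open U \<and> x \<in> U \<longrightarrow> emeasure \<mu> U > 0}"

definition hankel_measures :: "real measure set" where
  "hankel_measures =
     {\<mu>. sets \<mu> = sets borel \<and> measure_support \<mu> \<subseteq> {0..} \<and> emeasure \<mu> {0} = 0 \<and>
        (\<forall>t>0. (\<integral>\<^sup>+x\<in>{0<..}. ennreal (exp (- t * x)) \<partial>\<mu>) < \<infinity>)}"

definition hankel_kernel :: "real measure \<Rightarrow> real \<Rightarrow> real" where
  "hankel_kernel \<mu> t = (LINT x:{0<..}|\<mu>. exp (- t * x))"

definition laplace :: "(real \<Rightarrow> complex) \<Rightarrow> real \<Rightarrow> complex" where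
  "laplace f x = (\<integral>t. exp (- t * x) *\<^sub>R f t \<partial>Rplus)"

definition hankel_quad :: "real measure \<Rightarrow> (real \<Rightarrow> complex) \<Rightarrow> ennreal" where
  "hankel_quad \<mu> f = (\<integral>\<^sup>+x\<in>{0<..}. ennreal ((cmod (laplace f x))\<^sup>2) \<partial>\<mu>)"

definition hankel_form_dom :: "real measure \<Rightarrow> (real \<Rightarrow> complex) set" where
  "hankel_form_dom \<mu> = {f \<in> L2 Rplus. hankel_quad \<mu> f < \<infinity>}"

text \<open>The sesquilinear form obtained from \<^const>\<open>hankel_quad\<close> by polarization.\<close>

definition hankel_form :: "real measure \<Rightarrow> (real \<Rightarrow> complex) \<Rightarrow> (real \<Rightarrow> complex) \<Rightarrow> complex" where
  "hankel_form \<mu> f g = (LINT x:{0<..}|\<mu>. laplace f x * cnj (laplace g x))"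

definition hankel_operator :: "real measure \<Rightarrow> real l2_operator" where
  "hankel_operator \<mu> = form_operator Rplus (hankel_form_dom \<mu>) (hankel_form \<mu>)"

definition hankel_integral :: "real measure \<Rightarrow> (real \<Rightarrow> complex) \<Rightarrow> real \<Rightarrow> complex" where
  "hankel_integral \<mu> f t = (\<integral>s. hankel_kernel \<mu> (t + s) *\<^sub>R f s \<partial>Rplus)"

definition smooth :: "(real \<Rightarrow> complex) \<Rightarrow> bool" where
  "smooth f \<longleftrightarrow>
     (\<exists>D. D 0 = f \<and> (\<forall>n::nat. \<forall>x. (D n has_vector_derivative D (Suc n) x) (at x)))"

text \<open>
  Elements of \<open>C\<^sup>\<infinity>\<close> with compact support in \<open>(0, \<infinity>)\<close> are identified with their extension by zero.
\<close>

definition C_comp :: "(real \<Rightarrow> complex) set" where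
  "C_comp = {f. smooth f \<and> compact (closure {t. f t \<noteq> 0}) \<and> closure {t. f t \<noteq> 0} \<subseteq> {0<..}}"

end

theory Submission
  imports Defs
begin

text \<open>
  Write \<open>L\<close> for the Laplace transform, \<open>\<nu>\<close> for the restriction of \<open>\<mu>\<close> to \<open>(0, \<infinity>)\<close> and \<open>F f\<close> for
  the function \<open>hankel_integral \<mu> f\<close>. As the kernel is itself a Laplace transform,
  \<open>F f (t) = \<integral> exp (- t x) L f (x) d\<nu>(x)\<close>, so formally \<open>F\<close> is \<open>L\<close> followed by its adjoint, while the
  form is \<open>q(f, g) = \<langle>L f, L g\<rangle>\<close> in \<open>L\<^sup>2(\<nu>)\<close>. The question is when
  \<open>q(f, \<phi>) = \<langle>F f, \<phi>\<rangle>\<close> may be concluded by exchanging the integrals. For \<open>\<phi>\<close> supported in a compact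
  subset of \<open>(0, \<infinity>)\<close> there is no difficulty, since \<open>L \<phi>\<close> decays exponentially. In general the
  exchange fails to converge for two reasons: \<open>\<nu>\<close> may be large near infinity and near zero.

  Both defects are removed by the multiplier \<open>m(x) = exp (- a x) - exp (- b x)\<close> with
  \<open>0 < a < b\<close>. By Cauchy-Schwarz \<open>\<bar>L f (x)\<bar>\<^sup>2 \<le> \<parallel>f\<parallel>\<^sup>2 / (2 x)\<close>, and \<open>m(x) / x \<le> (b - a) exp (- a x)\<close> is
  integrable for \<open>\<nu>\<close>. Hence \<open>L\<close> maps \<open>L\<^sup>2(0, \<infinity>)\<close> boundedly into \<open>L\<^sup>2(m \<nu>)\<close>. On the other side the
  multiplier is a combination of translations: the adjoint of \<open>L\<close> takes \<open>m L f\<close> to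
  \<open>F f (\<cdot> + a) - F f (\<cdot> + b)\<close>. So for all \<open>f\<close> and \<open>\<phi>\<close> in \<open>L\<^sup>2\<close>, with no assumption on \<open>F f\<close>,

    \<open>\<integral> m L f (L \<phi>)\<^sup>* d\<nu> = \<langle>F f (\<cdot> + a) - F f (\<cdot> + b), \<phi>\<rangle>\<close>,

  and \<open>f \<mapsto> F f (\<cdot> + a) - F f (\<cdot> + b)\<close> is a bounded operator
  (\<open>multiplier_pairing\<close>, \<open>hankel_difference_bounded\<close>).

  The domain. If \<open>F f \<in> L\<^sup>2\<close>, let \<open>a\<close> tend to zero and \<open>b\<close> to infinity. Then \<open>m\<close> tends to one and the
  right-hand side to \<open>\<langle>F f, \<phi>\<rangle>\<close>, because translations are continuous in \<open>L\<^sup>2\<close> and translates to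
  infinity vanish on the half-line. With \<open>\<phi> = f\<close> Fatou's lemma shows that \<open>f\<close> is in the form domain,
  and dominated convergence then gives \<open>q(f, \<phi>) = \<langle>F f, \<phi>\<rangle>\<close> on the form domain. Conversely, if \<open>f\<close>
  is mapped to \<open>g\<close>, then testing with functions supported in compact subsets of \<open>(0, \<infinity>)\<close> gives
  \<open>g = F f\<close> (\<open>hankel_operator_iff\<close>).

  The core. For smooth \<open>\<psi>\<close> with compact support consider
  \<open>v = 1/N \<Sum>\<^sub>k (S\<^sub>\<epsilon> \<psi> - S\<^sub>\<epsilon>\<^sub>+\<^sub>k\<^sub>l \<psi>)\<close>, \<open>k = 1, \<dots>, N\<close>, where \<open>S\<^sub>r\<close> is translation to the right by \<open>r\<close>.
  Then \<open>v\<close> is smooth with compact support and \<open>F v\<close> is the average of the functions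
  \<open>F \<psi> (\<cdot> + \<epsilon>) - F \<psi> (\<cdot> + \<epsilon> + k l)\<close>; by the boundedness above it depends continuously in \<open>L\<^sup>2\<close> on
  \<open>\<psi>\<close>, so \<open>\<psi>\<close> may be replaced by any \<open>f\<close> of the domain at the cost of a small error. For such \<open>f\<close>
  the terms \<open>S\<^sub>\<epsilon> f\<close> and \<open>F f (\<cdot> + \<epsilon>)\<close> are close to \<open>f\<close> and \<open>F f\<close>, and the remaining ones are
  negligible for large \<open>l\<close> and \<open>N\<close>: the functions \<open>F f (\<cdot> + \<epsilon> + k l)\<close> are small in norm, and the far
  translates of \<open>f\<close> are almost orthogonal, so that their average has norm of order \<open>1 / \<surd>N\<close>
  (\<open>norm_average_far_translates\<close>, \<open>C_comp_graph_dense\<close>). Density of the graph of the restriction to the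
  smooth functions, together with the test by functions of compact support, identifies the adjoint
  of the restriction with \<open>\<Gamma>\<^sub>\<mu>\<close>, and its closure is \<open>\<Gamma>\<^sub>\<mu>\<close> as well.
\<close>

section \<open>Square integrable functions\<close>

lemma L2D [dest]:
  assumes "f \<in> L2 M"
  shows "f \<in> borel_measurable M" "integrable M (\<lambda>x. (cmod (f x))\<^sup>2)"
  using assms by (auto simp: L2_def)

lemma L2_iff_nn_integral:
  "f \<in> L2 M \<longleftrightarrow> f \<in> borel_measurable M \<and> (\<integral>\<^sup>+x. ennreal ((cmod (f x))\<^sup>2) \<partial>M) < \<infinity>"
  by (auto simp: L2_def integrable_iff_bounded)

lemma nn_integral_L2:
  "f \<in> L2 M \<Longrightarrow> (\<integral>\<^sup>+x. ennreal ((cmod (f x))\<^sup>2) \<partial>M) = ennreal ((l2_norm M f)\<^sup>2)"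
  by (subst nn_integral_eq_integral) (auto simp: l2_norm_def L2_def)

lemma l2_norm_nonneg [simp]: "0 \<le> l2_norm M f"
  by (simp add: l2_norm_def)

lemma l2_norm_squared: "(l2_norm M f)\<^sup>2 = (\<integral>x. (cmod (f x))\<^sup>2 \<partial>M)"
  by (simp add: l2_norm_def)

lemma L2_bounded:
  assumes "f \<in> borel_measurable M" "g \<in> L2 M" "AE x in M. cmod (f x) \<le> cmod (g x)"
  shows "f \<in> L2 M"
proof -
  have "integrable M (\<lambda>x. (cmod (f x))\<^sup>2)"
  proof (rule Bochner_Integration.integrable_bound[OF L2D(2)[OF assms(2)]])
    show "(\<lambda>x. (cmod (f x))\<^sup>2) \<in> borel_measurable M" using assms(1) by measurable
    show "AE x in M. norm ((cmod (f x))\<^sup>2) \<le> norm ((cmod (g x))\<^sup>2)"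
      using assms(3) by eventually_elim (simp add: power_mono)
  qed
  then show ?thesis using assms(1) by (simp add: L2_def)
qed

lemma l2_norm_mono:
  assumes "f \<in> L2 M" "g \<in> L2 M" "AE x in M. cmod (f x) \<le> cmod (g x)"
  shows "l2_norm M f \<le> l2_norm M g"
  unfolding l2_norm_def real_sqrt_le_iff
  by (rule integral_mono_AE[OF L2D(2)[OF assms(1)] L2D(2)[OF assms(2)]])
     (use assms(3) in \<open>eventually_elim, simp add: power_mono\<close>)

lemma l2_norm_cong_AE:
  assumes "f \<in> L2 M" "g \<in> L2 M" "AE x in M. f x = g x"
  shows "l2_norm M f = l2_norm M g"
  by (rule antisym; rule l2_norm_mono) (use assms in auto)

lemma L2_add:
  assumes "f \<in> L2 M" "g \<in> L2 M" shows "(\<lambda>x. f x + g x) \<in> L2 M"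
proof -
  have [measurable]: "f \<in> borel_measurable M" "g \<in> borel_measurable M" using assms by auto
  have "integrable M (\<lambda>x. (cmod (f x + g x))\<^sup>2)"
  proof (rule Bochner_Integration.integrable_bound)
    show "integrable M (\<lambda>x. 2 * (cmod (f x))\<^sup>2 + 2 * (cmod (g x))\<^sup>2)"
      using assms by (auto simp: L2_def)
    have "(cmod (f x + g x))\<^sup>2 \<le> 2 * (cmod (f x))\<^sup>2 + 2 * (cmod (g x))\<^sup>2" for x
    proof -
      have "(cmod (f x + g x))\<^sup>2 \<le> (cmod (f x) + cmod (g x))\<^sup>2"
        by (intro power_mono norm_triangle_ineq) auto
      also have "\<dots> \<le> 2 * (cmod (f x))\<^sup>2 + 2 * (cmod (g x))\<^sup>2"
        using sum_squares_bound[of "cmod (f x)" "cmod (g x)"] by (simp add: power2_sum)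
      finally show ?thesis .
    qed
    then show "AE x in M. norm ((cmod (f x + g x))\<^sup>2) \<le> norm (2 * (cmod (f x))\<^sup>2 + 2 * (cmod (g x))\<^sup>2)"
      by simp
  qed measurable
  then show ?thesis by (simp add: L2_def)
qed

lemma L2_cmult: "f \<in> L2 M \<Longrightarrow> (\<lambda>x. c * f x) \<in> L2 M"
  by (auto simp: L2_def norm_mult power_mult_distrib)

lemma L2_diff:
  assumes "f \<in> L2 M" "g \<in> L2 M" shows "(\<lambda>x. f x - g x) \<in> L2 M"
  using L2_add[OF assms(1) L2_cmult[OF assms(2), of "-1"]] by simp

lemma L2_zero [simp]: "(\<lambda>x. 0) \<in> L2 M"
  by (simp add: L2_def)

lemma L2_sum: "(\<And>i. i \<in> I \<Longrightarrow> f i \<in> L2 M) \<Longrightarrow> (\<lambda>x. \<Sum>i\<in>I. f i x) \<in> L2 M"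
  by (induction I rule: infinite_finite_induct) (auto intro: L2_add)

lemma L2_indicator_mult:
  assumes "f \<in> L2 M" "A \<in> sets M"
  shows "(\<lambda>x. indicator A x * f x) \<in> L2 M"
proof (rule L2_bounded[OF _ assms(1)])
  have [measurable]: "f \<in> borel_measurable M" "A \<in> sets M" using assms by auto
  show "(\<lambda>x. indicator A x * f x) \<in> borel_measurable M" by measurable
qed (auto simp: indicator_def)

lemma l2_Cauchy_Schwarz_nn:
  assumes "f \<in> L2 M" "g \<in> L2 M"
  shows "(\<integral>\<^sup>+x. ennreal (cmod (f x) * cmod (g x)) \<partial>M) \<le> ennreal (l2_norm M f * l2_norm M g)"
proof -
  have [measurable]: "f \<in> borel_measurable M" "g \<in> borel_measurable M" using assms by auto
  have "(\<integral>\<^sup>+x. ennreal (cmod (f x)) * ennreal (cmod (g x)) \<partial>M)\<^sup>2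
      \<le> (\<integral>\<^sup>+x. (ennreal (cmod (f x)))\<^sup>2 \<partial>M) * (\<integral>\<^sup>+x. (ennreal (cmod (g x)))\<^sup>2 \<partial>M)"
    by (rule Cauchy_Schwarz_nn_integral) auto
  also have "\<dots> = ennreal ((l2_norm M f)\<^sup>2) * ennreal ((l2_norm M g)\<^sup>2)"
    using nn_integral_L2[OF assms(1)] nn_integral_L2[OF assms(2)] by (simp add: ennreal_power)
  also have "\<dots> = (ennreal (l2_norm M f * l2_norm M g))\<^sup>2"
    by (simp add: ennreal_power ennreal_mult power_mult_distrib)
  finally have "(\<integral>\<^sup>+x. ennreal (cmod (f x)) * ennreal (cmod (g x)) \<partial>M)
      \<le> ennreal (l2_norm M f * l2_norm M g)"
    by (cases "\<integral>\<^sup>+x. ennreal (cmod (f x)) * ennreal (cmod (g x)) \<partial>M" rule: ennreal_cases)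
       (auto simp: ennreal_power top_unique intro: power2_le_imp_le)
  then show ?thesis by (simp add: ennreal_mult)
qed

lemma L2_mult_integrable:
  assumes "f \<in> L2 M" "g \<in> L2 M"
  shows "integrable M (\<lambda>x. f x * g x)"
proof (rule integrableI_bounded)
  have [measurable]: "f \<in> borel_measurable M" "g \<in> borel_measurable M" using assms by auto
  show "(\<lambda>x. f x * g x) \<in> borel_measurable M" by measurable
  show "(\<integral>\<^sup>+x. ennreal (norm (f x * g x)) \<partial>M) < \<infinity>"
    using l2_Cauchy_Schwarz_nn[OF assms] by (simp add: norm_mult order_le_less_trans)
qed

lemma borel_measurable_cnj [measurable (raw)]:
  "f \<in> borel_measurable M \<Longrightarrow> (\<lambda>x. cnj (f x)) \<in> borel_measurable M"
  by (rule measurable_compose[OF _ borel_measurable_continuous_onI]) (auto intro: continuous_intros)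

lemma L2_cnj: "f \<in> L2 M \<Longrightarrow> (\<lambda>x. cnj (f x)) \<in> L2 M"
  by (auto simp: L2_def)

lemma L2_mult_cnj_integrable:
  "f \<in> L2 M \<Longrightarrow> g \<in> L2 M \<Longrightarrow> integrable M (\<lambda>x. f x * cnj (g x))"
  by (rule L2_mult_integrable[OF _ L2_cnj])

lemma l2_integral_norm_le:
  assumes "f \<in> L2 M" "g \<in> L2 M"
  shows "(\<integral>x. cmod (f x) * cmod (g x) \<partial>M) \<le> l2_norm M f * l2_norm M g"
proof -
  have [measurable]: "f \<in> borel_measurable M" "g \<in> borel_measurable M" using assms by auto
  have "integrable M (\<lambda>x. norm (f x * g x))"
    by (intro integrable_norm L2_mult_integrable assms)
  then have "ennreal (\<integral>x. cmod (f x) * cmod (g x) \<partial>M)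
      = (\<integral>\<^sup>+x. ennreal (cmod (f x) * cmod (g x)) \<partial>M)"
    by (subst nn_integral_eq_integral) (auto simp: norm_mult)
  also note l2_Cauchy_Schwarz_nn[OF assms]
  finally show ?thesis by simp
qed

lemma l2_Cauchy_Schwarz:
  assumes "f \<in> L2 M" "g \<in> L2 M"
  shows "cmod (l2_inner M f g) \<le> l2_norm M f * l2_norm M g"
proof -
  have "cmod (l2_inner M f g) \<le> (\<integral>x. cmod (f x * cnj (g x)) \<partial>M)"
    unfolding l2_inner_def by (rule integral_norm_bound)
  also have "\<dots> \<le> l2_norm M f * l2_norm M g"
    using l2_integral_norm_le[OF assms] by (simp add: norm_mult)
  finally show ?thesis .
qed

lemma l2_norm_triangle:
  assumes "f \<in> L2 M" "g \<in> L2 M"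
  shows "l2_norm M (\<lambda>x. f x + g x) \<le> l2_norm M f + l2_norm M g"
proof (rule power2_le_imp_le)
  have i: "integrable M (\<lambda>x. cmod (f x) * cmod (g x))"
    using integrable_norm[OF L2_mult_integrable[OF assms]] by (simp add: norm_mult)
  have "(l2_norm M (\<lambda>x. f x + g x))\<^sup>2 = (\<integral>x. (cmod (f x + g x))\<^sup>2 \<partial>M)"
    by (simp add: l2_norm_squared)
  also have "\<dots> \<le> (\<integral>x. (cmod (f x))\<^sup>2 + 2 * (cmod (f x) * cmod (g x)) + (cmod (g x))\<^sup>2 \<partial>M)"
  proof (rule integral_mono)
    fix x
    have "(cmod (f x + g x))\<^sup>2 \<le> (cmod (f x) + cmod (g x))\<^sup>2"
      by (intro power_mono norm_triangle_ineq) auto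
    then show "(cmod (f x + g x))\<^sup>2 \<le> (cmod (f x))\<^sup>2 + 2 * (cmod (f x) * cmod (g x)) + (cmod (g x))\<^sup>2"
      by (simp add: power2_sum)
  qed (use L2_add[OF assms] assms i in \<open>auto simp: L2_def\<close>)
  also have "\<dots> = (l2_norm M f)\<^sup>2 + 2 * (\<integral>x. cmod (f x) * cmod (g x) \<partial>M) + (l2_norm M g)\<^sup>2"
    using i assms by (simp add: l2_norm_squared L2_def)
  also have "\<dots> \<le> (l2_norm M f + l2_norm M g)\<^sup>2"
    using l2_integral_norm_le[OF assms] by (simp add: power2_sum)
  finally show "(l2_norm M (\<lambda>x. f x + g x))\<^sup>2 \<le> (l2_norm M f + l2_norm M g)\<^sup>2" .
qed simp

lemma l2_norm_cmult: "l2_norm M (\<lambda>x. c * f x) = cmod c * l2_norm M f"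
  by (simp add: l2_norm_def norm_mult power_mult_distrib real_sqrt_mult)

lemma l2_norm_minus_commute: "l2_norm M (\<lambda>x. f x - g x) = l2_norm M (\<lambda>x. g x - f x)"
  by (simp add: l2_norm_def norm_minus_commute)

lemma l2_norm_zero [simp]: "l2_norm M (\<lambda>x. 0) = 0"
  by (simp add: l2_norm_def)

lemma l2_norm_diff_triangle:
  assumes "f \<in> L2 M" "g \<in> L2 M" "k \<in> L2 M"
  shows "l2_norm M (\<lambda>x. f x - k x) \<le> l2_norm M (\<lambda>x. f x - g x) + l2_norm M (\<lambda>x. g x - k x)"
  using l2_norm_triangle[OF L2_diff[OF assms(1,2)] L2_diff[OF assms(2,3)]] by simp

lemma l2_norm_sum:
  assumes "\<And>i. i \<in> I \<Longrightarrow> f i \<in> L2 M"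
  shows "l2_norm M (\<lambda>x. \<Sum>i\<in>I. f i x) \<le> (\<Sum>i\<in>I. l2_norm M (f i))"
  using assms
proof (induction I rule: infinite_finite_induct)
  case (insert i I)
  have "l2_norm M (\<lambda>x. f i x + (\<Sum>i\<in>I. f i x)) \<le> l2_norm M (f i) + l2_norm M (\<lambda>x. \<Sum>i\<in>I. f i x)"
    using insert by (intro l2_norm_triangle L2_sum) auto
  with insert show ?case by force
qed auto

lemma l2_dominated_convergence:
  assumes s: "\<And>n::nat. s n \<in> borel_measurable M" and f: "f \<in> borel_measurable M"
    and w: "integrable M (\<lambda>x. (w x)\<^sup>2)"
    and lim: "AE x in M. (\<lambda>n. s n x) \<longlonglongrightarrow> f x"
    and bd: "\<And>n. AE x in M. cmod (s n x - f x) \<le> w x"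
  shows "(\<lambda>n. l2_norm M (\<lambda>x. s n x - f x)) \<longlonglongrightarrow> 0"
proof -
  have [measurable]: "s n \<in> borel_measurable M" "f \<in> borel_measurable M" for n using s f by auto
  have "(\<lambda>n. \<integral>x. (cmod (s n x - f x))\<^sup>2 \<partial>M) \<longlonglongrightarrow> (\<integral>x. 0 \<partial>M)"
  proof (rule integral_dominated_convergence[where w="\<lambda>x. (w x)\<^sup>2"])
    show "AE x in M. (\<lambda>n. (cmod (s n x - f x))\<^sup>2) \<longlonglongrightarrow> 0"
      using lim
    proof eventually_elim
      case (elim x)
      then have "(\<lambda>n. (cmod (s n x - f x))\<^sup>2) \<longlonglongrightarrow> (cmod (f x - f x))\<^sup>2"
        by (intro tendsto_intros)
      then show ?case by simp
    qed
    show "AE x in M. norm ((cmod (s n x - f x))\<^sup>2) \<le> (w x)\<^sup>2" for n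
      using bd[of n] by eventually_elim (simp add: power_mono)
  qed (use w in measurable)
  then have "(\<lambda>n. sqrt (\<integral>x. (cmod (s n x - f x))\<^sup>2 \<partial>M)) \<longlonglongrightarrow> sqrt 0"
    by (intro tendsto_real_sqrt) simp
  then show ?thesis by (simp add: l2_norm_def)
qed

lemma l2_inner_diff_left:
  assumes "f \<in> L2 M" "g \<in> L2 M" "k \<in> L2 M"
  shows "l2_inner M (\<lambda>x. f x - g x) k = l2_inner M f k - l2_inner M g k"
  unfolding l2_inner_def
  by (subst Bochner_Integration.integral_diff[symmetric])
     (auto intro: L2_mult_cnj_integrable assms simp: algebra_simps)

lemma l2_inner_diff_right:
  assumes "f \<in> L2 M" "g \<in> L2 M" "k \<in> L2 M"
  shows "l2_inner M k (\<lambda>x. f x - g x) = l2_inner M k f - l2_inner M k g"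
  unfolding l2_inner_def
  by (subst Bochner_Integration.integral_diff[symmetric])
     (auto intro: L2_mult_cnj_integrable assms simp: algebra_simps)

lemma l2_inner_commute: "l2_inner M f g = cnj (l2_inner M g f)"
proof -
  have "cnj (l2_inner M g f) = (\<integral>x. cnj (g x * cnj (f x)) \<partial>M)"
    unfolding l2_inner_def by (simp flip: integral_cnj del: complex_cnj_mult)
  then show ?thesis by (simp add: l2_inner_def mult.commute)
qed

lemma l2_inner_self: "l2_inner M f f = of_real ((l2_norm M f)\<^sup>2)"
proof -
  have "l2_inner M f f = (\<integral>x. of_real ((cmod (f x))\<^sup>2) \<partial>M)"
    unfolding l2_inner_def by (simp flip: complex_norm_square)
  also have "\<dots> = of_real (\<integral>x. (cmod (f x))\<^sup>2 \<partial>M)"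
    by (rule integral_complex_of_real)
  finally show ?thesis by (simp only: l2_norm_squared)
qed

lemma l2_norm_eq_0_AE:
  assumes "f \<in> L2 M" "l2_norm M f = 0"
  shows "AE x in M. f x = 0"
proof -
  have "(\<integral>x. (cmod (f x))\<^sup>2 \<partial>M) = 0" using assms(2) by (simp add: l2_norm_def)
  then have "AE x in M. (cmod (f x))\<^sup>2 = 0"
    using integral_nonneg_eq_0_iff_AE[OF L2D(2)[OF assms(1)]] by simp
  then show ?thesis by simp
qed

lemma l2_inner_tendsto_left:
  assumes "\<And>n. s n \<in> L2 M" "f \<in> L2 M" "g \<in> L2 M"
    and "(\<lambda>n::nat. l2_norm M (\<lambda>x. s n x - f x)) \<longlonglongrightarrow> 0"
  shows "(\<lambda>n. l2_inner M (s n) g) \<longlonglongrightarrow> l2_inner M f g"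
proof -
  have "(\<lambda>n. l2_inner M (s n) g - l2_inner M f g) \<longlonglongrightarrow> 0"
  proof (rule Lim_null_comparison)
    show "\<forall>\<^sub>F n in sequentially. norm (l2_inner M (s n) g - l2_inner M f g)
        \<le> l2_norm M (\<lambda>x. s n x - f x) * l2_norm M g"
      using l2_Cauchy_Schwarz[OF L2_diff[OF assms(1,2)] assms(3)]
      by (simp add: l2_inner_diff_left[OF assms(1,2,3)])
    show "(\<lambda>n. l2_norm M (\<lambda>x. s n x - f x) * l2_norm M g) \<longlonglongrightarrow> 0"
      using tendsto_mult_right[OF assms(4), of "l2_norm M g"] by simp
  qed
  then show ?thesis by (simp add: LIM_zero_iff)
qed

text \<open>
  Norms over two different measures may be compared, as a change of variables requires.
\<close>

lemma l2_norm_le_if_nn_integral_le: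
  assumes "f \<in> L2 M" "g \<in> L2 N"
    "(\<integral>\<^sup>+x. ennreal ((cmod (f x))\<^sup>2) \<partial>M) \<le> (\<integral>\<^sup>+x. ennreal ((cmod (g x))\<^sup>2) \<partial>N)"
  shows "l2_norm M f \<le> l2_norm N g"
  using assms(3) unfolding nn_integral_L2[OF assms(1)] nn_integral_L2[OF assms(2)]
  by (simp add: power2_le_iff_abs_le)

text \<open>
  Functions with disjoint supports are orthogonal, so this is Pythagoras' theorem.
\<close>

lemma l2_norm_sum_disjoint:
  assumes "finite I" "\<And>i. i \<in> I \<Longrightarrow> g i \<in> L2 M"
    and disj: "\<And>x i j. i \<in> I \<Longrightarrow> j \<in> I \<Longrightarrow> i \<noteq> j \<Longrightarrow> g i x = 0 \<or> g j x = 0"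
  shows "(l2_norm M (\<lambda>x. \<Sum>i\<in>I. g i x))\<^sup>2 = (\<Sum>i\<in>I. (l2_norm M (g i))\<^sup>2)"
proof -
  have pt: "(cmod (\<Sum>i\<in>I. g i x))\<^sup>2 = (\<Sum>i\<in>I. (cmod (g i x))\<^sup>2)" for x
    using assms(1) disj
  proof (induction I rule: finite_induct)
    case (insert i I)
    have IH: "(cmod (\<Sum>i\<in>I. g i x))\<^sup>2 = (\<Sum>i\<in>I. (cmod (g i x))\<^sup>2)"
      by (rule insert.IH) (use insert.prems in blast)
    show ?case
    proof (cases "g i x = 0")
      case False
      have "g j x = 0" if "j \<in> I" for j
        using insert.prems[of i j] insert.hyps(2) that False by auto
      then show ?thesis using insert.hyps by simp
    qed (use insert.hyps IH in simp)
  qed simp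
  show ?thesis
    unfolding l2_norm_squared pt
    by (rule Bochner_Integration.integral_sum) (rule L2D(2)[OF assms(2)])
qed

lemma average_norm_le:
  assumes "\<And>k. k \<in> {1::nat..N} \<Longrightarrow> g k \<in> L2 M" "\<And>k. k \<in> {1::nat..N} \<Longrightarrow> l2_norm M (g k) \<le> B" "0 < N"
  shows "l2_norm M (\<lambda>t. \<Sum>k\<in>{1::nat..N}. of_real (1 / real N) * g k t) \<le> B"
proof -
  have "l2_norm M (\<lambda>t. \<Sum>k\<in>{1::nat..N}. of_real (1 / real N) * g k t)
      \<le> (\<Sum>k\<in>{1::nat..N}. l2_norm M (\<lambda>t. of_real (1 / real N) * g k t))"
    by (rule l2_norm_sum) (intro L2_cmult assms)
  also have "\<dots> = (\<Sum>k\<in>{1::nat..N}. 1 / real N * l2_norm M (g k))"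
    unfolding l2_norm_cmult by (simp add: norm_divide)
  also have "\<dots> \<le> (\<Sum>k\<in>{1::nat..N}. 1 / real N * B)"
    by (intro sum_mono mult_left_mono assms) auto
  also have "\<dots> = B" using assms(3) by simp
  finally show ?thesis .
qed

text \<open>
  Membership in the closure carries the approximation property through the measure-theoretic
  inductions by which the density of smooth functions is proved.
\<close>

definition l2_closure :: "'a measure \<Rightarrow> ('a \<Rightarrow> complex) set \<Rightarrow> ('a \<Rightarrow> complex) set" where
  "l2_closure M S = {f \<in> L2 M. \<forall>e>0. \<exists>g\<in>S. l2_norm M (\<lambda>x. f x - g x) < e}"

lemma l2_closureE:
  assumes "f \<in> l2_closure M S" "e > 0"
  obtains g where "g \<in> S" "l2_norm M (\<lambda>x. f x - g x) < e"
  using assms by (auto simp: l2_closure_def)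

lemma l2_closure_limit:
  assumes "\<And>n::nat. s n \<in> l2_closure M S" "S \<subseteq> L2 M" "f \<in> L2 M"
    and "(\<lambda>n. l2_norm M (\<lambda>x. s n x - f x)) \<longlonglongrightarrow> 0"
  shows "f \<in> l2_closure M S"
  unfolding l2_closure_def
proof (intro CollectI conjI allI impI assms(3))
  fix e :: real assume "e > 0"
  with assms(4) have "\<forall>\<^sub>F n in sequentially. l2_norm M (\<lambda>x. s n x - f x) < e / 2"
    using \<open>e > 0\<close> by (intro order_tendstoD) auto
  then obtain n where n: "l2_norm M (\<lambda>x. s n x - f x) < e / 2"
    using eventually_happens' sequentially_bot by blast
  obtain g where g: "g \<in> S" "l2_norm M (\<lambda>x. s n x - g x) < e / 2"
    using l2_closureE[OF assms(1)] half_gt_zero[OF \<open>e > 0\<close>] by metis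
  have "l2_norm M (\<lambda>x. f x - g x) \<le> l2_norm M (\<lambda>x. f x - s n x) + l2_norm M (\<lambda>x. s n x - g x)"
    using assms(1)[of n] g(1) assms(2,3)
    by (intro l2_norm_diff_triangle) (auto simp: l2_closure_def)
  also have "\<dots> < e" using n g(2) by (simp add: l2_norm_minus_commute[of M f])
  finally show "\<exists>g\<in>S. l2_norm M (\<lambda>x. f x - g x) < e"
    using g(1) by (intro bexI[of _ g])
qed

lemma l2_closure_add:
  assumes f: "f \<in> l2_closure M S" and g: "g \<in> l2_closure M S" and S: "S \<subseteq> L2 M"
    and add: "\<And>u v. u \<in> S \<Longrightarrow> v \<in> S \<Longrightarrow> (\<lambda>x. u x + v x) \<in> S"
  shows "(\<lambda>x. f x + g x) \<in> l2_closure M S"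
  unfolding l2_closure_def
proof (intro CollectI conjI allI impI)
  show "(\<lambda>x. f x + g x) \<in> L2 M" using f g by (auto simp: l2_closure_def intro: L2_add)
  fix e :: real assume "e > 0"
  then obtain u v where u: "u \<in> S" "l2_norm M (\<lambda>x. f x - u x) < e / 2"
    and v: "v \<in> S" "l2_norm M (\<lambda>x. g x - v x) < e / 2"
    using l2_closureE[OF f] l2_closureE[OF g] half_gt_zero by metis
  have "l2_norm M (\<lambda>x. (f x - u x) + (g x - v x)) \<le> l2_norm M (\<lambda>x. f x - u x) + l2_norm M (\<lambda>x. g x - v x)"
    using f g u v S by (intro l2_norm_triangle L2_diff) (auto simp: l2_closure_def)
  then have "l2_norm M (\<lambda>x. (f x + g x) - (u x + v x)) < e"
    using u v by (simp add: algebra_simps)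
  then show "\<exists>h\<in>S. l2_norm M (\<lambda>x. f x + g x - h x) < e"
    using add[OF u(1) v(1)] by (intro bexI[of _ "\<lambda>x. u x + v x"])
qed

lemma l2_closure_cmult:
  assumes f: "f \<in> l2_closure M S"
    and cmult: "\<And>u. u \<in> S \<Longrightarrow> (\<lambda>x. c * u x) \<in> S"
  shows "(\<lambda>x. c * f x) \<in> l2_closure M S"
  unfolding l2_closure_def
proof (intro CollectI conjI allI impI)
  show "(\<lambda>x. c * f x) \<in> L2 M" using f by (auto simp: l2_closure_def intro: L2_cmult)
  fix e :: real assume "e > 0"
  then have "e / (cmod c + 1) > 0" by (simp add: add_nonneg_pos)
  then obtain u where u: "u \<in> S" "l2_norm M (\<lambda>x. f x - u x) < e / (cmod c + 1)"
    using l2_closureE[OF f] by metis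
  have "l2_norm M (\<lambda>x. c * f x - c * u x) = cmod c * l2_norm M (\<lambda>x. f x - u x)"
    by (simp flip: l2_norm_cmult right_diff_distrib)
  also have "\<dots> \<le> (cmod c + 1) * l2_norm M (\<lambda>x. f x - u x)"
    by (intro mult_right_mono) auto
  also have "\<dots> < e"
    using u(2) by (simp add: pos_less_divide_eq add_nonneg_pos mult.commute)
  finally show "\<exists>h\<in>S. l2_norm M (\<lambda>x. c * f x - h x) < e"
    using cmult[OF u(1)] by (intro bexI[of _ "\<lambda>x. c * u x"])
qed

text \<open>
  Strong convergence of uniformly bounded operators may be checked on a dense set, by the usual
  three-term estimate.
\<close>

lemma l2_contractions_tendsto:
  assumes TL: "\<And>n f. f \<in> L2 M \<Longrightarrow> T n f \<in> L2 M"
    and contr: "\<And>n f g. f \<in> L2 M \<Longrightarrow> g \<in> L2 M \<Longrightarrow>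
        l2_norm M (\<lambda>x. T n f x - T n g x) \<le> l2_norm M (\<lambda>x. f x - g x)"
    and S: "S \<subseteq> L2 M" "\<And>g. g \<in> S \<Longrightarrow> (\<lambda>n::nat. l2_norm M (\<lambda>x. T n g x - g x)) \<longlonglongrightarrow> 0"
    and f: "f \<in> l2_closure M S"
  shows "(\<lambda>n. l2_norm M (\<lambda>x. T n f x - f x)) \<longlonglongrightarrow> 0"
proof (rule LIMSEQ_I)
  fix e :: real assume e: "e > 0"
  then have "e / 3 > 0" by simp
  from l2_closureE[OF f this] obtain g where g: "g \<in> S" "l2_norm M (\<lambda>x. f x - g x) < e / 3" by metis
  have L: "f \<in> L2 M" "g \<in> L2 M" using f g S(1) by (auto simp: l2_closure_def)
  obtain N where N: "\<And>n. n \<ge> N \<Longrightarrow> norm (l2_norm M (\<lambda>x. T n g x - g x) - 0) < e / 3"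
    using LIMSEQ_D[OF S(2)[OF g(1)] \<open>e / 3 > 0\<close>] by metis
  have "norm (l2_norm M (\<lambda>x. T n f x - f x) - 0) < e" if "n \<ge> N" for n
  proof -
    have "l2_norm M (\<lambda>x. T n f x - f x) \<le> l2_norm M (\<lambda>x. T n f x - T n g x) + l2_norm M (\<lambda>x. T n g x - f x)"
      by (intro l2_norm_diff_triangle TL L)
    also have "l2_norm M (\<lambda>x. T n g x - f x) \<le> l2_norm M (\<lambda>x. T n g x - g x) + l2_norm M (\<lambda>x. g x - f x)"
      by (intro l2_norm_diff_triangle TL L)
    finally show ?thesis
      using contr[OF L, of n] N[OF that] g(2) by (simp add: l2_norm_minus_commute[of M g])
  qed
  then show "\<exists>N. \<forall>n\<ge>N. norm (l2_norm M (\<lambda>x. T n f x - f x) - 0) < e" by blast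
qed

section \<open>Adjoint and closure of symmetric operators\<close>

lemma op_symmetricD:
  assumes "op_symmetric M T" "(f, f') \<in> T" "(g, g') \<in> T"
  shows "l2_inner M f' g = l2_inner M f g'"
proof -
  have "\<forall>(g, g')\<in>T. l2_inner M f' g = l2_inner M f g'"
    using bspec[OF assms(1)[unfolded op_symmetric_def] assms(2)] by simp
  from bspec[OF this assms(3)] show ?thesis by simp
qed

lemma op_symmetric_subset:
  assumes "op_symmetric M T" "S \<subseteq> T"
  shows "op_symmetric M S"
  unfolding op_symmetric_def
proof clarify
  fix f f' g g' assume "(f, f') \<in> S" "(g, g') \<in> S"
  then show "l2_inner M f' g = l2_inner M f g'"
    using assms(2) by (intro op_symmetricD[OF assms(1)]) auto
qed

lemma op_adjointI:
  assumes "g \<in> L2 M" "g' \<in> L2 M" "\<And>f f'. (f, f') \<in> T \<Longrightarrow> l2_inner M f' g = l2_inner M f g'"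
  shows "(g, g') \<in> op_adjoint M T"
  using assms by (simp add: op_adjoint_def split_beta)

lemma op_adjoint_antimono: "S \<subseteq> T \<Longrightarrow> op_adjoint M T \<subseteq> op_adjoint M S"
  by (auto simp: op_adjoint_def)

lemma op_symmetric_subset_adjoint:
  assumes "op_symmetric M T" "T \<subseteq> L2 M \<times> L2 M"
  shows "T \<subseteq> op_adjoint M T"
proof (rule subrelI)
  fix g g' assume g: "(g, g') \<in> T"
  then show "(g, g') \<in> op_adjoint M T"
    using assms(2) by (intro op_adjointI op_symmetricD[OF assms(1) _ g]) auto
qed

text \<open>
  The adjoint is closed and contains a symmetric operator, hence contains its closure; both sides of
  the symmetry relation pass to limits by Cauchy-Schwarz.
\<close>

lemma op_closure_subset_adjoint:
  assumes sym: "op_symmetric M T" and T: "T \<subseteq> L2 M \<times> L2 M"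
  shows "op_closure M T \<subseteq> op_adjoint M T"
proof (rule subrelI)
  fix f f' assume ff: "(f, f') \<in> op_closure M T"
  then have f: "f \<in> L2 M" "f' \<in> L2 M" by (auto simp: op_closure_def)
  have "l2_inner M u' f = l2_inner M u f'" if u: "(u, u') \<in> T" for u u'
  proof -
    have uL: "u \<in> L2 M" "u' \<in> L2 M" using u T by auto
    have "cmod (l2_inner M u' f - l2_inner M u f') \<le> 0 + e" if e: "e > 0" for e
    proof -
      define K where "K = l2_norm M u' + l2_norm M u + 1"
      have K: "K > 0" by (simp add: K_def add_nonneg_pos)
      then have "e / K > 0" using e by simp
      then obtain g g' where g: "(g, g') \<in> T" "l2_norm M (\<lambda>x. f x - g x) < e / K" "l2_norm M (\<lambda>x. f' x - g' x) < e / K"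
        using ff unfolding op_closure_def by (simp add: split_beta) (metis prod.collapse)
      have gL: "g \<in> L2 M" "g' \<in> L2 M" using g T by auto
      have "l2_inner M u' g = l2_inner M u g'"
        by (rule op_symmetricD[OF sym u g(1)])
      then have "l2_inner M u' f - l2_inner M u f' = l2_inner M u' (\<lambda>x. f x - g x) - l2_inner M u (\<lambda>x. f' x - g' x)"
        by (simp add: l2_inner_diff_right f gL uL)
      then have "cmod (l2_inner M u' f - l2_inner M u f')
          \<le> cmod (l2_inner M u' (\<lambda>x. f x - g x)) + cmod (l2_inner M u (\<lambda>x. f' x - g' x))"
        by (simp only: norm_triangle_ineq4)
      also have "\<dots> \<le> l2_norm M u' * l2_norm M (\<lambda>x. f x - g x) + l2_norm M u * l2_norm M (\<lambda>x. f' x - g' x)"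
        by (intro add_mono l2_Cauchy_Schwarz L2_diff f gL uL)
      also have "\<dots> \<le> l2_norm M u' * (e / K) + l2_norm M u * (e / K)"
        using g by (intro add_mono mult_left_mono) auto
      also have "\<dots> \<le> K * (e / K)"
        unfolding distrib_right[symmetric] using \<open>e / K > 0\<close> by (intro mult_right_mono) (auto simp: K_def)
      also have "\<dots> = e" using K by simp
      finally show ?thesis by simp
    qed
    then have "cmod (l2_inner M u' f - l2_inner M u f') \<le> 0" by (rule field_le_epsilon)
    then show ?thesis by simp
  qed
  then show "(f, f') \<in> op_adjoint M T" by (rule op_adjointI[OF f])
qed

section \<open>Smooth functions with compact support\<close>

lemma smoothD:
  assumes "smooth f"
  obtains D where "D 0 = f" "\<And>n x. (D n has_vector_derivative D (Suc n) x) (at x)"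
  using assms by (auto simp: smooth_def)

lemma smooth_zero: "smooth (\<lambda>x. 0)"
  unfolding smooth_def by (rule exI[of _ "\<lambda>n x. 0"]) auto

lemma smooth_add:
  assumes "smooth f" "smooth g"
  shows "smooth (\<lambda>x. f x + g x)"
proof -
  obtain D E where "D 0 = f" "\<And>n x. (D n has_vector_derivative D (Suc n) x) (at x)"
    "E 0 = g" "\<And>n x. (E n has_vector_derivative E (Suc n) x) (at x)"
    using smoothD[OF assms(1)] smoothD[OF assms(2)] by metis
  then show ?thesis
    unfolding smooth_def
    by (intro exI[of _ "\<lambda>n x. D n x + E n x"]) (auto intro: has_vector_derivative_add)
qed

lemma smooth_cmult:
  assumes "smooth f"
  shows "smooth (\<lambda>x. c * f x)"
proof -
  obtain D where "D 0 = f" "\<And>n x. (D n has_vector_derivative D (Suc n) x) (at x)"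
    using smoothD[OF assms] by metis
  then show ?thesis
    unfolding smooth_def
    by (intro exI[of _ "\<lambda>n x. c * D n x"]) (auto intro: has_vector_derivative_mult_right)
qed

lemma smooth_translate:
  assumes "smooth f"
  shows "smooth (\<lambda>x. f (x - a))"
proof -
  obtain D where D: "D 0 = f" "\<And>n x. (D n has_vector_derivative D (Suc n) x) (at x)"
    using smoothD[OF assms] by metis
  have "((\<lambda>x. D n (x - a)) has_vector_derivative D (Suc n) (x - a)) (at x)" for n x
  proof -
    have "((D n \<circ> (\<lambda>x. x - a)) has_vector_derivative 1 *\<^sub>R D (Suc n) (x - a)) (at x)"
      by (rule vector_diff_chain_at) (auto intro!: derivative_eq_intros D(2))
    then show ?thesis by (simp add: o_def)
  qed
  then show ?thesis
    unfolding smooth_def by (intro exI[of _ "\<lambda>n x. D n (x - a)"]) (auto simp: D(1))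
qed

lemma smooth_imp_continuous_on: "smooth f \<Longrightarrow> continuous_on A f"
  by (erule smoothD) (metis continuous_at_imp_continuous_on has_vector_derivative_continuous)

text \<open>
  For a quadratic \<open>p\<close> that is positive exactly between its zeros, \<open>exp (- 1 / p)\<close> extended by zero is
  the usual bump function. The factor \<open>q / p\<^sup>k\<close> makes this class of functions closed under
  differentiation, so that all derivatives of a bump can be written down at once.
\<close>

definition poly_bump :: "real poly \<Rightarrow> real poly \<Rightarrow> nat \<Rightarrow> real \<Rightarrow> real" where
  "poly_bump p q k x = (if poly p x > 0 then poly q x / poly p x ^ k * exp (- 1 / poly p x) else 0)"

text \<open>
  A single term of the exponential series at \<open>1 / u\<close> beats any power of \<open>u\<close>.
\<close>

lemma exp_minus_inverse_le:
  fixes u :: real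
  assumes "u > 0"
  shows "exp (- 1 / u) / u ^ k \<le> fact (k + 2) * u\<^sup>2"
proof -
  have "(\<Sum>n\<in>{k + 2}. (1 / u) ^ n /\<^sub>R fact n) \<le> (\<Sum>n. (1 / u) ^ n /\<^sub>R fact n)"
    using assms by (intro sum_le_suminf summable_exp_generic) auto
  then have "(1 / u) ^ (k + 2) / fact (k + 2) \<le> exp (1 / u)"
    by (simp add: exp_def divide_inverse mult.commute del: fact_Suc power_Suc)
  moreover have "(1 / u) ^ (k + 2) / fact (k + 2) = 1 / (fact (k + 2) * u\<^sup>2 * u ^ k)"
    using assms by (simp add: power_add power_divide power2_eq_square mult_ac del: fact_Suc)
  moreover have "fact (k + 2) * u\<^sup>2 * u ^ k > 0"
    using assms by simp
  ultimately have "1 \<le> exp (1 / u) * (fact (k + 2) * u\<^sup>2 * u ^ k)"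
    by (metis pos_divide_le_eq)
  then show ?thesis
    using assms by (simp add: exp_minus divide_simps mult_ac del: fact_Suc)
qed

text \<open>
  Where \<open>p\<close> is positive this is the quotient rule, and where it is negative the function vanishes
  locally. At a zero of \<open>p\<close> both the function and the claimed
  derivative vanish, and the difference quotient is squeezed to zero because the function is bounded
  by a multiple of \<open>p\<^sup>2\<close> nearby.
\<close>

lemma poly_bump_deriv:
  "(poly_bump p q k has_real_derivative
     poly_bump p (pderiv q * p\<^sup>2 - of_nat k * q * pderiv p * p + q * pderiv p) (k + 2) x) (at x)"
proof -
  let ?r = "pderiv q * p\<^sup>2 - of_nat k * q * pderiv p * p + q * pderiv p"
  have cont: "(poly p \<longlongrightarrow> poly p x) (at x)" for p :: "real poly" and x
    using poly_isCont[of x p] by (simp add: isCont_def)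
  consider "poly p x > 0" | "poly p x < 0" | "poly p x = 0" by linarith
  then show ?thesis
  proof cases
    case 1
    let ?u = "poly p x"
    have ev: "\<forall>\<^sub>F y in nhds x. poly p y > 0"
      using order_tendstoD(1)[OF poly_isCont[of x p, unfolded isCont_def tendsto_at_iff_tendsto_nhds] 1] .
    have "((\<lambda>y. poly q y / poly p y ^ k * exp (- 1 / poly p y)) has_real_derivative
       ((poly (pderiv q) x * ?u ^ k - poly q x * (of_nat k * ?u ^ (k - 1) * poly (pderiv p) x)) / (?u ^ k * ?u ^ k)
         * exp (- 1 / ?u)
        + poly q x / ?u ^ k * (exp (- 1 / ?u) * (poly (pderiv p) x / (?u * ?u))))) (at x)"
      using 1 by (auto intro!: derivative_eq_intros simp: field_simps)
    moreover have "((poly (pderiv q) x * ?u ^ k - poly q x * (of_nat k * ?u ^ (k - 1) * poly (pderiv p) x)) / (?u ^ k * ?u ^ k)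
         * exp (- 1 / ?u)
        + poly q x / ?u ^ k * (exp (- 1 / ?u) * (poly (pderiv p) x / (?u * ?u)))) = poly_bump p ?r (k + 2) x"
      using 1 by (cases k) (simp_all add: poly_bump_def field_simps power2_eq_square of_nat_poly)
    moreover have "\<forall>\<^sub>F y in nhds x. poly_bump p q k y = poly q y / poly p y ^ k * exp (- 1 / poly p y)"
      using ev by eventually_elim (simp add: poly_bump_def)
    ultimately show ?thesis
      by (subst DERIV_cong_ev[OF refl _ refl]) auto
  next
    case 2
    have "\<forall>\<^sub>F y in nhds x. poly p y < 0"
      using order_tendstoD(2)[OF poly_isCont[of x p, unfolded isCont_def tendsto_at_iff_tendsto_nhds] 2] .
    then have "\<forall>\<^sub>F y in nhds x. poly_bump p q k y = 0"
      by eventually_elim (simp add: poly_bump_def)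
    then show ?thesis
      using 2 by (subst DERIV_cong_ev[OF refl _ refl, of _ "\<lambda>_. 0"]) (auto simp: poly_bump_def)
  next
    case 3
    define B where "B y = fact (k + 2) * \<bar>poly q y\<bar> * \<bar>poly p y\<bar> * \<bar>(poly p y - poly p x) / (y - x)\<bar>" for y
    have "((\<lambda>y. (poly p y - poly p x) / (y - x)) \<longlongrightarrow> poly (pderiv p) x) (at x)"
      using poly_DERIV[of p x] by (simp add: has_field_derivative_iff)
    then have "(B \<longlongrightarrow> fact (k + 2) * \<bar>poly q x\<bar> * \<bar>poly p x\<bar> * \<bar>poly (pderiv p) x\<bar>) (at x)"
      unfolding B_def by (intro tendsto_intros cont)
    then have B: "(B \<longlongrightarrow> 0) (at x)" using 3 by simp
    have le: "norm ((poly_bump p q k y - poly_bump p q k x) / (y - x)) \<le> B y" for y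
    proof (cases "poly p y > 0")
      case True
      have "\<bar>poly_bump p q k y\<bar> = \<bar>poly q y\<bar> * (exp (- 1 / poly p y) / poly p y ^ k)"
        using True by (simp add: poly_bump_def abs_mult)
      also have "\<dots> \<le> \<bar>poly q y\<bar> * (fact (k + 2) * (poly p y)\<^sup>2)"
        by (intro mult_left_mono exp_minus_inverse_le True) auto
      finally have "\<bar>poly_bump p q k y\<bar> / \<bar>y - x\<bar> \<le> \<bar>poly q y\<bar> * (fact (k + 2) * (poly p y)\<^sup>2) / \<bar>y - x\<bar>"
        by (rule divide_right_mono) simp
      also have "\<dots> = B y"
        using True 3 by (simp add: B_def power2_eq_square abs_mult)
      finally show ?thesis using 3 by (simp add: poly_bump_def)
    next
      case False
      then have "B y \<ge> 0" unfolding B_def by (intro mult_nonneg_nonneg) auto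
      then show ?thesis using False 3 by (simp add: poly_bump_def)
    qed
    have "((\<lambda>y. (poly_bump p q k y - poly_bump p q k x) / (y - x)) \<longlongrightarrow> 0) (at x)"
      by (rule Lim_null_comparison[OF always_eventually B]) (rule allI, rule le)
    then show ?thesis using 3 by (simp add: has_field_derivative_iff poly_bump_def)
  qed
qed

lemma smooth_poly_bump: "smooth (\<lambda>x. of_real (poly_bump p q k x))"
proof -
  define step where "step = (\<lambda>(q :: real poly, k). (pderiv q * p\<^sup>2 - of_nat k * q * pderiv p * p + q * pderiv p, k + 2 :: nat))"
  define E where "E n = poly_bump p (fst ((step ^^ n) (q, k))) (snd ((step ^^ n) (q, k)))" for n
  have "(E n has_real_derivative E (Suc n) x) (at x)" for n x
    unfolding E_def funpow.simps o_def using poly_bump_deriv[of p "fst ((step ^^ n) (q, k))" "snd ((step ^^ n) (q, k))" x]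
    by (simp add: step_def split_beta)
  then have "((\<lambda>x. complex_of_real (E n x)) has_vector_derivative of_real (E (Suc n) x)) (at x)" for n x
    by (intro has_vector_derivative_of_real) (simp add: has_real_derivative_iff_has_vector_derivative)
  then show ?thesis
    unfolding smooth_def by (intro exI[of _ "\<lambda>n x. of_real (E n x)"]) (auto simp: E_def)
qed

text \<open>
  A compact subset of \<open>(0, \<infinity>)\<close> stays away from zero, so the support condition amounts to vanishing
  outside an interval \<open>[a, b]\<close> with \<open>a > 0\<close>.
\<close>

lemma C_comp_iff:
  "\<phi> \<in> C_comp \<longleftrightarrow> smooth \<phi> \<and> (\<exists>a b. 0 < a \<and> (\<forall>t. t \<notin> {a..b} \<longrightarrow> \<phi> t = 0))"
proof safe
  assume \<phi>: "\<phi> \<in> C_comp"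
  then show "smooth \<phi>" by (simp add: C_comp_def)
  let ?K = "closure {t. \<phi> t \<noteq> 0}"
  show "\<exists>a b. 0 < a \<and> (\<forall>t. t \<notin> {a..b} \<longrightarrow> \<phi> t = 0)"
  proof (cases "?K = {}")
    case True
    then have "\<phi> t = 0" for t by auto
    then show ?thesis by (intro exI[of _ 1]) auto
  next
    case False
    have K: "compact ?K" "?K \<subseteq> {0<..}" using \<phi> by (auto simp: C_comp_def)
    obtain a where a: "a \<in> ?K" "\<And>t. t \<in> ?K \<Longrightarrow> a \<le> t" using compact_attains_inf[OF K(1) False] by blast
    obtain b where b: "\<And>t. t \<in> ?K \<Longrightarrow> t \<le> b" using compact_attains_sup[OF K(1) False] by blast
    have "\<phi> t = 0" if "t \<notin> {a..b}" for t
      using that a(2)[of t] b[of t] closure_subset[of "{t. \<phi> t \<noteq> 0}"] by (auto simp: subset_iff)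
    with a(1) K(2) show ?thesis by (intro exI[of _ a] exI[of _ b]) auto
  qed
next
  fix a b :: real assume s: "smooth \<phi>" and a: "0 < a" and z: "\<forall>t. t \<notin> {a..b} \<longrightarrow> \<phi> t = 0"
  have sub: "closure {t. \<phi> t \<noteq> 0} \<subseteq> {a..b}"
    by (rule closure_minimal) (use z in auto)
  then have "compact (closure {t. \<phi> t \<noteq> 0})"
    by (meson bounded_closed_interval bounded_subset closed_closure compact_eq_bounded_closed)
  with sub a s show "\<phi> \<in> C_comp" by (auto simp: C_comp_def)
qed

lemma C_compE:
  assumes "\<phi> \<in> C_comp"
  obtains a b where "0 < a" "a \<le> b" "\<And>t. t \<notin> {a..b} \<Longrightarrow> \<phi> t = 0"
proof -
  obtain a b where ab: "0 < a" "\<And>t. t \<notin> {a..b} \<Longrightarrow> \<phi> t = 0"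
    using assms unfolding C_comp_iff by blast
  have "\<phi> t = 0" if "t \<notin> {a..max a b}" for t
    using that ab(2)[of t] by (auto simp: max_def split: if_splits)
  then show ?thesis using that[of a "max a b"] ab(1) by auto
qed

lemma C_comp_zero: "(\<lambda>x. 0) \<in> C_comp"
  unfolding C_comp_iff by (auto simp: smooth_zero intro: exI[of _ 1])

lemma C_comp_add:
  assumes "f \<in> C_comp" "g \<in> C_comp" shows "(\<lambda>x. f x + g x) \<in> C_comp"
proof -
  obtain a b where ab: "0 < a" "\<And>t. t \<notin> {a..b} \<Longrightarrow> f t = 0" using C_compE[OF assms(1)] by metis
  obtain c d where cd: "0 < c" "\<And>t. t \<notin> {c..d} \<Longrightarrow> g t = 0" using C_compE[OF assms(2)] by metis
  have "f t + g t = 0" if "t \<notin> {min a c..max b d}" for t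
    using that ab(2)[of t] cd(2)[of t] by (auto simp: min_def max_def split: if_splits)
  then have "0 < min a c \<and> (\<forall>t. t \<notin> {min a c..max b d} \<longrightarrow> f t + g t = 0)"
    using ab(1) cd(1) by auto
  then show ?thesis
    using assms unfolding C_comp_iff by (blast intro: smooth_add)
qed

lemma C_comp_cmult:
  assumes "f \<in> C_comp" shows "(\<lambda>x. c * f x) \<in> C_comp"
proof -
  obtain a b where ab: "0 < a" "\<And>t. t \<notin> {a..b} \<Longrightarrow> f t = 0" using C_compE[OF assms] by metis
  then have "0 < a \<and> (\<forall>t. t \<notin> {a..b} \<longrightarrow> c * f t = 0)" by auto
  then show ?thesis using assms smooth_cmult unfolding C_comp_iff by blast
qed

lemma C_comp_sum: "(\<And>i. i \<in> I \<Longrightarrow> f i \<in> C_comp) \<Longrightarrow> (\<lambda>x. \<Sum>i\<in>I. f i x) \<in> C_comp"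
  by (induction I rule: infinite_finite_induct) (auto simp: C_comp_zero intro: C_comp_add)

lemma C_comp_translate:
  assumes "f \<in> C_comp" "0 \<le> r" shows "(\<lambda>x. f (x - r)) \<in> C_comp"
proof -
  obtain a b where ab: "0 < a" "\<And>t. t \<notin> {a..b} \<Longrightarrow> f t = 0" using C_compE[OF assms(1)] by metis
  then have "0 < a + r \<and> (\<forall>t. t \<notin> {a + r..b + r} \<longrightarrow> f (t - r) = 0)" using assms(2) by auto
  then show ?thesis using assms(1) smooth_translate unfolding C_comp_iff by blast
qed

lemma C_comp_bounded:
  assumes "f \<in> C_comp" obtains B where "0 \<le> B" "\<And>t. cmod (f t) \<le> B"
proof -
  obtain a b where ab: "0 < a" "\<And>t. t \<notin> {a..b} \<Longrightarrow> f t = 0" using C_compE[OF assms] by metis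
  have "compact (f ` {a..b})"
    using assms by (intro compact_continuous_image smooth_imp_continuous_on) (auto simp: C_comp_def)
  then obtain B where B: "\<And>t. t \<in> {a..b} \<Longrightarrow> cmod (f t) \<le> B"
    using compact_imp_bounded bounded_iff by (metis imageI)
  show ?thesis
    by (rule that[of "max 0 B"]) (use B ab(2) in \<open>fastforce simp: le_max_iff_disj\<close>)+
qed

lemma C_comp_borel [measurable_dest]: "f \<in> C_comp \<Longrightarrow> f \<in> borel_measurable borel"
  by (intro borel_measurable_continuous_onI smooth_imp_continuous_on) (simp add: C_comp_def)

lemma indicator_square_integrable:
  "integrable Rplus (\<lambda>x. (c * indicator {a..b} x :: real)\<^sup>2)"
proof -
  have "integrable lborel (\<lambda>x::real. c\<^sup>2 * indicator {a..b} x :: real)" by (cases "a \<le> b") auto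
  then have "integrable lborel (\<lambda>x. indicator {0<..} x *\<^sub>R (c\<^sup>2 * indicator {a..b} x :: real))"
    by (intro integrable_mult_indicator) auto
  then have "integrable Rplus (\<lambda>x. c\<^sup>2 * indicator {a..b} x)"
    by (subst integrable_restrict_space) auto
  moreover have "(\<lambda>x. (c * indicator {a..b} x :: real)\<^sup>2) = (\<lambda>x. c\<^sup>2 * indicator {a..b} x)"
    by (auto simp: indicator_def power_mult_distrib)
  ultimately show ?thesis by simp
qed

lemma bounded_support_L2:
  assumes "f \<in> borel_measurable Rplus" "\<And>t. cmod (f t) \<le> B" "\<And>t. t \<notin> {a..b} \<Longrightarrow> f t = 0"
  shows "f \<in> L2 Rplus"
proof (rule L2_bounded[OF assms(1)])
  have [measurable]: "{a..b} \<in> sets borel" by simp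
  have "(\<lambda>x. complex_of_real (B * indicator {a..b} x)) \<in> borel_measurable Rplus"
    by (rule measurable_restrict_space1) measurable
  then show "(\<lambda>x. of_real (B * indicator {a..b} x)) \<in> L2 Rplus"
    using indicator_square_integrable[of B a b] by (auto simp: L2_def norm_mult power_mult_distrib)
  have "cmod (f x) \<le> cmod (of_real (B * indicator {a..b} x))" for x
    using assms(2,3)[of x] abs_ge_self[of B] by (auto simp: indicator_def)
  then show "AE x in Rplus. cmod (f x) \<le> cmod (of_real (B * indicator {a..b} x))" by simp
qed

lemma C_comp_L2: "C_comp \<subseteq> L2 Rplus"
proof
  fix f assume f: "f \<in> C_comp"
  obtain B where "\<And>t. cmod (f t) \<le> B" using C_comp_bounded[OF f] by metis
  moreover obtain a b where "\<And>t. t \<notin> {a..b} \<Longrightarrow> f t = 0" using C_compE[OF f] by metis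
  moreover have "f \<in> borel_measurable Rplus"
    by (intro measurable_restrict_space1) (use f in measurable)
  ultimately show "f \<in> L2 Rplus" by (rule bounded_support_L2[rotated])
qed

section \<open>Density of the smooth functions with compact support\<close>

lemma C_comp_in_closure: "C_comp \<subseteq> l2_closure Rplus C_comp"
proof
  fix f assume f: "f \<in> C_comp"
  have "\<exists>g\<in>C_comp. l2_norm Rplus (\<lambda>x. f x - g x) < e" if "e > 0" for e
    using f that by (intro bexI[of _ f]) auto
  then show "f \<in> l2_closure Rplus C_comp"
    using f C_comp_L2 by (auto simp: l2_closure_def)
qed

lemmas C_comp_closure_limit = l2_closure_limit[OF _ C_comp_L2]

lemma C_comp_closure_add:
  assumes "f \<in> l2_closure Rplus C_comp" "g \<in> l2_closure Rplus C_comp"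
  shows "(\<lambda>x. f x + g x) \<in> l2_closure Rplus C_comp"
  by (rule l2_closure_add[OF assms C_comp_L2 C_comp_add])

lemma C_comp_closure_cmult:
  assumes "f \<in> l2_closure Rplus C_comp"
  shows "(\<lambda>x. c * f x) \<in> l2_closure Rplus C_comp"
  by (rule l2_closure_cmult[OF assms C_comp_cmult])

lemma borel_measurable_Rplus: "f \<in> borel_measurable borel \<Longrightarrow> f \<in> borel_measurable Rplus"
  by (rule measurable_restrict_space1) simp

lemma indicator_L2:
  assumes "A \<in> sets borel" "A \<subseteq> {a..b}"
  shows "(\<lambda>t. of_real (indicator A t)) \<in> L2 Rplus"
proof (rule bounded_support_L2)
  have [measurable]: "A \<in> sets borel" by fact
  show "(\<lambda>t. complex_of_real (indicator A t)) \<in> borel_measurable Rplus"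
    by (rule borel_measurable_Rplus) measurable
  show "cmod (of_real (indicator A t)) \<le> 1" for t by (simp add: indicator_def)
  show "complex_of_real (indicator A t) = 0" if "t \<notin> {a..b}" for t
    using that assms(2) by (auto simp: indicator_def)
qed

text \<open>
  The bumps \<open>exp (- 1 / (n (t - a) (b - t)))\<close> increase to the indicator of \<open>(a, b)\<close> as \<open>n\<close> grows.
\<close>

lemma indicator_interval_in_closure:
  assumes "0 < a"
  shows "(\<lambda>t. of_real (indicator {a<..<b} t)) \<in> l2_closure Rplus C_comp"
proof -
  define p where "p n = [: - real (Suc n) * a * b, real (Suc n) * (a + b), - real (Suc n) :]" for n
  define s where "s n t = complex_of_real (poly_bump (p n) 1 0 t)" for n t
  have p: "poly (p n) t = real (Suc n) * ((t - a) * (b - t))" for n t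
    by (simp add: p_def algebra_simps)
  have pos: "poly (p n) t > 0 \<longleftrightarrow> t \<in> {a<..<b} \<and> a < b \<or> t \<in> {b<..<a}" for n t
    unfolding p by (auto simp: zero_less_mult_iff)
  show ?thesis
  proof (cases "a < b")
    case False
    then have "{a<..<b} = {}" by auto
    then show ?thesis using C_comp_in_closure C_comp_zero by auto
  next
    case True
    have ps: "poly (p n) t > 0 \<longleftrightarrow> t \<in> {a<..<b}" for n t using True by (auto simp: pos)
    have s_eq: "s n t = of_real (indicator {a<..<b} t * exp (- (inverse (real (Suc n)) * (1 / ((t - a) * (b - t))))))" for n t
      by (cases "t \<in> {a<..<b}")
         (simp_all only: s_def poly_bump_def ps, simp_all add: p divide_inverse mult_ac del: of_nat_Suc)
    have sC: "s n \<in> C_comp" for n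
    proof -
      have "smooth (s n)" unfolding s_def by (rule smooth_poly_bump)
      moreover have "0 < a \<and> (\<forall>t. t \<notin> {a..b} \<longrightarrow> s n t = 0)"
        using assms by (auto simp: s_eq)
      ultimately show ?thesis unfolding C_comp_iff by blast
    qed
    show ?thesis
    proof (rule C_comp_closure_limit)
      show "s n \<in> l2_closure Rplus C_comp" for n using sC C_comp_in_closure by auto
      show L: "(\<lambda>t. of_real (indicator {a<..<b} t)) \<in> L2 Rplus"
        by (rule indicator_L2[of _ a b]) auto
      show "(\<lambda>n. l2_norm Rplus (\<lambda>t. s n t - of_real (indicator {a<..<b} t))) \<longlonglongrightarrow> 0"
      proof (rule l2_dominated_convergence)
        show "s n \<in> borel_measurable Rplus" for n using sC[of n] C_comp_L2 by auto
        show "(\<lambda>t. complex_of_real (indicator {a<..<b} t)) \<in> borel_measurable Rplus" using L by auto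
        show "integrable Rplus (\<lambda>t. (1 * indicator {a..b} t :: real)\<^sup>2)"
          by (rule indicator_square_integrable)
        have "(\<lambda>n. s n t) \<longlonglongrightarrow> of_real (indicator {a<..<b} t)" for t
        proof -
          have "(\<lambda>n. s n t) \<longlonglongrightarrow> of_real (indicator {a<..<b} t * exp (- (0 * (1 / ((t - a) * (b - t))))))"
            unfolding s_eq by (intro tendsto_intros LIMSEQ_inverse_real_of_nat)
          then show ?thesis by simp
        qed
        then show "AE t in Rplus. (\<lambda>n. s n t) \<longlonglongrightarrow> of_real (indicator {a<..<b} t)" by simp
        have "cmod (s n t - of_real (indicator {a<..<b} t)) \<le> 1 * indicator {a..b} t" for n t
        proof (cases "t \<in> {a<..<b}")
          case t: True
          have "s n t - of_real (indicator {a<..<b} t) = of_real (exp (- (inverse (real (Suc n)) * (1 / ((t - a) * (b - t))))) - 1)"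
            using t by (simp add: s_eq del: of_nat_Suc)
          moreover have "exp (- (inverse (real (Suc n)) * (1 / ((t - a) * (b - t))))) \<le> 1"
            using t by (simp del: of_nat_Suc)
          ultimately show ?thesis using t by (simp only: norm_of_real) (auto simp: abs_le_iff)
        qed (simp add: s_eq)
        then show "AE t in Rplus. cmod (s n t - of_real (indicator {a<..<b} t)) \<le> 1 * indicator {a..b} t" for n
          by simp
      qed
    qed
  qed
qed

text \<open>
  Inside a fixed bounded interval the sets with approximable indicator form a Dynkin system, and open
  intervals are a generator of the Borel sets stable under intersection.
\<close>

lemma indicator_bounded_in_closure:
  assumes "A \<in> sets borel" "0 < a"
  shows "(\<lambda>t. of_real (indicator (A \<inter> {a<..<b}) t)) \<in> l2_closure Rplus C_comp"
proof -
  let ?G = "range (\<lambda>(x, y). {x<..<y::real})"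
  let ?P = "\<lambda>A. (\<lambda>t. complex_of_real (indicator (A \<inter> {a<..<b}) t)) \<in> l2_closure Rplus C_comp"
  have G: "sets (borel :: real measure) = sigma_sets UNIV ?G"
    unfolding borel_eq_box[where 'a=real] by (simp add: box_real split_def)
  have Int: "{x<..<y} \<inter> {x'<..<y'} = {max x x'<..<min y y'}" for x y x' y' :: real by auto
  have intv: "{x<..<y} \<in> ?G" for x y
    by (rule range_eqI[of _ _ "(x, y)"]) simp
  have "Int_stable ?G"
    by (rule Int_stableI) (use intv in \<open>auto simp only: Int split: prod.splits\<close>)
  moreover have "?G \<subseteq> Pow UNIV" by simp
  moreover have "A \<in> sigma_sets UNIV ?G" using assms(1) G by simp
  ultimately show ?thesis
  proof (induction rule: sigma_sets_induct_disjoint)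
    case (basic A)
    then obtain x y where "A = {x<..<y}" by auto
    then show ?case
      using indicator_interval_in_closure[of "max x a" "min y b"] assms(2) by (auto simp: Int)
  next
    case empty
    then show ?case using C_comp_in_closure C_comp_zero by auto
  next
    case (compl A)
    have "(\<lambda>t. of_real (indicator {a<..<b} t) + (-1) * of_real (indicator (A \<inter> {a<..<b}) t)) \<in> l2_closure Rplus C_comp"
      by (intro C_comp_closure_add C_comp_closure_cmult compl indicator_interval_in_closure assms)
    moreover have "(\<lambda>t. of_real (indicator {a<..<b} t) + (-1) * of_real (indicator (A \<inter> {a<..<b}) t))
      = (\<lambda>t. complex_of_real (indicator ((UNIV - A) \<inter> {a<..<b}) t))"
      by (auto simp: indicator_def)
    ultimately show ?case by simp
  next
    case (union A)
    let ?U = "\<lambda>n. (\<Union>i<n. A i)"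
    have split: "(\<lambda>t. complex_of_real (indicator ((B \<union> V) \<inter> I) t))
        = (\<lambda>t. of_real (indicator (V \<inter> I) t) + of_real (indicator (B \<inter> I) t))"
      if "V \<inter> B = {}" for V B I :: "real set"
      by (intro ext) (use that in \<open>auto simp: indicator_def\<close>)
    have Ab: "A i \<in> sets borel" for i using union G by auto
    have fin: "?P (?U n)" for n
    proof (induction n)
      case 0
      then show ?case using C_comp_in_closure C_comp_zero by auto
    next
      case (Suc n)
      have "?U n \<inter> A n = {}"
        using union(1) by (auto simp: disjoint_family_on_def) (metis IntI empty_iff less_irrefl)
      then have eq: "(\<lambda>t. complex_of_real (indicator (?U (Suc n) \<inter> {a<..<b}) t))
        = (\<lambda>t. of_real (indicator (?U n \<inter> {a<..<b}) t) + of_real (indicator (A n \<inter> {a<..<b}) t))"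
        unfolding lessThan_Suc UN_insert by (rule split)
      show ?case
        unfolding eq by (rule C_comp_closure_add[OF Suc union(3)])
    qed
    show ?case
    proof (rule C_comp_closure_limit[OF fin])
      have "(\<Union>i. A i) \<inter> {a<..<b} \<in> sets borel" "(\<Union>i<n. A i) \<inter> {a<..<b} \<in> sets borel" for n
        using Ab by (intro sets.Int sets.countable_UN'; auto)+
      note [measurable] = this
      show L: "(\<lambda>t. complex_of_real (indicator ((\<Union>i. A i) \<inter> {a<..<b}) t)) \<in> L2 Rplus"
        by (rule indicator_L2[of _ a b]) auto
      show "(\<lambda>n. l2_norm Rplus (\<lambda>t. of_real (indicator (?U n \<inter> {a<..<b}) t) - of_real (indicator ((\<Union>i. A i) \<inter> {a<..<b}) t))) \<longlonglongrightarrow> 0"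
      proof (rule l2_dominated_convergence)
        show "(\<lambda>t. complex_of_real (indicator (?U n \<inter> {a<..<b}) t)) \<in> borel_measurable Rplus" for n
          by (rule borel_measurable_Rplus) measurable
        show "(\<lambda>t. complex_of_real (indicator ((\<Union>i. A i) \<inter> {a<..<b}) t)) \<in> borel_measurable Rplus"
          using L by auto
        show "integrable Rplus (\<lambda>t. (1 * indicator {a..b} t :: real)\<^sup>2)"
          by (rule indicator_square_integrable)
        have "(\<lambda>n. complex_of_real (indicator (?U n \<inter> {a<..<b}) t)) \<longlonglongrightarrow> of_real (indicator ((\<Union>i. A i) \<inter> {a<..<b}) t)" for t
          using tendsto_of_real[OF tendsto_mult_left[OF LIMSEQ_indicator_UN[of A t], of "indicator {a<..<b} t"]]
          by (simp add: indicator_inter_arith mult.commute)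
        then show "AE t in Rplus. (\<lambda>n. complex_of_real (indicator (?U n \<inter> {a<..<b}) t)) \<longlonglongrightarrow> of_real (indicator ((\<Union>i. A i) \<inter> {a<..<b}) t)"
          by simp
        show "AE t in Rplus. cmod (of_real (indicator (?U n \<inter> {a<..<b}) t) - of_real (indicator ((\<Union>i. A i) \<inter> {a<..<b}) t)) \<le> 1 * indicator {a..b} t" for n
          by (intro always_eventually) (auto simp: indicator_def)
      qed
    qed
  qed
qed

lemma sets_Rplus_borel: "A \<in> sets Rplus \<Longrightarrow> A \<in> sets borel \<and> A \<subseteq> {0<..}"
  by (auto simp: sets_restrict_space)

lemma indicator_in_closure:
  assumes "A \<in> sets Rplus" "(\<lambda>t. of_real (indicator A t)) \<in> L2 Rplus"
  shows "(\<lambda>t. of_real (indicator A t)) \<in> l2_closure Rplus C_comp"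
proof -
  define I where "I n = {inverse (real (Suc n))<..<real (Suc n)}" for n
  define s where "s n t = complex_of_real (indicator (A \<inter> I n) t)" for n t
  have A: "A \<in> sets borel" "A \<subseteq> {0<..}" using sets_Rplus_borel[OF assms(1)] by auto
  show ?thesis
  proof (rule C_comp_closure_limit[OF _ assms(2)])
    show sc: "s n \<in> l2_closure Rplus C_comp" for n
      unfolding s_def I_def by (rule indicator_bounded_in_closure[OF A(1)]) simp
    show "(\<lambda>n. l2_norm Rplus (\<lambda>t. s n t - of_real (indicator A t))) \<longlonglongrightarrow> 0"
    proof (rule l2_dominated_convergence)
      show "s n \<in> borel_measurable Rplus" for n using sc by (auto simp: l2_closure_def)
      show "(\<lambda>t. complex_of_real (indicator A t)) \<in> borel_measurable Rplus" using assms(2) by auto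
      show "integrable Rplus (\<lambda>t. (indicator A t)\<^sup>2 :: real)"
        using L2D(2)[OF assms(2)] by simp
      have "(\<lambda>n. s n t) \<longlonglongrightarrow> of_real (indicator A t)" for t
      proof (cases "t \<in> A")
        case True
        then have "t > 0" using A by auto
        have "\<forall>\<^sub>F n in sequentially. inverse (real (Suc n)) < t"
          by (rule order_tendstoD(2)[OF LIMSEQ_inverse_real_of_nat \<open>t > 0\<close>])
        moreover have "\<forall>\<^sub>F n in sequentially. real n > t"
          using filterlim_real_sequentially by (auto simp: filterlim_at_top_dense)
        ultimately have "\<forall>\<^sub>F n in sequentially. s n t = of_real (indicator A t)"
          by eventually_elim (use True in \<open>auto simp: s_def I_def\<close>)
        then show ?thesis by (rule tendsto_eventually)
      qed (simp add: s_def)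
      then show "AE t in Rplus. (\<lambda>n. s n t) \<longlonglongrightarrow> of_real (indicator A t)" by simp
      show "AE t in Rplus. cmod (s n t - of_real (indicator A t)) \<le> indicator A t" for n
        by (intro always_eventually) (auto simp: s_def indicator_def)
    qed
  qed
qed

text \<open>
  Induction over the construction of measurable functions works for square integrability because all
  functions involved are nonnegative: summands and members of an increasing sequence are dominated
  by the final function, hence again square integrable.
\<close>

lemma nonneg_in_closure:
  assumes "u \<in> borel_measurable Rplus" "\<And>x. 0 \<le> u x" "(\<lambda>t. of_real (u t)) \<in> L2 Rplus"
  shows "(\<lambda>t. of_real (u t)) \<in> l2_closure Rplus C_comp"
  using assms
proof (induction u rule: borel_measurable_induct_real)
  case (set A)
  then show ?case by (intro indicator_in_closure)
next
  case (mult u c)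
  show ?case
  proof (cases "c = 0")
    case True
    then show ?thesis using C_comp_in_closure C_comp_zero by auto
  next
    case False
    then have "(\<lambda>t. complex_of_real (u t)) \<in> L2 Rplus"
      using L2_cmult[OF mult.prems, of "of_real (1 / c)"] by simp
    from C_comp_closure_cmult[OF mult.IH[OF this], of "of_real c"] show ?thesis by simp
  qed
next
  case (add u v)
  note [measurable] = add.hyps(1,3)
  have bd: "cmod (of_real (u t)) \<le> cmod (of_real (v t + u t))"
      "cmod (of_real (v t)) \<le> cmod (of_real (v t + u t))" for t
    using add.hyps(2)[of t] add.hyps(4)[of t] unfolding norm_of_real by (simp_all only: abs_of_nonneg add_nonneg_nonneg)
  have uv: "(\<lambda>t. complex_of_real (u t)) \<in> L2 Rplus" "(\<lambda>t. complex_of_real (v t)) \<in> L2 Rplus"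
    by (rule L2_bounded[OF _ add.prems AE_I2[OF bd(1)]], measurable)
       (rule L2_bounded[OF _ add.prems AE_I2[OF bd(2)]], measurable)
  have cl: "(\<lambda>t. complex_of_real (u t)) \<in> l2_closure Rplus C_comp"
      "(\<lambda>t. complex_of_real (v t)) \<in> l2_closure Rplus C_comp"
    by (rule add.IH(1)[OF uv(1)], rule add.IH(2)[OF uv(2)])
  show ?case
    unfolding of_real_add by (rule C_comp_closure_add[OF cl(2,1)])
next
  case (seq U)
  have le: "U i x \<le> u x" if "x \<in> space Rplus" for i x
    using incseq_le[OF _ seq.hyps(4)[OF that]] seq.hyps(3) by (auto simp: incseq_def le_fun_def)
  have um: "u \<in> borel_measurable Rplus"
    by (rule borel_measurable_LIMSEQ_metric[OF seq.hyps(1,4)])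
  have "(\<lambda>t. complex_of_real (U i t)) \<in> L2 Rplus" for i
  proof (rule L2_bounded[OF _ seq.prems])
    have "cmod (of_real (U i x)) \<le> cmod (of_real (u x))" if "x \<in> space Rplus" for x
      using le[OF that, of i] seq.hyps(2)[of i x] by simp
    then show "AE x in Rplus. cmod (of_real (U i x)) \<le> cmod (of_real (u x))" by (rule AE_I2)
    show "(\<lambda>t. complex_of_real (U i t)) \<in> borel_measurable Rplus"
      using seq.hyps(1)[of i] by measurable
  qed
  then have Uc: "(\<lambda>t. complex_of_real (U i t)) \<in> l2_closure Rplus C_comp" for i by (rule seq.IH)
  show ?case
  proof (rule C_comp_closure_limit[OF Uc seq.prems])
    show "(\<lambda>n. l2_norm Rplus (\<lambda>t. of_real (U n t) - of_real (u t))) \<longlonglongrightarrow> 0"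
    proof (rule l2_dominated_convergence)
      show "(\<lambda>t. complex_of_real (U n t)) \<in> borel_measurable Rplus" for n
        using Uc[of n] by (auto simp: l2_closure_def)
      show "(\<lambda>t. complex_of_real (u t)) \<in> borel_measurable Rplus" using seq.prems by auto
      show "integrable Rplus (\<lambda>t. (u t)\<^sup>2)" using L2D(2)[OF seq.prems] by simp
      show "AE t in Rplus. (\<lambda>n. complex_of_real (U n t)) \<longlonglongrightarrow> of_real (u t)"
        using seq.hyps(4) by (intro AE_I2 tendsto_of_real)
      show "AE t in Rplus. cmod (of_real (U n t) - of_real (u t)) \<le> u t" for n
      proof (rule AE_I2)
        fix t assume "t \<in> space Rplus"
        then show "cmod (of_real (U n t) - of_real (u t)) \<le> u t"
          using le[of t n] seq.hyps(2)[of n t] by (simp flip: of_real_diff)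
      qed
    qed
  qed
qed

lemma C_comp_dense:
  assumes "f \<in> L2 Rplus" shows "f \<in> l2_closure Rplus C_comp"
proof -
  have [measurable]: "f \<in> borel_measurable Rplus" using assms by auto
  \<comment> \<open>With \<open>g = \<plusminus> Re\<close> and \<open>g = \<plusminus> Im\<close> this yields the four nonnegative parts of \<open>f\<close>.\<close>
  have part: "(\<lambda>t. of_real (max 0 (g (f t)))) \<in> l2_closure Rplus C_comp"
    if g [measurable]: "g \<in> borel_measurable borel" and le: "\<And>z. \<bar>g z\<bar> \<le> cmod z" for g
  proof (rule nonneg_in_closure)
    show "(\<lambda>t. max 0 (g (f t))) \<in> borel_measurable Rplus" by measurable
    show "(\<lambda>t. complex_of_real (max 0 (g (f t)))) \<in> L2 Rplus"
    proof (rule L2_bounded[OF _ assms])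
      show "(\<lambda>t. complex_of_real (max 0 (g (f t)))) \<in> borel_measurable Rplus" by measurable
      have "cmod (of_real (max 0 (g (f t)))) \<le> cmod (f t)" for t
        using le[of "f t"] by (auto simp: max_def)
      then show "AE t in Rplus. cmod (of_real (max 0 (g (f t)))) \<le> cmod (f t)" by simp
    qed
  qed simp
  have "(\<lambda>t. (of_real (max 0 (Re (f t))) + (-1) * of_real (max 0 (- Re (f t))))
      + (\<i> * of_real (max 0 (Im (f t))) + (- \<i>) * of_real (max 0 (- Im (f t)))))
    \<in> l2_closure Rplus C_comp"
    using abs_Re_le_cmod abs_Im_le_cmod
    by (intro C_comp_closure_add C_comp_closure_cmult part part[of "\<lambda>z. - Re z"] part[of "\<lambda>z. - Im z"]) auto
  also have "(\<lambda>t. (of_real (max 0 (Re (f t))) + (-1) * of_real (max 0 (- Re (f t))))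
      + (\<i> * of_real (max 0 (Im (f t))) + (- \<i>) * of_real (max 0 (- Im (f t))))) = f"
    by (rule ext) (auto simp: max_def complex_eq_iff)
  finally show ?thesis .
qed

lemma C_comp_approx:
  assumes "f \<in> L2 Rplus" "0 < e"
  obtains \<psi> where "\<psi> \<in> C_comp" "l2_norm Rplus (\<lambda>t. f t - \<psi> t) < e"
  using l2_closureE[OF C_comp_dense[OF assms(1)] assms(2)] by metis

lemma densely_defined_of_C_comp:
  assumes "C_comp \<subseteq> Domain T" "Domain T \<subseteq> L2 Rplus"
  shows "densely_defined Rplus T"
  unfolding densely_defined_def
proof (intro conjI assms ballI allI impI)
  fix f and e :: real assume "f \<in> L2 Rplus" "e > 0"
  then obtain \<psi> where "\<psi> \<in> C_comp" "l2_norm Rplus (\<lambda>t. f t - \<psi> t) < e" using C_comp_approx by metis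
  then show "\<exists>g\<in>Domain T. l2_norm Rplus (\<lambda>x. f x - g x) < e" using assms(1) by (intro bexI[of _ \<psi>]) auto
qed

section \<open>Translations of the half-line\<close>

text \<open>
  The indicator discards the values of \<open>f\<close> on \<open>(-\<infinity>, 0]\<close>, which would otherwise be moved into the
  half-line. Translation to the right is an isometry of \<open>L\<^sup>2(0, \<infinity>)\<close>; translation to the left is its
  adjoint and only a contraction.
\<close>

definition shiftR :: "real \<Rightarrow> (real \<Rightarrow> complex) \<Rightarrow> real \<Rightarrow> complex" where
  "shiftR a f t = indicator {a<..} t * f (t - a)"

abbreviation shiftL :: "real \<Rightarrow> (real \<Rightarrow> complex) \<Rightarrow> real \<Rightarrow> complex" where
  "shiftL a f \<equiv> \<lambda>t. f (t + a)"

lemma nn_integral_Rplus: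
  "(\<integral>\<^sup>+t. f t \<partial>Rplus) = (\<integral>\<^sup>+t. f t * indicator {0<..} t \<partial>lborel)"
  by (rule nn_integral_restrict_space) simp

lemma measurable_Rplus_plus [measurable]: "0 \<le> a \<Longrightarrow> (\<lambda>t. t + a) \<in> Rplus \<rightarrow>\<^sub>M Rplus"
  by (intro measurable_restrict_space2 measurable_restrict_space1) (auto simp: space_restrict_space)

lemma nn_integral_Rplus_shift:
  assumes f: "f \<in> borel_measurable Rplus" and a: "0 \<le> (a::real)"
  shows "(\<integral>\<^sup>+t. f (t + a) \<partial>Rplus) = (\<integral>\<^sup>+t. f t * indicator {a<..} t \<partial>Rplus)"
proof -
  define G where "G t = f t * indicator {0<..} t * indicator {a<..} t" for t
  have [measurable]: "(\<lambda>t. f t * indicator {0<..} t) \<in> borel_measurable borel"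
    using f by (subst (asm) borel_measurable_restrict_space_iff_ennreal) auto
  have G: "G \<in> borel_measurable borel" unfolding G_def by measurable
  have "(\<integral>\<^sup>+t. f (t + a) \<partial>Rplus) = (\<integral>\<^sup>+t. G (a + 1 * t) \<partial>lborel)"
    unfolding nn_integral_Rplus
    by (intro nn_integral_cong) (use a in \<open>auto simp: G_def indicator_def add.commute\<close>)
  also have "\<dots> = (\<integral>\<^sup>+t. G t \<partial>lborel)"
    using nn_integral_real_affine[OF G, of 1 a] by simp
  also have "\<dots> = (\<integral>\<^sup>+t. f t * indicator {a<..} t \<partial>Rplus)"
    unfolding nn_integral_Rplus by (intro nn_integral_cong) (auto simp: G_def indicator_def)
  finally show ?thesis .
qed

lemma shiftL_L2:
  assumes "f \<in> L2 Rplus" "0 \<le> a"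
  shows "shiftL a f \<in> L2 Rplus" "l2_norm Rplus (shiftL a f) \<le> l2_norm Rplus f"
proof -
  have f [measurable]: "f \<in> borel_measurable Rplus" using assms by auto
  have m: "shiftL a f \<in> borel_measurable Rplus"
    using measurable_Rplus_plus[OF assms(2)] by measurable
  have "(\<integral>\<^sup>+t. ennreal ((cmod (f (t + a)))\<^sup>2) \<partial>Rplus)
      = (\<integral>\<^sup>+t. ennreal ((cmod (f t))\<^sup>2) * indicator {a<..} t \<partial>Rplus)"
    by (rule nn_integral_Rplus_shift[OF _ assms(2)]) measurable
  also have "\<dots> \<le> (\<integral>\<^sup>+t. ennreal ((cmod (f t))\<^sup>2) \<partial>Rplus)"
    by (intro nn_integral_mono) (auto simp: indicator_def)
  finally have le: "(\<integral>\<^sup>+t. ennreal ((cmod (f (t + a)))\<^sup>2) \<partial>Rplus)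
    \<le> (\<integral>\<^sup>+t. ennreal ((cmod (f t))\<^sup>2) \<partial>Rplus)" .
  then show L: "shiftL a f \<in> L2 Rplus"
    using assms(1) m unfolding L2_iff_nn_integral by (auto intro: order_le_less_trans)
  show "l2_norm Rplus (shiftL a f) \<le> l2_norm Rplus f"
    by (rule l2_norm_le_if_nn_integral_le[OF L assms(1) le])
qed

lemma shiftR_L2:
  assumes "f \<in> L2 Rplus" "0 \<le> a"
  shows "shiftR a f \<in> L2 Rplus" "l2_norm Rplus (shiftR a f) = l2_norm Rplus f"
proof -
  have f: "f \<in> borel_measurable Rplus" using assms by auto
  have [measurable]: "(\<lambda>t. indicator {0<..} t *\<^sub>R f t) \<in> borel_measurable borel"
    using f by (subst (asm) borel_measurable_restrict_space_iff) auto
  have "(\<lambda>t. indicator {0<..} (t - a) *\<^sub>R f (t - a)) \<in> borel_measurable borel" by measurable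
  moreover have "(\<lambda>t. indicator {0<..} (t - a) *\<^sub>R f (t - a)) = shiftR a f"
    by (auto simp: shiftR_def indicator_def)
  ultimately have m [measurable]: "shiftR a f \<in> borel_measurable Rplus"
    by (intro borel_measurable_Rplus) simp
  have "(\<integral>\<^sup>+t. ennreal ((cmod (f t))\<^sup>2) \<partial>Rplus) = (\<integral>\<^sup>+t. ennreal ((cmod (shiftR a f (t + a)))\<^sup>2) \<partial>Rplus)"
    by (intro nn_integral_cong) (auto simp: shiftR_def space_restrict_space)
  also have "\<dots> = (\<integral>\<^sup>+t. ennreal ((cmod (shiftR a f t))\<^sup>2) * indicator {a<..} t \<partial>Rplus)"
    by (rule nn_integral_Rplus_shift[OF _ assms(2)]) measurable
  also have "\<dots> = (\<integral>\<^sup>+t. ennreal ((cmod (shiftR a f t))\<^sup>2) \<partial>Rplus)"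
    by (intro nn_integral_cong) (auto simp: shiftR_def indicator_def)
  finally have eq: "(\<integral>\<^sup>+t. ennreal ((cmod (f t))\<^sup>2) \<partial>Rplus) = (\<integral>\<^sup>+t. ennreal ((cmod (shiftR a f t))\<^sup>2) \<partial>Rplus)" .
  then show L: "shiftR a f \<in> L2 Rplus"
    using assms(1) m unfolding L2_iff_nn_integral by auto
  show "l2_norm Rplus (shiftR a f) = l2_norm Rplus f"
    using eq by (intro antisym l2_norm_le_if_nn_integral_le L assms(1)) auto
qed

lemma shiftR_diff: "shiftR a (\<lambda>x. f x - g x) = (\<lambda>t. shiftR a f t - shiftR a g t)"
  by (auto simp: shiftR_def right_diff_distrib)

lemma shiftR_C_comp:
  assumes "f \<in> C_comp" "0 \<le> a"
  shows "shiftR a f = (\<lambda>t. f (t - a))" "shiftR a f \<in> C_comp"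
proof -
  obtain c d where "0 < c" "\<And>t. t \<notin> {c..d} \<Longrightarrow> f t = 0" using C_compE[OF assms(1)] by metis
  then have "f (t - a) = 0" if "t \<le> a" for t using that by auto
  then show eq: "shiftR a f = (\<lambda>t. f (t - a))"
    by (auto simp: shiftR_def indicator_def fun_eq_iff)
  show "shiftR a f \<in> C_comp" unfolding eq by (rule C_comp_translate[OF assms])
qed

text \<open>
  The translates converge pointwise and, for shifts of size at most one, are supported in one bounded
  interval, so dominated convergence applies. Both signs of the shift occur: the two kinds of
  translation of the half-line agree with translation of the line on these functions.
\<close>

lemma C_comp_translation_tendsto:
  assumes f: "f \<in> C_comp" and c: "c \<longlonglongrightarrow> 0" "\<And>n. \<bar>c n\<bar> \<le> (1::real)"
  shows "(\<lambda>n. l2_norm Rplus (\<lambda>t. f (t + c n) - f t)) \<longlonglongrightarrow> 0"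
proof -
  obtain B where B: "0 \<le> B" "\<And>t. cmod (f t) \<le> B" using C_comp_bounded[OF f] by metis
  obtain a b where ab: "\<And>t. t \<notin> {a..b} \<Longrightarrow> f t = 0" using C_compE[OF f] by metis
  have [measurable]: "f \<in> borel_measurable borel" using f by (rule C_comp_borel)
  have cont: "isCont f t" for t
    using smooth_imp_continuous_on[of f UNIV] f by (auto simp: C_comp_def continuous_on_eq_continuous_at)
  show ?thesis
  proof (rule l2_dominated_convergence)
    show "(\<lambda>t. f (t + c n)) \<in> borel_measurable Rplus" for n by (rule borel_measurable_Rplus) measurable
    show "f \<in> borel_measurable Rplus" by (rule borel_measurable_Rplus) measurable
    show "integrable Rplus (\<lambda>t. ((2 * B) * indicator {a - 1..b + 1} t)\<^sup>2)"
      by (rule indicator_square_integrable)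
    have "(\<lambda>n. f (t + c n)) \<longlonglongrightarrow> f t" for t
    proof (rule isCont_tendsto_compose[OF cont])
      show "(\<lambda>n. t + c n) \<longlonglongrightarrow> t" using tendsto_add[OF tendsto_const c(1), of t] by simp
    qed
    then show "AE t in Rplus. (\<lambda>n. f (t + c n)) \<longlonglongrightarrow> f t" by simp
    have "cmod (f (t + c n) - f t) \<le> 2 * B * indicator {a - 1..b + 1} t" for n t
    proof (cases "t \<in> {a - 1..b + 1}")
      case True
      then show ?thesis using norm_triangle_ineq4[of "f (t + c n)" "f t"] B(2)[of t] B(2)[of "t + c n"] by simp
    next
      case False
      then have "t + c n \<notin> {a..b}" "t \<notin> {a..b}" using c(2)[of n] by auto
      then have "f (t + c n) = 0" "f t = 0" by (intro ab; simp)+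
      then show ?thesis using False by simp
    qed
    then show "AE t in Rplus. cmod (f (t + c n) - f t) \<le> 2 * B * indicator {a - 1..b + 1} t" for n by simp
  qed
qed

lemma shiftL_tendsto:
  assumes "f \<in> L2 Rplus" "c \<longlonglongrightarrow> 0" "\<And>n. 0 \<le> c n" "\<And>n. c n \<le> 1"
  shows "(\<lambda>n. l2_norm Rplus (\<lambda>t. f (t + c n) - f t)) \<longlonglongrightarrow> 0"
proof (rule l2_contractions_tendsto[where S = C_comp and T = "\<lambda>n. shiftL (c n)"])
  show "l2_norm Rplus (\<lambda>x. f (x + c n) - g (x + c n)) \<le> l2_norm Rplus (\<lambda>x. f x - g x)"
    if "f \<in> L2 Rplus" "g \<in> L2 Rplus" for n f g
    using shiftL_L2(2)[OF L2_diff[OF that] assms(3)[of n]] .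
  show "(\<lambda>n. l2_norm Rplus (\<lambda>x. g (x + c n) - g x)) \<longlonglongrightarrow> 0" if "g \<in> C_comp" for g
    using that assms by (intro C_comp_translation_tendsto) auto
  show "shiftL (c n) g \<in> L2 Rplus" if "g \<in> L2 Rplus" for n g
    by (rule shiftL_L2(1)[OF that assms(3)])
qed (rule C_comp_L2, rule C_comp_dense[OF assms(1)])

lemma shiftR_tendsto:
  assumes "f \<in> L2 Rplus" "c \<longlonglongrightarrow> 0" "\<And>n. 0 \<le> c n" "\<And>n. c n \<le> 1"
  shows "(\<lambda>n. l2_norm Rplus (\<lambda>t. shiftR (c n) f t - f t)) \<longlonglongrightarrow> 0"
proof (rule l2_contractions_tendsto[where S = C_comp])
  show "l2_norm Rplus (\<lambda>x. shiftR (c n) f x - shiftR (c n) g x) \<le> l2_norm Rplus (\<lambda>x. f x - g x)"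
    if "f \<in> L2 Rplus" "g \<in> L2 Rplus" for n f g
    using shiftR_L2(2)[OF L2_diff[OF that] assms(3)[of n]] by (simp add: shiftR_diff)
  show "(\<lambda>n. l2_norm Rplus (\<lambda>x. shiftR (c n) g x - g x)) \<longlonglongrightarrow> 0" if "g \<in> C_comp" for g
  proof -
    have "(\<lambda>n. - c n) \<longlonglongrightarrow> 0" using tendsto_minus[OF assms(2)] by simp
    from C_comp_translation_tendsto[OF that this] show ?thesis
      using assms by (simp add: shiftR_C_comp(1)[OF that])
  qed
  show "shiftR (c n) g \<in> L2 Rplus" if "g \<in> L2 Rplus" for n g
    by (rule shiftR_L2(1)[OF that assms(3)])
qed (rule C_comp_L2, rule C_comp_dense[OF assms(1)])

text \<open>
  The translate by \<open>b\<close> has the norm of \<open>f\<close> restricted to \<open>(b, \<infinity>)\<close>, and tails of an integrable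
  function tend to zero.
\<close>

lemma shiftL_at_top:
  assumes f: "f \<in> L2 Rplus" and b: "filterlim b at_top sequentially" "\<And>n. 0 \<le> b n"
  shows "(\<lambda>n. l2_norm Rplus (shiftL (b n) f)) \<longlonglongrightarrow> 0"
proof (rule tendsto_sandwich[OF _ _ tendsto_const])
  have [measurable]: "f \<in> borel_measurable Rplus" using f by auto
  have [measurable]: "{x<..} \<inter> {0<..} \<in> sets Rplus" for x :: real by (auto simp: sets_restrict_space)
  let ?g = "\<lambda>n t. indicator ({b n<..} \<inter> {0<..}) t * f t"
  have gm: "?g n \<in> borel_measurable Rplus" for n by measurable
  have lim: "(\<lambda>n. l2_norm Rplus (\<lambda>t. ?g n t - 0)) \<longlonglongrightarrow> 0"
  proof (rule l2_dominated_convergence)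
    show "integrable Rplus (\<lambda>t. (cmod (f t))\<^sup>2)" using f by auto
    have "(\<lambda>n. ?g n t) \<longlonglongrightarrow> 0" for t
    proof -
      have "\<forall>\<^sub>F n in sequentially. b n > t" using b(1) by (auto simp: filterlim_at_top_dense)
      then have "\<forall>\<^sub>F n in sequentially. ?g n t = 0" by eventually_elim (auto simp: indicator_def)
      then show ?thesis by (rule tendsto_eventually)
    qed
    then show "AE t in Rplus. (\<lambda>n. ?g n t) \<longlonglongrightarrow> 0" by simp
    show "AE t in Rplus. cmod (?g n t - 0) \<le> cmod (f t)" for n
      by (intro always_eventually) (auto simp: indicator_def)
  qed (use gm in auto)
  then show "(\<lambda>n. l2_norm Rplus (?g n)) \<longlonglongrightarrow> 0" by simp
  show "\<forall>\<^sub>F n in sequentially. l2_norm Rplus (shiftL (b n) f) \<le> l2_norm Rplus (?g n)"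
  proof (intro always_eventually allI l2_norm_le_if_nn_integral_le)
    fix n
    show "shiftL (b n) f \<in> L2 Rplus" using f b by (intro shiftL_L2)
    show "?g n \<in> L2 Rplus" by (intro L2_indicator_mult f) auto
    have "(\<integral>\<^sup>+t. ennreal ((cmod (f (t + b n)))\<^sup>2) \<partial>Rplus)
      = (\<integral>\<^sup>+t. ennreal ((cmod (f t))\<^sup>2) * indicator {b n<..} t \<partial>Rplus)"
      by (rule nn_integral_Rplus_shift[OF _ b(2)]) measurable
    also have "\<dots> = (\<integral>\<^sup>+t. ennreal ((cmod (?g n t))\<^sup>2) \<partial>Rplus)"
      by (intro nn_integral_cong) (auto simp: indicator_def space_restrict_space)
    finally show "(\<integral>\<^sup>+t. ennreal ((cmod (f (t + b n)))\<^sup>2) \<partial>Rplus) \<le> (\<integral>\<^sup>+t. ennreal ((cmod (?g n t))\<^sup>2) \<partial>Rplus)"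
      by simp
  qed
qed simp

lemma integral_Rplus_shift:
  fixes f :: "real \<Rightarrow> complex"
  assumes "0 \<le> a"
  shows "(\<integral>t. f (t + a) \<partial>Rplus) = (\<integral>t. indicator {a<..} t *\<^sub>R f t \<partial>Rplus)"
proof -
  let ?G = "\<lambda>t. indicator {a<..} t *\<^sub>R f t"
  have "(\<integral>t. ?G t \<partial>Rplus) = (\<integral>t. indicator {0<..} t *\<^sub>R ?G t \<partial>lborel)"
    by (rule integral_restrict_space) simp
  also have "\<dots> = (\<integral>t. ?G t \<partial>lborel)"
    by (rule Bochner_Integration.integral_cong[OF refl]) (use assms in \<open>auto simp: indicator_def\<close>)
  also have "\<dots> = (\<integral>t. ?G (a + 1 * t) \<partial>lborel)"
    using lborel_integral_real_affine[of 1 ?G a] by simp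
  also have "\<dots> = (\<integral>t. indicator {0<..} t *\<^sub>R f (t + a) \<partial>lborel)"
    by (rule Bochner_Integration.integral_cong[OF refl]) (auto simp: indicator_def add.commute)
  also have "\<dots> = (\<integral>t. f (t + a) \<partial>Rplus)"
    by (rule integral_restrict_space[symmetric]) simp
  finally show ?thesis ..
qed

section \<open>Averages of far translates\<close>

text \<open>
  Steps at least as long as the support make the translates disjoint, so the squared norms of the \<open>N\<close>
  terms, each \<open>\<parallel>f\<parallel>\<^sup>2 / N\<^sup>2\<close>, add up to \<open>\<parallel>f\<parallel>\<^sup>2 / N\<close>. This is a mean ergodic theorem for the translations
  with an explicit rate.
\<close>

lemma norm_average_far_translates:
  assumes f: "f \<in> L2 Rplus" and supp: "0 < a" "\<And>t. t \<notin> {a..l} \<Longrightarrow> f t = 0" and "0 \<le> \<epsilon>" "0 \<le> l" "0 < N"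
  shows "l2_norm Rplus (\<lambda>t. \<Sum>k\<in>{1::nat..N}. of_real (1 / real N) * shiftR (\<epsilon> + real k * l) f t) = l2_norm Rplus f / sqrt N"
proof -
  have r: "0 \<le> \<epsilon> + real k * l" for k using assms by simp
  have disj: "of_real (1 / real N) * shiftR (\<epsilon> + real i * l) f t = 0 \<or> of_real (1 / real N) * shiftR (\<epsilon> + real j * l) f t = 0"
    if "i \<noteq> j" for i j :: nat and t
  proof (rule ccontr)
    assume "\<not> ?thesis"
    then have "f (t - (\<epsilon> + real i * l)) \<noteq> 0" "f (t - (\<epsilon> + real j * l)) \<noteq> 0" by (auto simp: shiftR_def)
    then have m: "t - (\<epsilon> + real i * l) \<in> {a..l}" "t - (\<epsilon> + real j * l) \<in> {a..l}" using supp(2) by blast+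
    have "False" if "i < j" "t - (\<epsilon> + real i * l) \<le> l" "a \<le> t - (\<epsilon> + real j * l)" for i j :: nat
    proof -
      have "(real i + 1) * l \<le> real j * l" using that(1) \<open>0 \<le> l\<close> by (intro mult_right_mono) auto
      then show False using that(2,3) supp(1) by (simp add: distrib_right)
    qed
    then show False using m \<open>i \<noteq> j\<close> by (metis atLeastAtMost_iff linorder_neqE_nat)
  qed
  have "(l2_norm Rplus (\<lambda>t. \<Sum>k\<in>{1::nat..N}. of_real (1 / real N) * shiftR (\<epsilon> + real k * l) f t))\<^sup>2
      = (\<Sum>k\<in>{1::nat..N}. (l2_norm Rplus (\<lambda>t. of_real (1 / real N) * shiftR (\<epsilon> + real k * l) f t))\<^sup>2)"
    by (rule l2_norm_sum_disjoint[OF finite_atLeastAtMost]) (rule L2_cmult[OF shiftR_L2(1)[OF f r]], rule disj)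
  also have "\<dots> = (\<Sum>k\<in>{1::nat..N}. (1 / real N * l2_norm Rplus f)\<^sup>2)"
    unfolding l2_norm_cmult shiftR_L2(2)[OF f r] by (simp add: norm_divide)
  also have "\<dots> = (l2_norm Rplus f / sqrt N)\<^sup>2"
    using \<open>0 < N\<close> by (simp add: power_divide power_mult_distrib power2_eq_square)
  finally show ?thesis by (rule power2_eq_imp_eq) auto
qed

text \<open>
  In the Laplace variable this multiplies by \<open>exp (- \<epsilon> x)\<close> times one minus the average of
  \<open>exp (- k l x)\<close>: the first factor tames large \<open>x\<close>, the second vanishes at \<open>x = 0\<close>. Averaging over
  many \<open>k\<close> rather than using one far translate makes the subtracted term small in norm.
\<close>

definition regularize :: "real \<Rightarrow> real \<Rightarrow> nat \<Rightarrow> (real \<Rightarrow> complex) \<Rightarrow> real \<Rightarrow> complex" where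
  "regularize \<epsilon> l N f t = (\<Sum>k\<in>{1::nat..N}. of_real (1 / real N) * (shiftR \<epsilon> f t - shiftR (\<epsilon> + real k * l) f t))"

lemma regularize_C_comp:
  assumes "f \<in> C_comp" "0 \<le> \<epsilon>" "0 \<le> l"
  shows "regularize \<epsilon> l N f \<in> C_comp"
proof -
  have "(\<lambda>t. shiftR \<epsilon> f t + (- 1) * shiftR (\<epsilon> + real k * l) f t) \<in> C_comp" for k :: nat
    using assms by (intro C_comp_add C_comp_cmult shiftR_C_comp(2)) auto
  then have "(\<lambda>t. \<Sum>k\<in>{1::nat..N}. of_real (1 / real N) * (shiftR \<epsilon> f t + (- 1) * shiftR (\<epsilon> + real k * l) f t)) \<in> C_comp"
    by (intro C_comp_sum C_comp_cmult)
  then show ?thesis by (simp add: regularize_def[abs_def])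
qed

section \<open>The Laplace transform\<close>

lemma sigma_finite_Rplus: "sigma_finite_measure Rplus"
  by (rule sigma_finite_measure_restrict_space) (auto intro: lborel.sigma_finite_measure_axioms)

lemma AE_Rplus_pos: "(\<And>t. t > 0 \<Longrightarrow> P t) \<Longrightarrow> AE t in Rplus. P t"
  by (rule AE_I2) (simp add: space_restrict_space)

lemma exp_decay_L2:
  assumes "0 < x"
  shows "(\<lambda>t. complex_of_real (exp (- t * x))) \<in> L2 Rplus"
    and "l2_norm Rplus (\<lambda>t. complex_of_real (exp (- t * x))) = 1 / sqrt (2 * x)"
proof -
  let ?e = "\<lambda>t. complex_of_real (exp (- t * x))"
  have "(\<integral>\<^sup>+t. ennreal ((cmod (?e t))\<^sup>2) \<partial>Rplus) = (\<integral>\<^sup>+t. ennreal (exp (- (2 * x) * t)) * indicator {0<..} t \<partial>lborel)"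
    unfolding nn_integral_Rplus
    by (intro nn_integral_cong) (simp add: power2_eq_square algebra_simps flip: exp_add)
  also have "\<dots> = (\<integral>\<^sup>+t. ennreal (exp (- (2 * x) * t)) * indicator {0..} t \<partial>lborel)"
  proof (rule nn_integral_cong_AE)
    show "AE t in lborel. ennreal (exp (- (2 * x) * t)) * indicator {0<..} t
        = ennreal (exp (- (2 * x) * t)) * indicator {0..} t"
      using AE_lborel_singleton[of 0] by eventually_elim (simp add: indicator_def order_less_le)
  qed
  also have "\<dots> = ennreal (0 - (- exp (- (2 * x) * 0) / (2 * x)))"
  proof (rule nn_integral_FTC_atLeast)
    show "((\<lambda>t. - exp (- (2 * x) * t) / (2 * x)) has_real_derivative exp (- (2 * x) * t)) (at t)" for t
      using assms by (auto intro!: derivative_eq_intros)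
    have "LIM t at_top. - (2 * x) * t :> at_bot"
      using assms by (intro filterlim_tendsto_neg_mult_at_bot[OF tendsto_const _ filterlim_ident]) auto
    then have "((\<lambda>t. exp (- (2 * x) * t)) \<longlongrightarrow> 0) at_top"
      by (rule filterlim_compose[OF exp_at_bot])
    then have "((\<lambda>t. - exp (- (2 * x) * t) / (2 * x)) \<longlongrightarrow> - 0 / (2 * x)) at_top"
      using assms by (intro tendsto_intros) auto
    then show "((\<lambda>t. - exp (- (2 * x) * t) / (2 * x)) \<longlongrightarrow> 0) at_top" by simp
  qed auto
  finally have eq: "(\<integral>\<^sup>+t. ennreal ((cmod (?e t))\<^sup>2) \<partial>Rplus) = ennreal (1 / (2 * x))" by simp
  have "?e \<in> borel_measurable Rplus" by (rule borel_measurable_Rplus) measurable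
  then show L: "?e \<in> L2 Rplus" unfolding L2_iff_nn_integral eq by simp
  have "(l2_norm Rplus ?e)\<^sup>2 = 1 / (2 * x)"
    using nn_integral_L2[OF L] assms unfolding eq by (simp add: ennreal_inj)
  then have "l2_norm Rplus ?e = sqrt (1 / (2 * x))" by (intro real_sqrt_unique[symmetric]) auto
  then show "l2_norm Rplus ?e = 1 / sqrt (2 * x)" by (simp add: real_sqrt_divide)
qed

text \<open>
  The Laplace transform of \<open>\<bar>f\<bar>\<close> with values in \<open>[0, \<infinity>]\<close>. All exchanges of integrals are justified by
  the finiteness of integrals of this function.
\<close>

definition abs_laplace :: "(real \<Rightarrow> complex) \<Rightarrow> real \<Rightarrow> ennreal" where
  "abs_laplace f x = (\<integral>\<^sup>+t. ennreal (exp (- t * x) * cmod (f t)) \<partial>Rplus)"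

text \<open>
  Cauchy-Schwarz with the norm of the exponential. The factor \<open>1 / \<surd>(2 x)\<close> is the reason why a
  multiplier of order \<open>x\<close> near zero compensates any concentration of the measure there.
\<close>

lemma abs_laplace_le:
  assumes "f \<in> L2 Rplus" "0 < x"
  shows "abs_laplace f x \<le> ennreal (l2_norm Rplus f / sqrt (2 * x))"
  using l2_Cauchy_Schwarz_nn[OF exp_decay_L2(1)[OF assms(2)] assms(1)]
  unfolding exp_decay_L2(2)[OF assms(2)] by (simp add: abs_laplace_def)

lemma laplace_integrable:
  assumes "f \<in> L2 Rplus" "0 < x"
  shows "integrable Rplus (\<lambda>t. exp (- t * x) *\<^sub>R f t)"
  using L2_mult_integrable[OF exp_decay_L2(1)[OF assms(2)] assms(1)] by (simp add: scaleR_conv_of_real)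

lemma norm_laplace_le:
  assumes "f \<in> L2 Rplus" "0 < x"
  shows "ennreal (cmod (laplace f x)) \<le> abs_laplace f x"
  using integral_norm_bound_ennreal[OF laplace_integrable[OF assms]]
  by (simp add: laplace_def abs_laplace_def)

lemma nn_integral_exp_Rplus:
  assumes "0 < x"
  shows "(\<integral>\<^sup>+t. ennreal ((exp (- t * x))\<^sup>2) \<partial>Rplus) = ennreal (1 / (2 * x))"
  using nn_integral_L2[OF exp_decay_L2(1)[OF assms]] assms
  unfolding exp_decay_L2(2)[OF assms] by (simp add: power_divide)

lemma nn_integral_finite_of_L2_on_interval:
  assumes f: "\<phi> \<in> L2 Rplus" and supp: "\<And>t. t \<notin> {a..b} \<Longrightarrow> \<phi> t = 0"
  shows "(\<integral>\<^sup>+t. ennreal (cmod (\<phi> t)) \<partial>Rplus) < \<infinity>"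
proof -
  have I: "(\<lambda>t. complex_of_real (indicator {a..b} t)) \<in> L2 Rplus"
    by (rule indicator_L2) auto
  have "(\<integral>\<^sup>+t. ennreal (cmod (\<phi> t)) \<partial>Rplus) = (\<integral>\<^sup>+t. ennreal (cmod (complex_of_real (indicator {a..b} t)) * cmod (\<phi> t)) \<partial>Rplus)"
    by (intro nn_integral_cong) (use supp in \<open>auto simp: indicator_def\<close>)
  also have "\<dots> < \<infinity>" using l2_Cauchy_Schwarz_nn[OF I f] by (rule order_le_less_trans) simp
  finally show ?thesis .
qed

text \<open>
  The product of two Laplace transforms of \<open>L\<^sup>2\<close> functions is at most of order \<open>1 / x\<close>. This function vanishes
  to first order at zero and decays exponentially, and multiplication by it corresponds to a
  difference of two translations.
\<close>

definition multiplier :: "real \<Rightarrow> real \<Rightarrow> real \<Rightarrow> real" where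
  "multiplier a b x = exp (- a * x) - exp (- b * x)"

lemma multiplier_bounds:
  assumes "0 < a" "a \<le> b" "0 < x"
  shows "0 \<le> multiplier a b x" "multiplier a b x \<le> 1"
    "multiplier a b x / (2 * x) \<le> (b - a) / 2 * exp (- a * x)"
proof -
  have "b * x \<ge> a * x" using assms by (simp add: mult_right_mono)
  then show "0 \<le> multiplier a b x" by (simp add: multiplier_def)
  have "exp (- a * x) \<le> 1" using assms by simp
  then show "multiplier a b x \<le> 1" using exp_gt_zero[of "- b * x"] unfolding multiplier_def by linarith
  have "multiplier a b x = exp (- a * x) * (1 - exp (- ((b - a) * x)))"
    by (simp add: multiplier_def algebra_simps flip: exp_add)
  also have "\<dots> \<le> exp (- a * x) * ((b - a) * x)"
    using exp_ge_add_one_self[of "- ((b - a) * x)"] by (intro mult_left_mono) auto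
  finally show "multiplier a b x / (2 * x) \<le> (b - a) / 2 * exp (- a * x)"
    using assms(3) by (simp add: field_simps)
qed

section \<open>The adjoint of the Laplace transform and the Hankel kernel\<close>

locale hankel_setting =
  fixes \<mu> :: "real measure"
  assumes mu: "\<mu> \<in> hankel_measures"
    and kernel_L2: "\<And>t. t > 0 \<Longrightarrow> (\<integral>\<^sup>+s. ennreal (\<bar>hankel_kernel \<mu> (t + s)\<bar>\<^sup>2) \<partial>Rplus) < \<infinity>"

begin

abbreviation \<nu> :: "real measure" where "\<nu> \<equiv> restrict_space \<mu> {0<..}"

lemma sets_mu [simp]: "sets \<mu> = sets borel"
  using mu by (simp add: hankel_measures_def)

lemma space_mu [simp]: "space \<mu> = UNIV"
  using sets_eq_imp_space_eq[OF sets_mu] by simp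

lemma space_nu [simp]: "space \<nu> = {0<..}"
  by (simp add: space_restrict_space)

lemma nn_integral_nu: "(\<integral>\<^sup>+x. f x \<partial>\<nu>) = (\<integral>\<^sup>+x\<in>{0<..}. f x \<partial>\<mu>)"
  by (rule nn_integral_restrict_space) simp

lemma integral_nu:
  fixes f :: "real \<Rightarrow> 'b::{banach, second_countable_topology}"
  shows "(\<integral>x. f x \<partial>\<nu>) = (LINT x:{0<..}|\<mu>. f x)"
  unfolding set_lebesgue_integral_def by (rule integral_restrict_space) simp

lemma borel_measurable_nu: "f \<in> borel_measurable borel \<Longrightarrow> f \<in> borel_measurable \<nu>"
  by (rule measurable_restrict_space1) (simp add: measurable_cong_sets[OF sets_mu refl])

lemma exp_nu_finite: "t > 0 \<Longrightarrow> (\<integral>\<^sup>+x. ennreal (exp (- t * x)) \<partial>\<nu>) < \<infinity>"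
  using mu by (simp add: nn_integral_nu hankel_measures_def)

lemma exp_nu_integrable:
  assumes "t > 0" shows "integrable \<nu> (\<lambda>x. exp (- t * x))"
proof (rule integrableI_bounded)
  show "(\<lambda>x. exp (- t * x)) \<in> borel_measurable \<nu>" by (rule borel_measurable_nu) measurable
qed (use exp_nu_finite[OF assms] in simp)

text \<open>
  On \<open>(0, n]\<close> the function \<open>exp (- x)\<close> is bounded below by \<open>exp (- n)\<close>, and it is integrable.
\<close>

lemma sigma_finite_nu: "sigma_finite_measure \<nu>"
proof
  let ?A = "\<lambda>n::nat. {0<..real n}"
  show "\<exists>A. countable A \<and> A \<subseteq> sets \<nu> \<and> \<Union> A = space \<nu> \<and> (\<forall>a\<in>A. emeasure \<nu> a \<noteq> \<infinity>)"
  proof (intro exI[of _ "range ?A"] conjI ballI)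
    show "range ?A \<subseteq> sets \<nu>" by (auto simp: sets_restrict_space_iff)
    show "\<Union> (range ?A) = space \<nu>" by (auto intro: real_arch_simple)
    fix a assume "a \<in> range ?A"
    then obtain n where a: "a = ?A n" by auto
    have "emeasure \<nu> a = (\<integral>\<^sup>+x. indicator a x \<partial>\<nu>)"
      by (rule nn_integral_indicator[symmetric]) (auto simp: a sets_restrict_space_iff)
    also have "\<dots> \<le> (\<integral>\<^sup>+x. ennreal (exp (real n)) * ennreal (exp (- 1 * x)) \<partial>\<nu>)"
    proof (rule nn_integral_mono)
      fix x
      have "1 \<le> exp (real n) * exp (- 1 * x)" if "x \<in> a"
        using that by (simp add: a flip: exp_add)
      then show "indicator a x \<le> ennreal (exp (real n)) * ennreal (exp (- 1 * x))"
        by (auto simp: indicator_def simp flip: ennreal_mult ennreal_1 intro!: ennreal_leI)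
    qed
    also have "\<dots> = ennreal (exp (real n)) * (\<integral>\<^sup>+x. ennreal (exp (- 1 * x)) \<partial>\<nu>)"
      by (rule nn_integral_cmult) (rule borel_measurable_nu, measurable)
    also have "\<dots> < \<infinity>" using exp_nu_finite[of 1] by (simp add: ennreal_mult_less_top)
    finally show "emeasure \<nu> a \<noteq> \<infinity>" by simp
  qed simp
qed

sublocale nu: sigma_finite_measure \<nu> by (rule sigma_finite_nu)

sublocale Rp: sigma_finite_measure Rplus by (rule sigma_finite_Rplus)

sublocale pair_sigma_finite \<nu> Rplus ..

lemma fst_borel [measurable]: "fst \<in> borel_measurable (\<nu> \<Otimes>\<^sub>M Rplus)"
  by (rule measurable_compose[OF measurable_fst]) (rule borel_measurable_nu, simp)

lemma snd_borel [measurable]: "snd \<in> borel_measurable (\<nu> \<Otimes>\<^sub>M Rplus)"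
  by (rule measurable_compose[OF measurable_snd]) (rule borel_measurable_Rplus, simp)

lemma laplace_measurable [measurable]:
  assumes "f \<in> borel_measurable Rplus"
  shows "laplace f \<in> borel_measurable \<nu>"
  unfolding laplace_def
proof (rule Rp.borel_measurable_lebesgue_integral)
  have [measurable]: "(\<lambda>p. f (snd p)) \<in> borel_measurable (\<nu> \<Otimes>\<^sub>M Rplus)"
    by (rule measurable_compose[OF measurable_snd assms])
  show "(\<lambda>(x, t). exp (- t * x) *\<^sub>R f t) \<in> borel_measurable (\<nu> \<Otimes>\<^sub>M Rplus)"
    unfolding split_beta by measurable
qed

lemma abs_laplace_measurable [measurable]:
  assumes "f \<in> borel_measurable Rplus"
  shows "abs_laplace f \<in> borel_measurable \<nu>"
  unfolding abs_laplace_def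
proof (rule Rp.borel_measurable_nn_integral)
  have [measurable]: "(\<lambda>p. f (snd p)) \<in> borel_measurable (\<nu> \<Otimes>\<^sub>M Rplus)"
    by (rule measurable_compose[OF measurable_snd assms])
  show "(\<lambda>(x, t). ennreal (exp (- t * x) * cmod (f t))) \<in> borel_measurable (\<nu> \<Otimes>\<^sub>M Rplus)"
    unfolding split_beta by measurable
qed

text \<open>
  The formal adjoint of the Laplace transform from \<open>L\<^sup>2(0, \<infinity>)\<close> to \<open>L\<^sup>2(\<nu>)\<close> is
  \<open>u \<mapsto> \<integral> exp (- t x) u(x) d\<nu>(x)\<close>. This is Fubini's theorem for \<open>exp (- t x) u(x) (g(t))\<^sup>*\<close>; the
  hypothesis is absolute convergence. Every exchange of integrals for complex functions below is an
  instance.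
\<close>

lemma laplace_adjoint:
  assumes u: "u \<in> borel_measurable \<nu>" and g: "g \<in> L2 Rplus"
    and fin: "(\<integral>\<^sup>+x. ennreal (cmod (u x)) * abs_laplace g x \<partial>\<nu>) < \<infinity>"
  shows "integrable \<nu> (\<lambda>x. u x * cnj (laplace g x))"
    and "integrable Rplus (\<lambda>t. (\<integral>x. exp (- t * x) *\<^sub>R u x \<partial>\<nu>) * cnj (g t))"
    and "(\<integral>x. u x * cnj (laplace g x) \<partial>\<nu>)
      = (\<integral>t. (\<integral>x. exp (- t * x) *\<^sub>R u x \<partial>\<nu>) * cnj (g t) \<partial>Rplus)"
proof -
  define K where "K p = exp (- snd p * fst p) *\<^sub>R (u (fst p) * cnj (g (snd p)))" for p
  have gm: "g \<in> borel_measurable Rplus" using g by auto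
  have [measurable]: "(\<lambda>p. g (snd p)) \<in> borel_measurable (\<nu> \<Otimes>\<^sub>M Rplus)"
    by (rule measurable_compose[OF measurable_snd gm])
  have [measurable]: "(\<lambda>p. u (fst p)) \<in> borel_measurable (\<nu> \<Otimes>\<^sub>M Rplus)"
    by (rule measurable_compose[OF measurable_fst u])
  have Km [measurable]: "K \<in> borel_measurable (\<nu> \<Otimes>\<^sub>M Rplus)"
    unfolding K_def by measurable
  have Kx: "(\<integral>t. K (x, t) \<partial>Rplus) = u x * cnj (laplace g x)" for x
  proof -
    have "(\<integral>t. K (x, t) \<partial>Rplus) = (\<integral>t. u x * cnj (exp (- t * x) *\<^sub>R g t) \<partial>Rplus)"
      by (simp add: K_def)
    also have "\<dots> = u x * (\<integral>t. cnj (exp (- t * x) *\<^sub>R g t) \<partial>Rplus)"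
      by (rule integral_mult_right_zero)
    also have "(\<integral>t. cnj (exp (- t * x) *\<^sub>R g t) \<partial>Rplus) = cnj (laplace g x)"
      unfolding laplace_def by (rule Bochner_Integration.integral_cnj)
    finally show ?thesis .
  qed
  have Kt: "(\<integral>x. K (x, t) \<partial>\<nu>) = (\<integral>x. exp (- t * x) *\<^sub>R u x \<partial>\<nu>) * cnj (g t)" for t
  proof -
    have "(\<integral>x. K (x, t) \<partial>\<nu>) = (\<integral>x. (exp (- t * x) *\<^sub>R u x) * cnj (g t) \<partial>\<nu>)"
      by (simp add: K_def)
    also have "\<dots> = (\<integral>x. exp (- t * x) *\<^sub>R u x \<partial>\<nu>) * cnj (g t)"
      by (rule integral_mult_left_zero)
    finally show ?thesis .
  qed
  have "(\<integral>\<^sup>+p. ennreal (norm (K p)) \<partial>(\<nu> \<Otimes>\<^sub>M Rplus)) = (\<integral>\<^sup>+x. \<integral>\<^sup>+t. ennreal (norm (K (x, t))) \<partial>Rplus \<partial>\<nu>)"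
    by (rule Rp.nn_integral_fst[symmetric]) measurable
  also have "\<dots> = (\<integral>\<^sup>+x. ennreal (cmod (u x)) * abs_laplace g x \<partial>\<nu>)"
  proof (rule nn_integral_cong)
    fix x
    have m: "(\<lambda>t. ennreal (exp (- t * x) * cmod (g t))) \<in> borel_measurable Rplus"
    proof -
      have [measurable]: "(\<lambda>t. exp (- t * x)) \<in> borel_measurable Rplus"
        by (rule borel_measurable_Rplus) measurable
      show ?thesis using gm by measurable
    qed
    have "(\<integral>\<^sup>+t. ennreal (norm (K (x, t))) \<partial>Rplus)
        = (\<integral>\<^sup>+t. ennreal (cmod (u x)) * ennreal (exp (- t * x) * cmod (g t)) \<partial>Rplus)"
      by (intro nn_integral_cong) (simp add: K_def norm_mult mult_ac flip: ennreal_mult)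
    also have "\<dots> = ennreal (cmod (u x)) * abs_laplace g x"
      unfolding abs_laplace_def by (rule nn_integral_cmult[OF m])
    finally show "(\<integral>\<^sup>+t. ennreal (norm (K (x, t))) \<partial>Rplus) = ennreal (cmod (u x)) * abs_laplace g x" .
  qed
  finally have "integrable (\<nu> \<Otimes>\<^sub>M Rplus) K"
    using fin by (intro integrableI_bounded Km) simp
  then have K: "integrable (\<nu> \<Otimes>\<^sub>M Rplus) (case_prod (\<lambda>x t. K (x, t)))" by simp
  show "integrable \<nu> (\<lambda>x. u x * cnj (laplace g x))"
    using integrable_fst[OF K] by (simp add: Kx)
  show "integrable Rplus (\<lambda>t. (\<integral>x. exp (- t * x) *\<^sub>R u x \<partial>\<nu>) * cnj (g t))"
    using integrable_snd[OF K] by (simp add: Kt)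
  show "(\<integral>x. u x * cnj (laplace g x) \<partial>\<nu>)
      = (\<integral>t. (\<integral>x. exp (- t * x) *\<^sub>R u x \<partial>\<nu>) * cnj (g t) \<partial>Rplus)"
    using Fubini_integral[OF K] by (simp add: Kx Kt)
qed

abbreviation h :: "real \<Rightarrow> real" where "h \<equiv> hankel_kernel \<mu>"

lemma kernel_eq: "h t = (\<integral>x. exp (- t * x) \<partial>\<nu>)"
  by (simp add: hankel_kernel_def integral_nu)

lemma kernel_nonneg: "0 \<le> h t"
  unfolding kernel_eq by (rule Bochner_Integration.integral_nonneg) simp

lemma kernel_nn: "t > 0 \<Longrightarrow> (\<integral>\<^sup>+x. ennreal (exp (- t * x)) \<partial>\<nu>) = ennreal (h t)"
  unfolding kernel_eq by (rule nn_integral_eq_integral[OF exp_nu_integrable]) auto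

lemma kernel_antimono:
  assumes "0 < s" "s \<le> t" shows "h t \<le> h s"
  unfolding kernel_eq
proof (rule integral_mono_AE)
  show "AE x in \<nu>. exp (- t * x) \<le> exp (- s * x)"
    by (rule AE_I2) (use assms in \<open>simp add: mult_right_mono\<close>)
qed (use assms in \<open>intro exp_nu_integrable; linarith\<close>)+

lemma kernel_measurable [measurable]: "h \<in> borel_measurable borel"
proof -
  have [measurable]: "snd \<in> borel_measurable (borel \<Otimes>\<^sub>M \<nu>)"
    by (rule measurable_compose[OF measurable_snd]) (rule borel_measurable_nu, simp)
  have "(\<lambda>t. \<integral>x. exp (- t * x) \<partial>\<nu>) \<in> borel_measurable borel"
    by (rule nu.borel_measurable_lebesgue_integral) (unfold split_beta, measurable)
  then show ?thesis by (simp add: kernel_eq[abs_def])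
qed

lemma kernel_shift_L2: "t > 0 \<Longrightarrow> (\<lambda>s. complex_of_real (h (t + s))) \<in> L2 Rplus"
  unfolding L2_iff_nn_integral using kernel_L2[of t] borel_measurable_Rplus[of "\<lambda>s. complex_of_real (h (t + s))"]
  by simp

lemma hankel_integrable:
  assumes "f \<in> L2 Rplus" "t > 0"
  shows "integrable Rplus (\<lambda>s. h (t + s) *\<^sub>R f s)"
  using L2_mult_integrable[OF kernel_shift_L2[OF assms(2)] assms(1)] by (simp add: scaleR_conv_of_real)

text \<open>
  By Tonelli's theorem the integral equals \<open>\<integral> h(t + s) \<bar>f(s)\<bar> ds\<close>, which is finite by the assumption on
  the kernel and Cauchy-Schwarz.
\<close>

lemma exp_abs_laplace_finite:
  assumes f: "f \<in> L2 Rplus" and t: "t > 0"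
  shows "(\<integral>\<^sup>+x. ennreal (exp (- t * x)) * abs_laplace f x \<partial>\<nu>) < \<infinity>"
proof -
  have fm: "f \<in> borel_measurable Rplus" using f by auto
  have [measurable]: "(\<lambda>p. f (snd p)) \<in> borel_measurable (\<nu> \<Otimes>\<^sub>M Rplus)"
    by (rule measurable_compose[OF measurable_snd fm])
  have m: "(\<lambda>s. ennreal (exp (- s * x) * cmod (f s))) \<in> borel_measurable Rplus" for x
  proof -
    have [measurable]: "(\<lambda>s. exp (- s * x)) \<in> borel_measurable Rplus"
      by (rule borel_measurable_Rplus) measurable
    show ?thesis using fm by measurable
  qed
  have m2: "(\<lambda>x. ennreal (exp (- (t + s) * x))) \<in> borel_measurable \<nu>" for s
    by (rule borel_measurable_nu) measurable
  have "(\<integral>\<^sup>+x. ennreal (exp (- t * x)) * abs_laplace f x \<partial>\<nu>)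
      = (\<integral>\<^sup>+x. \<integral>\<^sup>+s. ennreal (exp (- (t + s) * x)) * ennreal (cmod (f s)) \<partial>Rplus \<partial>\<nu>)"
    unfolding abs_laplace_def
    by (subst nn_integral_cmult[OF m, symmetric], intro nn_integral_cong)
       (simp add: algebra_simps flip: ennreal_mult exp_add)
  also have "\<dots> = (\<integral>\<^sup>+s. \<integral>\<^sup>+x. ennreal (exp (- (t + s) * x)) * ennreal (cmod (f s)) \<partial>\<nu> \<partial>Rplus)"
    by (rule Fubini'[symmetric]) (unfold split_beta, measurable)
  also have "\<dots> = (\<integral>\<^sup>+s. ennreal (cmod (complex_of_real (h (t + s))) * cmod (f s)) \<partial>Rplus)"
  proof (rule nn_integral_cong)
    fix s assume "s \<in> space Rplus"
    then have "t + s > 0" using t by (simp add: space_restrict_space)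
    have "(\<integral>\<^sup>+x. ennreal (exp (- (t + s) * x)) * ennreal (cmod (f s)) \<partial>\<nu>)
        = (\<integral>\<^sup>+x. ennreal (exp (- (t + s) * x)) \<partial>\<nu>) * ennreal (cmod (f s))"
      by (rule nn_integral_multc[OF m2])
    also have "\<dots> = ennreal (cmod (complex_of_real (h (t + s))) * cmod (f s))"
      unfolding kernel_nn[OF \<open>t + s > 0\<close>] by (simp add: kernel_nonneg ennreal_mult)
    finally show "(\<integral>\<^sup>+x. ennreal (exp (- (t + s) * x)) * ennreal (cmod (f s)) \<partial>\<nu>)
      = ennreal (cmod (complex_of_real (h (t + s))) * cmod (f s))" .
  qed
  also have "\<dots> < \<infinity>"
    using l2_Cauchy_Schwarz_nn[OF kernel_shift_L2[OF t] f] by (rule order_le_less_trans) simp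
  finally show ?thesis .
qed

text \<open>
  Apply \<open>laplace_adjoint\<close> to \<open>u = exp (- t x)\<close> and the conjugate of \<open>f\<close>: the adjoint of the Laplace
  transform takes \<open>u\<close> to the kernel \<open>h(t + \<cdot>)\<close>.
\<close>

lemma hankel_integral_eq:
  assumes f: "f \<in> L2 Rplus" and t: "t > 0"
  shows "integrable \<nu> (\<lambda>x. exp (- t * x) *\<^sub>R laplace f x)"
    and "hankel_integral \<mu> f t = (\<integral>x. exp (- t * x) *\<^sub>R laplace f x \<partial>\<nu>)"
proof -
  let ?u = "\<lambda>x. complex_of_real (exp (- t * x))"
  have u: "?u \<in> borel_measurable \<nu>" by (rule borel_measurable_nu) measurable
  have g: "(\<lambda>t. cnj (f t)) \<in> L2 Rplus" by (rule L2_cnj[OF f])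
  have fin: "(\<integral>\<^sup>+x. ennreal (cmod (?u x)) * abs_laplace (\<lambda>t. cnj (f t)) x \<partial>\<nu>) < \<infinity>"
    using exp_abs_laplace_finite[OF f t] by (simp add: abs_laplace_def)
  have cnjL: "cnj (laplace (\<lambda>t. cnj (f t)) x) = laplace f x" for x
  proof -
    have "laplace (\<lambda>t. cnj (f t)) x = (\<integral>t. cnj (exp (- t * x) *\<^sub>R f t) \<partial>Rplus)"
      by (simp add: laplace_def)
    also have "\<dots> = cnj (laplace f x)" unfolding laplace_def by (rule Bochner_Integration.integral_cnj)
    finally show ?thesis by simp
  qed
  show "integrable \<nu> (\<lambda>x. exp (- t * x) *\<^sub>R laplace f x)"
    using laplace_adjoint(1)[OF u g fin] by (simp add: cnjL scaleR_conv_of_real)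
  have "(\<integral>x. exp (- t * x) *\<^sub>R laplace f x \<partial>\<nu>)
      = (\<integral>s. (\<integral>x. exp (- s * x) *\<^sub>R ?u x \<partial>\<nu>) * f s \<partial>Rplus)"
    using laplace_adjoint(3)[OF u g fin] by (simp add: cnjL scaleR_conv_of_real)
  also have "\<dots> = hankel_integral \<mu> f t"
    unfolding hankel_integral_def
  proof (rule Bochner_Integration.integral_cong[OF refl])
    fix s
    have "(\<integral>x. exp (- s * x) *\<^sub>R ?u x \<partial>\<nu>) = (\<integral>x. complex_of_real (exp (- (t + s) * x)) \<partial>\<nu>)"
      by (simp add: scaleR_conv_of_real algebra_simps flip: of_real_mult exp_add)
    also have "\<dots> = complex_of_real (h (t + s))"
      unfolding kernel_eq by (rule integral_complex_of_real)
    finally show "(\<integral>x. exp (- s * x) *\<^sub>R ?u x \<partial>\<nu>) * f s = h (t + s) *\<^sub>R f s"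
      by (simp add: scaleR_conv_of_real)
  qed
  finally show "hankel_integral \<mu> f t = (\<integral>x. exp (- t * x) *\<^sub>R laplace f x \<partial>\<nu>)" by simp
qed

lemma hankel_integral_measurable:
  assumes "f \<in> L2 Rplus"
  shows "hankel_integral \<mu> f \<in> borel_measurable borel"
proof -
  have fm: "f \<in> borel_measurable Rplus" using assms by auto
  have [measurable]: "(\<lambda>p. f (snd p)) \<in> borel_measurable (borel \<Otimes>\<^sub>M Rplus)"
    by (rule measurable_compose[OF measurable_snd fm])
  have [measurable]: "snd \<in> borel_measurable (borel \<Otimes>\<^sub>M Rplus)"
    by (rule measurable_compose[OF measurable_snd]) (rule borel_measurable_Rplus, simp)
  show ?thesis
    unfolding hankel_integral_def[abs_def]
    by (rule Rp.borel_measurable_lebesgue_integral) (unfold split_beta, measurable)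
qed

lemma hankel_integral_diff:
  assumes "f \<in> L2 Rplus" "g \<in> L2 Rplus" "t > 0"
  shows "hankel_integral \<mu> (\<lambda>s. f s - g s) t = hankel_integral \<mu> f t - hankel_integral \<mu> g t"
  using Bochner_Integration.integral_diff[OF hankel_integrable[OF assms(1,3)] hankel_integrable[OF assms(2,3)]]
  by (simp add: hankel_integral_def scaleR_diff_right)

abbreviation F :: "(real \<Rightarrow> complex) \<Rightarrow> real \<Rightarrow> complex" where "F \<equiv> hankel_integral \<mu>"

lemma hankel_integral_cmult: "F (\<lambda>s. c * f s) t = c * F f t"
  unfolding hankel_integral_def by (simp flip: integral_mult_right_zero)

lemma hankel_integral_sum:
  assumes "\<And>i. i \<in> I \<Longrightarrow> f i \<in> L2 Rplus" "0 < t"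
  shows "F (\<lambda>s. \<Sum>i\<in>I. f i s) t = (\<Sum>i\<in>I. F (f i) t)"
  unfolding hankel_integral_def scaleR_sum_right
  by (rule Bochner_Integration.integral_sum) (rule hankel_integrable[OF assms])

text \<open>
  A Hankel operator intertwines translation to the right with translation to the left, since the
  kernel depends only on \<open>t + s\<close>.
\<close>

lemma hankel_integral_shiftR:
  assumes "0 \<le> r"
  shows "F (shiftR r f) t = F f (t + r)"
proof -
  have "F (shiftR r f) t = (\<integral>s. indicator {r<..} s *\<^sub>R (h (t + s) *\<^sub>R f (s - r)) \<partial>Rplus)"
    unfolding hankel_integral_def
    by (rule Bochner_Integration.integral_cong[OF refl]) (auto simp: shiftR_def indicator_def)
  also have "\<dots> = (\<integral>s. h (t + (s + r)) *\<^sub>R f (s + r - r) \<partial>Rplus)"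
    by (rule integral_Rplus_shift[OF assms, symmetric])
  also have "\<dots> = F f (t + r)" by (simp add: hankel_integral_def add_ac)
  finally show ?thesis .
qed

section \<open>Multipliers in the Laplace variable\<close>

text \<open>
  Half the integral of \<open>m / x\<close>: the trace of the operator \<open>f \<mapsto> F f (\<cdot> + a) - F f (\<cdot> + b)\<close>, hence a bound
  for its norm.
\<close>

definition multiplier_mass :: "real \<Rightarrow> real \<Rightarrow> real" where
  "multiplier_mass a b = enn2real (\<integral>\<^sup>+x. ennreal (multiplier a b x / (2 * x)) \<partial>\<nu>)"

lemma multiplier_measurable [measurable]: "multiplier a b \<in> borel_measurable \<nu>"
  unfolding multiplier_def[abs_def] by (rule borel_measurable_nu) measurable

text \<open>
  The integral is finite because \<open>m / x\<close> is at most a multiple of \<open>exp (- a x)\<close>.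
\<close>

lemma nn_integral_multiplier:
  assumes "0 < a" "a \<le> b"
  shows "(\<integral>\<^sup>+x. ennreal (multiplier a b x / (2 * x)) \<partial>\<nu>) = ennreal (multiplier_mass a b)"
proof -
  have "(\<integral>\<^sup>+x. ennreal (multiplier a b x / (2 * x)) \<partial>\<nu>)
      \<le> (\<integral>\<^sup>+x. ennreal ((b - a) / 2) * ennreal (exp (- a * x)) \<partial>\<nu>)"
  proof (rule nn_integral_mono)
    fix x assume "x \<in> space \<nu>"
    then show "ennreal (multiplier a b x / (2 * x)) \<le> ennreal ((b - a) / 2) * ennreal (exp (- a * x))"
      using multiplier_bounds(3)[OF assms, of x] assms by (simp add: ennreal_leI flip: ennreal_mult)
  qed
  also have "\<dots> = ennreal ((b - a) / 2) * (\<integral>\<^sup>+x. ennreal (exp (- a * x)) \<partial>\<nu>)"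
    by (rule nn_integral_cmult) (rule borel_measurable_nu, measurable)
  also have "\<dots> < \<infinity>" using exp_nu_finite[OF assms(1)] by (simp add: ennreal_mult_less_top)
  finally show ?thesis by (simp add: multiplier_mass_def)
qed

lemma multiplier_mass_nonneg [simp]: "0 \<le> multiplier_mass a b"
  by (simp add: multiplier_mass_def)

lemma multiplier_form_bound:
  assumes "0 < a" "a \<le> b" and f: "f \<in> L2 Rplus" and g: "g \<in> L2 Rplus"
  shows "(\<integral>\<^sup>+x. ennreal (multiplier a b x) * (abs_laplace f x * abs_laplace g x) \<partial>\<nu>)
    \<le> ennreal (l2_norm Rplus f * l2_norm Rplus g * multiplier_mass a b)"
proof -
  have mult3: "ennreal A * (ennreal B * ennreal D) = ennreal (A * (B * D))"
    if "0 \<le> A" "0 \<le> B" "0 \<le> D" for A B D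
    using that by (simp add: ennreal_mult)
  have "(\<integral>\<^sup>+x. ennreal (multiplier a b x) * (abs_laplace f x * abs_laplace g x) \<partial>\<nu>)
    \<le> (\<integral>\<^sup>+x. ennreal (l2_norm Rplus f * l2_norm Rplus g) * ennreal (multiplier a b x / (2 * x)) \<partial>\<nu>)"
  proof (rule nn_integral_mono)
    fix x assume "x \<in> space \<nu>"
    then have x: "0 < x" by simp
    have "ennreal (multiplier a b x) * (abs_laplace f x * abs_laplace g x)
      \<le> ennreal (multiplier a b x) * (ennreal (l2_norm Rplus f / sqrt (2 * x)) * ennreal (l2_norm Rplus g / sqrt (2 * x)))"
      by (intro mult_mono abs_laplace_le f g x) auto
    also have "\<dots> = ennreal (multiplier a b x * (l2_norm Rplus f / sqrt (2 * x) * (l2_norm Rplus g / sqrt (2 * x))))"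
      using multiplier_bounds(1)[OF assms(1,2) x] x by (intro mult3) auto
    also have "multiplier a b x * (l2_norm Rplus f / sqrt (2 * x) * (l2_norm Rplus g / sqrt (2 * x)))
      = l2_norm Rplus f * l2_norm Rplus g * (multiplier a b x / (2 * x))"
      using x by (simp add: field_simps flip: real_sqrt_mult)
    also have "ennreal \<dots> = ennreal (l2_norm Rplus f * l2_norm Rplus g) * ennreal (multiplier a b x / (2 * x))"
      using multiplier_bounds(1)[OF assms(1,2) x] x by (intro ennreal_mult) auto
    finally show "ennreal (multiplier a b x) * (abs_laplace f x * abs_laplace g x)
      \<le> ennreal (l2_norm Rplus f * l2_norm Rplus g) * ennreal (multiplier a b x / (2 * x))" .
  qed
  also have "\<dots> = ennreal (l2_norm Rplus f * l2_norm Rplus g) * (\<integral>\<^sup>+x. ennreal (multiplier a b x / (2 * x)) \<partial>\<nu>)"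
  proof (rule nn_integral_cmult)
    have [measurable]: "(\<lambda>x. 2 * x) \<in> borel_measurable \<nu>" by (rule borel_measurable_nu) measurable
    show "(\<lambda>x. ennreal (multiplier a b x / (2 * x))) \<in> borel_measurable \<nu>" by measurable
  qed
  also have "\<dots> = ennreal (l2_norm Rplus f * l2_norm Rplus g * multiplier_mass a b)"
    unfolding nn_integral_multiplier[OF assms(1,2)] by (simp add: ennreal_mult)
  finally show ?thesis .
qed

lemma hankel_difference_eq:
  assumes "0 < a" "a \<le> b" "f \<in> L2 Rplus" "0 < t"
  shows "F f (t + a) - F f (t + b) = (\<integral>x. exp (- t * x) *\<^sub>R (multiplier a b x *\<^sub>R laplace f x) \<partial>\<nu>)"
proof -
  have a: "t + a > 0" and b: "t + b > 0" using assms by auto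
  have "F f (t + a) - F f (t + b)
      = (\<integral>x. exp (- (t + a) * x) *\<^sub>R laplace f x - exp (- (t + b) * x) *\<^sub>R laplace f x \<partial>\<nu>)"
    unfolding hankel_integral_eq(2)[OF assms(3) a] hankel_integral_eq(2)[OF assms(3) b]
    by (rule Bochner_Integration.integral_diff[symmetric])
       (rule hankel_integral_eq(1)[OF assms(3) a], rule hankel_integral_eq(1)[OF assms(3) b])
  also have "\<dots> = (\<integral>x. exp (- t * x) *\<^sub>R (multiplier a b x *\<^sub>R laplace f x) \<partial>\<nu>)"
  proof (rule Bochner_Integration.integral_cong[OF refl])
    fix x
    have "exp (- (t + a) * x) = exp (- t * x) * exp (- a * x)" "exp (- (t + b) * x) = exp (- t * x) * exp (- b * x)"
      by (simp_all add: algebra_simps flip: exp_add)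
    then show "exp (- (t + a) * x) *\<^sub>R laplace f x - exp (- (t + b) * x) *\<^sub>R laplace f x
      = exp (- t * x) *\<^sub>R (multiplier a b x *\<^sub>R laplace f x)"
      by (simp add: multiplier_def right_diff_distrib flip: scaleR_diff_left)
  qed
  finally show ?thesis .
qed

text \<open>
  Weighted by the multiplier, the form is defined on all of \<open>L\<^sup>2\<close>, and its associated operator is a
  difference of two translates of \<open>F f\<close>.
\<close>

lemma multiplier_pairing:
  assumes "0 < a" "a \<le> b" and f: "f \<in> L2 Rplus" and g: "g \<in> L2 Rplus"
  shows "integrable \<nu> (\<lambda>x. multiplier a b x *\<^sub>R (laplace f x * cnj (laplace g x)))"
    and "(\<integral>x. multiplier a b x *\<^sub>R (laplace f x * cnj (laplace g x)) \<partial>\<nu>)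
      = (\<integral>t. (F f (t + a) - F f (t + b)) * cnj (g t) \<partial>Rplus)"
proof -
  let ?u = "\<lambda>x. multiplier a b x *\<^sub>R laplace f x"
  have fm: "f \<in> borel_measurable Rplus" using f by auto
  have [measurable]: "laplace f \<in> borel_measurable \<nu>" by (rule laplace_measurable[OF fm])
  have u: "?u \<in> borel_measurable \<nu>" by measurable
  have "(\<integral>\<^sup>+x. ennreal (cmod (?u x)) * abs_laplace g x \<partial>\<nu>)
    \<le> (\<integral>\<^sup>+x. ennreal (multiplier a b x) * (abs_laplace f x * abs_laplace g x) \<partial>\<nu>)"
  proof (rule nn_integral_mono)
    fix x assume "x \<in> space \<nu>"
    then have x: "0 < x" by simp
    have "ennreal (cmod (?u x)) = ennreal (multiplier a b x) * ennreal (cmod (laplace f x))"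
      using multiplier_bounds(1)[OF assms(1,2) x] by (simp add: ennreal_mult)
    then show "ennreal (cmod (?u x)) * abs_laplace g x
      \<le> ennreal (multiplier a b x) * (abs_laplace f x * abs_laplace g x)"
      using norm_laplace_le[OF f x] by (simp add: mult.assoc mult_left_mono mult_right_mono)
  qed
  also have "\<dots> < \<infinity>"
    using multiplier_form_bound[OF assms] by (rule order_le_less_trans) simp
  finally have fin: "(\<integral>\<^sup>+x. ennreal (cmod (?u x)) * abs_laplace g x \<partial>\<nu>) < \<infinity>" .
  show "integrable \<nu> (\<lambda>x. multiplier a b x *\<^sub>R (laplace f x * cnj (laplace g x)))"
    using laplace_adjoint(1)[OF u g fin] by simp
  have "(\<integral>x. multiplier a b x *\<^sub>R (laplace f x * cnj (laplace g x)) \<partial>\<nu>)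
      = (\<integral>t. (\<integral>x. exp (- t * x) *\<^sub>R ?u x \<partial>\<nu>) * cnj (g t) \<partial>Rplus)"
    using laplace_adjoint(3)[OF u g fin] by simp
  also have "\<dots> = (\<integral>t. (F f (t + a) - F f (t + b)) * cnj (g t) \<partial>Rplus)"
    by (rule Bochner_Integration.integral_cong[OF refl])
       (simp only: hankel_difference_eq[OF assms(1-3)] space_restrict_space space_lborel greaterThan_iff Int_iff)
  finally show "(\<integral>x. multiplier a b x *\<^sub>R (laplace f x * cnj (laplace g x)) \<partial>\<nu>)
      = (\<integral>t. (F f (t + a) - F f (t + b)) * cnj (g t) \<partial>Rplus)" .
qed

text \<open>
  By Cauchy-Schwarz in \<open>L\<^sup>2(m \<nu>)\<close> the square of the function at \<open>t\<close> is at most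
  \<open>\<integral> exp (- 2 t x) m d\<nu>\<close> times \<open>\<integral> m \<bar>L f\<bar>\<^sup>2 d\<nu>\<close>. Integrating the first factor over \<open>t\<close> gives
  \<open>\<integral> m / (2 x) d\<nu>\<close>, and the second is at most \<open>\<parallel>f\<parallel>\<^sup>2\<close> times the same number.
\<close>

lemma hankel_difference_bounded:
  assumes "0 < a" "a \<le> b" and f: "f \<in> L2 Rplus"
  shows "(\<lambda>t. F f (t + a) - F f (t + b)) \<in> L2 Rplus"
    and "l2_norm Rplus (\<lambda>t. F f (t + a) - F f (t + b)) \<le> multiplier_mass a b * l2_norm Rplus f"
proof -
  let ?D = "\<lambda>t. F f (t + a) - F f (t + b)" and ?m = "multiplier a b"
  define C where "C = ennreal (l2_norm Rplus f * l2_norm Rplus f * multiplier_mass a b)"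
  have fm: "f \<in> borel_measurable Rplus" using f by auto
  have [measurable]: "laplace f \<in> borel_measurable \<nu>" by (rule laplace_measurable[OF fm])
  have [measurable]: "F f \<in> borel_measurable borel" by (rule hankel_integral_measurable[OF f])
  have Dm: "?D \<in> borel_measurable Rplus" by (rule borel_measurable_Rplus) measurable
  have em [measurable]: "(\<lambda>x. exp (- t * x)) \<in> borel_measurable \<nu>" for t
    by (rule borel_measurable_nu) measurable
  have em2 [measurable]: "(\<lambda>t. exp (- t * x)) \<in> borel_measurable Rplus" for x
    by (rule borel_measurable_Rplus) measurable
  have mm: "(\<lambda>p. ?m (fst p)) \<in> borel_measurable (\<nu> \<Otimes>\<^sub>M Rplus)"
    by (rule measurable_compose[OF measurable_fst multiplier_measurable])
  have le: "ennreal ((cmod (?D t))\<^sup>2) \<le> (\<integral>\<^sup>+x. ennreal ((exp (- t * x))\<^sup>2 * ?m x) \<partial>\<nu>) * C" if t: "t > 0" for t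
  proof -
    have "ennreal (cmod (?D t)) \<le> (\<integral>\<^sup>+x. ennreal (cmod (exp (- t * x) *\<^sub>R (?m x *\<^sub>R laplace f x))) \<partial>\<nu>)"
    proof (cases "integrable \<nu> (\<lambda>x. exp (- t * x) *\<^sub>R (?m x *\<^sub>R laplace f x))")
      case True
      then show ?thesis unfolding hankel_difference_eq[OF assms t] by (rule integral_norm_bound_ennreal)
    next
      case False
      then show ?thesis unfolding hankel_difference_eq[OF assms t] not_integrable_integral_eq[OF False] by simp
    qed
    also have "\<dots> = (\<integral>\<^sup>+x. ennreal (exp (- t * x) * sqrt (?m x)) * ennreal (sqrt (?m x) * cmod (laplace f x)) \<partial>\<nu>)"
    proof (rule nn_integral_cong)
      fix x assume "x \<in> space \<nu>"
      then have m: "0 \<le> ?m x" using multiplier_bounds(1)[OF assms(1,2)] by simp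
      then have "cmod (exp (- t * x) *\<^sub>R (?m x *\<^sub>R laplace f x))
        = (exp (- t * x) * sqrt (?m x)) * (sqrt (?m x) * cmod (laplace f x))"
        by (simp add: mult_ac)
      then show "ennreal (cmod (exp (- t * x) *\<^sub>R (?m x *\<^sub>R laplace f x)))
        = ennreal (exp (- t * x) * sqrt (?m x)) * ennreal (sqrt (?m x) * cmod (laplace f x))"
        using m by (simp only:) (simp add: ennreal_mult)
    qed
    finally have "(ennreal (cmod (?D t)))\<^sup>2
      \<le> (\<integral>\<^sup>+x. ennreal (exp (- t * x) * sqrt (?m x)) * ennreal (sqrt (?m x) * cmod (laplace f x)) \<partial>\<nu>)\<^sup>2"
      by (rule power_mono) simp
    also have "\<dots> \<le> (\<integral>\<^sup>+x. (ennreal (exp (- t * x) * sqrt (?m x)))\<^sup>2 \<partial>\<nu>) * (\<integral>\<^sup>+x. (ennreal (sqrt (?m x) * cmod (laplace f x)))\<^sup>2 \<partial>\<nu>)"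
      by (rule Cauchy_Schwarz_nn_integral) measurable
    also have "(\<integral>\<^sup>+x. (ennreal (exp (- t * x) * sqrt (?m x)))\<^sup>2 \<partial>\<nu>) = (\<integral>\<^sup>+x. ennreal ((exp (- t * x))\<^sup>2 * ?m x) \<partial>\<nu>)"
      by (intro nn_integral_cong)
         (use multiplier_bounds(1)[OF assms(1,2)] in \<open>simp add: ennreal_power power_mult_distrib del: mult_minus_left\<close>)
    also have "(\<integral>\<^sup>+x. (ennreal (sqrt (?m x) * cmod (laplace f x)))\<^sup>2 \<partial>\<nu>)
      \<le> (\<integral>\<^sup>+x. ennreal (?m x) * (abs_laplace f x * abs_laplace f x) \<partial>\<nu>)"
    proof (rule nn_integral_mono)
      fix x assume "x \<in> space \<nu>"
      then have x: "0 < x" by simp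
      have "(ennreal (sqrt (?m x) * cmod (laplace f x)))\<^sup>2 = ennreal (?m x) * (ennreal (cmod (laplace f x)) * ennreal (cmod (laplace f x)))"
      proof -
        have "(ennreal (sqrt (?m x) * cmod (laplace f x)))\<^sup>2 = ennreal ((sqrt (?m x) * cmod (laplace f x))\<^sup>2)"
          using multiplier_bounds(1)[OF assms(1,2) x] by (intro ennreal_power) simp
        also have "(sqrt (?m x) * cmod (laplace f x))\<^sup>2 = ?m x * (cmod (laplace f x) * cmod (laplace f x))"
          using multiplier_bounds(1)[OF assms(1,2) x]
          by (simp only: power_mult_distrib real_sqrt_pow2 power2_eq_square[of "cmod _"])
        also have "ennreal \<dots> = ennreal (?m x) * (ennreal (cmod (laplace f x)) * ennreal (cmod (laplace f x)))"
          using multiplier_bounds(1)[OF assms(1,2) x] by (simp add: ennreal_mult)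
        finally show ?thesis .
      qed
      also have "\<dots> \<le> ennreal (?m x) * (abs_laplace f x * abs_laplace f x)"
        by (intro mult_mono norm_laplace_le[OF f x]) auto
      finally show "(ennreal (sqrt (?m x) * cmod (laplace f x)))\<^sup>2 \<le> ennreal (?m x) * (abs_laplace f x * abs_laplace f x)" .
    qed
    also have "(\<integral>\<^sup>+x. ennreal (?m x) * (abs_laplace f x * abs_laplace f x) \<partial>\<nu>) \<le> C"
      unfolding C_def by (rule multiplier_form_bound[OF assms f])
    finally show ?thesis by (simp add: ennreal_power mult_left_mono)
  qed
  have "(\<integral>\<^sup>+t. ennreal ((cmod (?D t))\<^sup>2) \<partial>Rplus)
      \<le> (\<integral>\<^sup>+t. (\<integral>\<^sup>+x. ennreal ((exp (- t * x))\<^sup>2 * ?m x) \<partial>\<nu>) * C \<partial>Rplus)"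
    by (rule nn_integral_mono) (rule le, simp add: space_restrict_space)
  also have "\<dots> = (\<integral>\<^sup>+t. (\<integral>\<^sup>+x. ennreal ((exp (- t * x))\<^sup>2 * ?m x) \<partial>\<nu>) \<partial>Rplus) * C"
  proof (rule nn_integral_multc)
    have [measurable]: "fst \<in> borel_measurable (Rplus \<Otimes>\<^sub>M \<nu>)" "snd \<in> borel_measurable (Rplus \<Otimes>\<^sub>M \<nu>)"
      "(\<lambda>p. ?m (snd p)) \<in> borel_measurable (Rplus \<Otimes>\<^sub>M \<nu>)"
      by (rule measurable_compose[OF measurable_fst], rule borel_measurable_Rplus, simp)
         (rule measurable_compose[OF measurable_snd], rule borel_measurable_nu, simp,
          rule measurable_compose[OF measurable_snd multiplier_measurable])
    show "(\<lambda>t. \<integral>\<^sup>+x. ennreal ((exp (- t * x))\<^sup>2 * ?m x) \<partial>\<nu>) \<in> borel_measurable Rplus"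
      by (rule nu.borel_measurable_nn_integral) (unfold split_beta, measurable)
  qed
  also have "(\<integral>\<^sup>+t. (\<integral>\<^sup>+x. ennreal ((exp (- t * x))\<^sup>2 * ?m x) \<partial>\<nu>) \<partial>Rplus)
      = (\<integral>\<^sup>+x. (\<integral>\<^sup>+t. ennreal ((exp (- t * x))\<^sup>2 * ?m x) \<partial>Rplus) \<partial>\<nu>)"
    using mm by (intro Fubini') (unfold split_beta, measurable)
  also have "\<dots> = (\<integral>\<^sup>+x. ennreal (?m x / (2 * x)) \<partial>\<nu>)"
  proof (rule nn_integral_cong)
    fix x assume "x \<in> space \<nu>"
    then have x: "0 < x" by simp
    have "(\<integral>\<^sup>+t. ennreal ((exp (- t * x))\<^sup>2 * ?m x) \<partial>Rplus)
      = (\<integral>\<^sup>+t. ennreal ((exp (- t * x))\<^sup>2) * ennreal (?m x) \<partial>Rplus)"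
      using multiplier_bounds(1)[OF assms(1,2) x] by (simp add: ennreal_mult del: mult_minus_left)
    also have "\<dots> = ennreal (1 / (2 * x)) * ennreal (?m x)"
      by (subst nn_integral_multc) (measurable, simp only: nn_integral_exp_Rplus[OF x])
    also have "\<dots> = ennreal (?m x / (2 * x))"
      using multiplier_bounds(1)[OF assms(1,2) x] x by (simp flip: ennreal_mult)
    finally show "(\<integral>\<^sup>+t. ennreal ((exp (- t * x))\<^sup>2 * ?m x) \<partial>Rplus) = ennreal (?m x / (2 * x))" .
  qed
  also have "\<dots> = ennreal (multiplier_mass a b)" by (rule nn_integral_multiplier[OF assms(1,2)])
  also have "ennreal (multiplier_mass a b) * C = ennreal ((multiplier_mass a b * l2_norm Rplus f)\<^sup>2)"
    by (simp add: C_def power2_eq_square mult_ac flip: ennreal_mult)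
  finally have bd: "(\<integral>\<^sup>+t. ennreal ((cmod (?D t))\<^sup>2) \<partial>Rplus) \<le> ennreal ((multiplier_mass a b * l2_norm Rplus f)\<^sup>2)" .
  show L: "?D \<in> L2 Rplus"
    unfolding L2_iff_nn_integral using Dm bd by (auto intro: order_le_less_trans)
  have "(l2_norm Rplus ?D)\<^sup>2 \<le> (multiplier_mass a b * l2_norm Rplus f)\<^sup>2"
    using bd unfolding nn_integral_L2[OF L] by simp
  then show "l2_norm Rplus ?D \<le> multiplier_mass a b * l2_norm Rplus f"
    by (rule power2_le_imp_le) simp
qed

section \<open>The domain of the Hankel operator\<close>

lemma hankel_form_dom_iff: "f \<in> hankel_form_dom \<mu> \<longleftrightarrow> f \<in> L2 Rplus \<and> laplace f \<in> L2 \<nu>"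
proof -
  have "hankel_quad \<mu> f = (\<integral>\<^sup>+x. ennreal ((cmod (laplace f x))\<^sup>2) \<partial>\<nu>)"
    by (simp add: hankel_quad_def nn_integral_nu)
  moreover have "laplace f \<in> borel_measurable \<nu>" if "f \<in> L2 Rplus"
    using that by (intro laplace_measurable) auto
  ultimately show ?thesis by (auto simp: hankel_form_dom_def L2_iff_nn_integral[of "laplace f"])
qed

lemma hankel_form_eq: "hankel_form \<mu> f g = l2_inner \<nu> (laplace f) (laplace g)"
  by (simp add: hankel_form_def l2_inner_def integral_nu)

lemma hankel_operator_form_iff:
  "(f, g) \<in> hankel_operator \<mu> \<longleftrightarrow> f \<in> hankel_form_dom \<mu> \<and> g \<in> L2 Rplus \<and>
     (\<forall>\<phi>\<in>hankel_form_dom \<mu>. l2_inner \<nu> (laplace f) (laplace \<phi>) = l2_inner Rplus g \<phi>)"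
  by (simp add: hankel_operator_def form_operator_def hankel_form_eq)

text \<open>
  If \<open>\<phi>\<close> vanishes outside \<open>[a, b]\<close> with \<open>a > 0\<close>, its Laplace transform is at most a constant times
  \<open>exp (- a x)\<close>. Such functions need not be smooth, so they include truncations of arbitrary
  \<open>L\<^sup>2\<close> functions, and they serve as test functions.
\<close>

lemma compact_support:
  assumes \<phi>: "\<phi> \<in> L2 Rplus" and a: "0 < a" and supp: "\<And>t. t \<notin> {a..b} \<Longrightarrow> \<phi> t = 0"
  shows compact_support_form_dom: "\<phi> \<in> hankel_form_dom \<mu>"
    and compact_support_pairing: "\<And>u. u \<in> L2 Rplus \<Longrightarrow> integrable Rplus (\<lambda>t. F u t * cnj (\<phi> t))"
      "\<And>u. u \<in> L2 Rplus \<Longrightarrow> l2_inner \<nu> (laplace u) (laplace \<phi>) = (\<integral>t. F u t * cnj (\<phi> t) \<partial>Rplus)"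
      "\<And>u. u \<in> L2 Rplus \<Longrightarrow> l2_inner \<nu> (laplace \<phi>) (laplace u) = l2_inner Rplus (F \<phi>) u"
    and compact_support_hankel_L2: "F \<phi> \<in> L2 Rplus"
proof -
  obtain c where c: "0 \<le> c" "(\<integral>\<^sup>+t. ennreal (cmod (\<phi> t)) \<partial>Rplus) = ennreal c"
    using nn_integral_finite_of_L2_on_interval[OF \<phi> supp] by (metis ennreal_cases less_irrefl infinity_ennreal_def)
  have \<phi>m [measurable]: "\<phi> \<in> borel_measurable Rplus" using \<phi> by auto
  have cm: "(\<lambda>t. ennreal (cmod (\<phi> t))) \<in> borel_measurable Rplus" by measurable
  have abs_le: "abs_laplace \<phi> x \<le> ennreal c * ennreal (exp (- a * x))" if x: "0 < x" for x
  proof -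
    have "abs_laplace \<phi> x \<le> (\<integral>\<^sup>+t. ennreal (exp (- a * x)) * ennreal (cmod (\<phi> t)) \<partial>Rplus)"
      unfolding abs_laplace_def
    proof (rule nn_integral_mono)
      fix t
      have "exp (- t * x) * cmod (\<phi> t) \<le> exp (- a * x) * cmod (\<phi> t)"
      proof (cases "t \<in> {a..b}")
        case True
        then have "a * x \<le> t * x" using x by (intro mult_right_mono) auto
        then show ?thesis by (intro mult_right_mono) auto
      qed (simp add: supp)
      then show "ennreal (exp (- t * x) * cmod (\<phi> t)) \<le> ennreal (exp (- a * x)) * ennreal (cmod (\<phi> t))"
        by (simp add: ennreal_leI flip: ennreal_mult)
    qed
    also have "\<dots> = ennreal (exp (- a * x)) * (\<integral>\<^sup>+t. ennreal (cmod (\<phi> t)) \<partial>Rplus)"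
      by (rule nn_integral_cmult[OF cm])
    finally show ?thesis by (simp add: c mult.commute)
  qed
  have Lm [measurable]: "laplace f \<in> borel_measurable \<nu>" if "f \<in> L2 Rplus" for f
    using that by (intro laplace_measurable) auto
  have "laplace \<phi> \<in> L2 \<nu>"
    unfolding L2_iff_nn_integral
  proof (intro conjI Lm[OF \<phi>])
    have "(\<integral>\<^sup>+x. ennreal ((cmod (laplace \<phi> x))\<^sup>2) \<partial>\<nu>) \<le> (\<integral>\<^sup>+x. ennreal (c\<^sup>2) * ennreal (exp (- (2 * a) * x)) \<partial>\<nu>)"
    proof (rule nn_integral_mono)
      fix x assume "x \<in> space \<nu>"
      then have x: "0 < x" by simp
      have "ennreal (cmod (laplace \<phi> x)) \<le> ennreal (c * exp (- a * x))"
        using order_trans[OF norm_laplace_le[OF \<phi> x] abs_le[OF x]] c(1) by (simp add: ennreal_mult)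
      then have "cmod (laplace \<phi> x) \<le> c * exp (- a * x)" using c(1) by simp
      then have "(cmod (laplace \<phi> x))\<^sup>2 \<le> (c * exp (- a * x))\<^sup>2" by (rule power_mono) simp
      also have "\<dots> = c\<^sup>2 * exp (- (2 * a) * x)"
        by (simp add: power_mult_distrib flip: exp_double)
      finally show "ennreal ((cmod (laplace \<phi> x))\<^sup>2) \<le> ennreal (c\<^sup>2) * ennreal (exp (- (2 * a) * x))"
        by (simp add: ennreal_leI flip: ennreal_mult)
    qed
    also have "\<dots> = ennreal (c\<^sup>2) * (\<integral>\<^sup>+x. ennreal (exp (- (2 * a) * x)) \<partial>\<nu>)"
      by (rule nn_integral_cmult) (rule borel_measurable_nu, measurable)
    also have "\<dots> < \<infinity>" using exp_nu_finite[of "2 * a"] a by (simp add: ennreal_mult_less_top)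
    finally show "(\<integral>\<^sup>+x. ennreal ((cmod (laplace \<phi> x))\<^sup>2) \<partial>\<nu>) < \<infinity>" .
  qed
  then show "\<phi> \<in> hankel_form_dom \<mu>" using \<phi> by (simp add: hankel_form_dom_iff)
  fix u assume u: "u \<in> L2 Rplus"
  have "(\<integral>\<^sup>+x. abs_laplace u x * abs_laplace \<phi> x \<partial>\<nu>)
      \<le> (\<integral>\<^sup>+x. ennreal c * (ennreal (exp (- a * x)) * abs_laplace u x) \<partial>\<nu>)"
  proof (rule nn_integral_mono)
    fix x assume "x \<in> space \<nu>"
    then have x: "0 < x" by simp
    have "abs_laplace u x * abs_laplace \<phi> x \<le> abs_laplace u x * (ennreal c * ennreal (exp (- a * x)))"
      by (rule mult_left_mono[OF abs_le[OF x]]) simp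
    then show "abs_laplace u x * abs_laplace \<phi> x \<le> ennreal c * (ennreal (exp (- a * x)) * abs_laplace u x)"
      by (simp add: mult_ac)
  qed
  also have "\<dots> = ennreal c * (\<integral>\<^sup>+x. ennreal (exp (- a * x)) * abs_laplace u x \<partial>\<nu>)"
  proof (rule nn_integral_cmult)
    have [measurable]: "abs_laplace u \<in> borel_measurable \<nu>" using u by (intro abs_laplace_measurable) auto
    have [measurable]: "(\<lambda>x. exp (- a * x)) \<in> borel_measurable \<nu>" by (rule borel_measurable_nu) measurable
    show "(\<lambda>x. ennreal (exp (- a * x)) * abs_laplace u x) \<in> borel_measurable \<nu>" by measurable
  qed
  also have "\<dots> < \<infinity>"
    using exp_abs_laplace_finite[OF u a] by (simp add: ennreal_mult_less_top)
  finally have fin0: "(\<integral>\<^sup>+x. abs_laplace u x * abs_laplace \<phi> x \<partial>\<nu>) < \<infinity>" .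
  have fin: "(\<integral>\<^sup>+x. ennreal (cmod (laplace u x)) * abs_laplace \<phi> x \<partial>\<nu>) < \<infinity>"
    by (rule order_le_less_trans[OF nn_integral_mono fin0])
       (intro mult_right_mono norm_laplace_le u, simp_all)
  have fin': "(\<integral>\<^sup>+x. ennreal (cmod (laplace \<phi> x)) * abs_laplace u x \<partial>\<nu>) < \<infinity>"
    by (rule order_le_less_trans[OF nn_integral_mono fin0])
       (subst mult.commute, intro mult_left_mono norm_laplace_le \<phi>, simp_all)
  have eq: "(\<integral>x. exp (- t * x) *\<^sub>R laplace u x \<partial>\<nu>) * cnj (\<phi> t) = F u t * cnj (\<phi> t)" if "t \<in> space Rplus" for t
    using hankel_integral_eq(2)[OF u, of t] that by (simp add: space_restrict_space)
  show "integrable Rplus (\<lambda>t. F u t * cnj (\<phi> t))"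
    by (rule iffD1[OF Bochner_Integration.integrable_cong[OF refl eq] laplace_adjoint(2)[OF Lm[OF u] \<phi> fin]])
  show "l2_inner \<nu> (laplace u) (laplace \<phi>) = (\<integral>t. F u t * cnj (\<phi> t) \<partial>Rplus)"
    unfolding l2_inner_def laplace_adjoint(3)[OF Lm[OF u] \<phi> fin]
    by (rule Bochner_Integration.integral_cong[OF refl eq])
  have eq': "(\<integral>x. exp (- t * x) *\<^sub>R laplace \<phi> x \<partial>\<nu>) * cnj (u t) = F \<phi> t * cnj (u t)" if "t \<in> space Rplus" for t
    using hankel_integral_eq(2)[OF \<phi>, of t] that by (simp add: space_restrict_space)
  show "l2_inner \<nu> (laplace \<phi>) (laplace u) = l2_inner Rplus (F \<phi>) u"
    unfolding l2_inner_def laplace_adjoint(3)[OF Lm[OF \<phi>] u fin']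
    by (rule Bochner_Integration.integral_cong[OF refl eq'])
next
  have \<phi>m [measurable]: "\<phi> \<in> borel_measurable Rplus" using \<phi> by auto
  obtain c where c: "0 \<le> c" "(\<integral>\<^sup>+t. ennreal (cmod (\<phi> t)) \<partial>Rplus) = ennreal c"
    using nn_integral_finite_of_L2_on_interval[OF \<phi> supp] by (metis ennreal_cases less_irrefl infinity_ennreal_def)
  show "F \<phi> \<in> L2 Rplus"
  proof (rule L2_bounded)
    show "F \<phi> \<in> borel_measurable Rplus" by (rule borel_measurable_Rplus[OF hankel_integral_measurable[OF \<phi>]])
    show "(\<lambda>t. of_real c * complex_of_real (h (a + t))) \<in> L2 Rplus" by (intro L2_cmult kernel_shift_L2 a)
    show "AE t in Rplus. cmod (F \<phi> t) \<le> cmod (of_real c * complex_of_real (h (a + t)))"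
    proof (rule AE_Rplus_pos)
      fix t :: real assume t: "0 < t"
      have "ennreal (cmod (F \<phi> t)) \<le> (\<integral>\<^sup>+s. ennreal (cmod (h (t + s) *\<^sub>R \<phi> s)) \<partial>Rplus)"
        unfolding hankel_integral_def by (rule integral_norm_bound_ennreal[OF hankel_integrable[OF \<phi> t]])
      also have "\<dots> \<le> (\<integral>\<^sup>+s. ennreal (h (a + t)) * ennreal (cmod (\<phi> s)) \<partial>Rplus)"
      proof (rule nn_integral_mono)
        fix s
        have "h (t + s) * cmod (\<phi> s) \<le> h (a + t) * cmod (\<phi> s)"
        proof (cases "s \<in> {a..b}")
          case True
          then show ?thesis using a t by (intro mult_right_mono kernel_antimono) auto
        qed (simp add: supp)
        then show "ennreal (cmod (h (t + s) *\<^sub>R \<phi> s)) \<le> ennreal (h (a + t)) * ennreal (cmod (\<phi> s))"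
          using kernel_nonneg by (simp add: ennreal_leI flip: ennreal_mult)
      qed
      also have "\<dots> = ennreal (h (a + t)) * (\<integral>\<^sup>+s. ennreal (cmod (\<phi> s)) \<partial>Rplus)"
        by (rule nn_integral_cmult) measurable
      also have "\<dots> = ennreal (c * h (a + t))"
        using c(1) kernel_nonneg by (simp add: c ennreal_mult mult.commute)
      finally show "cmod (F \<phi> t) \<le> cmod (of_real c * complex_of_real (h (a + t)))"
        using c(1) kernel_nonneg by (simp add: norm_mult)
    qed
  qed
qed

lemma hankel_integral_bounded:
  assumes f: "f \<in> L2 Rplus" and a: "0 < a" "a \<le> t"
  shows "cmod (F f t) \<le> l2_norm Rplus (\<lambda>s. complex_of_real (h (a + s))) * l2_norm Rplus f"
proof -
  have t: "0 < t" using a by simp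
  have "cmod (F f t) \<le> (\<integral>s. cmod (h (t + s) *\<^sub>R f s) \<partial>Rplus)"
    unfolding hankel_integral_def by (rule integral_norm_bound)
  also have "\<dots> = (\<integral>s. cmod (complex_of_real (h (t + s))) * cmod (f s) \<partial>Rplus)"
    by simp
  also have "\<dots> \<le> l2_norm Rplus (\<lambda>s. complex_of_real (h (t + s))) * l2_norm Rplus f"
    by (rule l2_integral_norm_le[OF kernel_shift_L2[OF t] f])
  also have "\<dots> \<le> l2_norm Rplus (\<lambda>s. complex_of_real (h (a + s))) * l2_norm Rplus f"
  proof (intro mult_right_mono l2_norm_mono kernel_shift_L2 a t AE_Rplus_pos l2_norm_nonneg)
    fix s :: real assume "s > 0"
    then show "cmod (complex_of_real (h (t + s))) \<le> cmod (complex_of_real (h (a + s)))"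
      using kernel_antimono[of "a + s" "t + s"] a kernel_nonneg by simp
  qed
  finally show ?thesis .
qed

text \<open>
  Away from zero \<open>F f\<close> is bounded, so the truncation of \<open>F f - g\<close> to a compact interval in
  \<open>(0, \<infinity>)\<close> is itself admissible as test function. Testing with it shows that its norm is zero.
\<close>

lemma hankel_integral_AE_eqI:
  assumes f: "f \<in> L2 Rplus" and g: "g \<in> L2 Rplus"
    and test: "\<And>\<phi> a b. \<phi> \<in> L2 Rplus \<Longrightarrow> 0 < a \<Longrightarrow> (\<And>t. t \<notin> {a..b} \<Longrightarrow> \<phi> t = 0) \<Longrightarrow>
        (\<integral>t. F f t * cnj (\<phi> t) \<partial>Rplus) = l2_inner Rplus g \<phi>"
  shows "AE t in Rplus. g t = F f t"
proof -
  define I where "I n = {inverse (real (Suc n))..real n}" for n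
  have [measurable]: "g \<in> borel_measurable Rplus" using g by auto
  have [measurable]: "F f \<in> borel_measurable Rplus"
    by (rule borel_measurable_Rplus[OF hankel_integral_measurable[OF f]])
  have Im [measurable]: "(\<lambda>t. complex_of_real (indicator (I n) t)) \<in> borel_measurable Rplus" for n
    unfolding I_def by (rule borel_measurable_Rplus) measurable
  have "AE t in Rplus. complex_of_real (indicator (I n) t) * (F f t - g t) = 0" for n
  proof -
    let ?\<phi> = "\<lambda>t. complex_of_real (indicator (I n) t) * F f t - complex_of_real (indicator (I n) t) * g t"
    let ?B = "l2_norm Rplus (\<lambda>s. complex_of_real (h (inverse (real (Suc n)) + s))) * l2_norm Rplus f"
    have "(\<lambda>t. complex_of_real (indicator (I n) t) * F f t) \<in> L2 Rplus"
    proof (rule bounded_support_L2)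
      show "(\<lambda>t. complex_of_real (indicator (I n) t) * F f t) \<in> borel_measurable Rplus" by measurable
      show "cmod (complex_of_real (indicator (I n) t) * F f t) \<le> ?B" for t
      proof (cases "t \<in> I n")
        case True
        then show ?thesis
          using hankel_integral_bounded[OF f, of "inverse (real (Suc n))" t] by (simp add: I_def)
      qed (simp add: mult_nonneg_nonneg)
      show "complex_of_real (indicator (I n) t) * F f t = 0" if "t \<notin> {inverse (real (Suc n))..real n}" for t
        using that by (simp add: I_def)
    qed
    moreover have "(\<lambda>t. complex_of_real (indicator (I n) t) * g t) \<in> L2 Rplus"
      by (rule L2_bounded[OF _ g]) (measurable, auto simp: indicator_def)
    ultimately have \<phi>: "?\<phi> \<in> L2 Rplus" by (rule L2_diff)
    have supp: "?\<phi> t = 0" if "t \<notin> {inverse (real (Suc n))..real n}" for t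
      using that by (simp add: I_def)
    have pos: "0 < inverse (real (Suc n))" by simp
    have "l2_inner Rplus ?\<phi> ?\<phi> = (\<integral>t. F f t * cnj (?\<phi> t) - g t * cnj (?\<phi> t) \<partial>Rplus)"
      unfolding l2_inner_def
      by (rule Bochner_Integration.integral_cong[OF refl]) (auto simp: indicator_def algebra_simps)
    also have "\<dots> = (\<integral>t. F f t * cnj (?\<phi> t) \<partial>Rplus) - (\<integral>t. g t * cnj (?\<phi> t) \<partial>Rplus)"
      by (intro Bochner_Integration.integral_diff compact_support_pairing(1)[OF \<phi> pos supp f] L2_mult_cnj_integrable g \<phi>)
    also have "\<dots> = 0"
      using test[OF \<phi> pos supp] by (simp add: l2_inner_def)
    finally have "l2_norm Rplus ?\<phi> = 0" by (simp add: l2_inner_self)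
    then have "AE t in Rplus. ?\<phi> t = 0" by (rule l2_norm_eq_0_AE[OF \<phi>])
    then show ?thesis by (simp add: right_diff_distrib)
  qed
  then have "AE t in Rplus. \<forall>n. complex_of_real (indicator (I n) t) * (F f t - g t) = 0"
    unfolding AE_all_countable by (rule allI)
  moreover have "AE t in Rplus. 0 < t" by (rule AE_Rplus_pos)
  ultimately show ?thesis
  proof eventually_elim
    case (elim t)
    obtain n where n: "inverse (real (Suc n)) < t" using reals_Archimedean[OF elim(2)] by auto
    obtain m where m: "t \<le> real m" using real_arch_simple by blast
    have "inverse (real (Suc (max n m))) \<le> inverse (real (Suc n))" by (rule le_imp_inverse_le) auto
    then have "inverse (real (Suc (max n m))) \<le> t" using n by linarith
    moreover have "t \<le> real (max n m)" using m by simp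
    ultimately have "t \<in> I (max n m)" unfolding I_def by (simp only: atLeastAtMost_iff)
    then show ?case using elim(1)[rule_format, of "max n m"] by simp
  qed
qed

lemma operator_imp_hankel_integral:
  assumes "(f, g) \<in> hankel_operator \<mu>"
  shows "AE t in Rplus. g t = F f t" "F f \<in> L2 Rplus"
proof -
  have f: "f \<in> L2 Rplus" and g: "g \<in> L2 Rplus"
    and form: "\<And>\<phi>. \<phi> \<in> hankel_form_dom \<mu> \<Longrightarrow> l2_inner \<nu> (laplace f) (laplace \<phi>) = l2_inner Rplus g \<phi>"
    using assms by (auto simp: hankel_operator_form_iff hankel_form_dom_iff)
  show AE: "AE t in Rplus. g t = F f t"
  proof (rule hankel_integral_AE_eqI[OF f g])
    fix \<phi> a b assume \<phi>: "\<phi> \<in> L2 Rplus" "0 < a" and supp: "\<And>t. t \<notin> {a..b} \<Longrightarrow> \<phi> t = 0"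
    show "(\<integral>t. F f t * cnj (\<phi> t) \<partial>Rplus) = l2_inner Rplus g \<phi>"
      using compact_support_pairing(2)[OF \<phi> supp f] form[OF compact_support_form_dom[OF \<phi> supp]] by simp
  qed
  show "F f \<in> L2 Rplus"
  proof (rule L2_bounded[OF _ g])
    show "F f \<in> borel_measurable Rplus" by (rule borel_measurable_Rplus[OF hankel_integral_measurable[OF f]])
    show "AE t in Rplus. cmod (F f t) \<le> cmod (g t)" using AE by eventually_elim simp
  qed
qed

text \<open>
  Use \<open>multiplier_pairing\<close> with \<open>a\<close> tending to zero and \<open>b\<close> to infinity. Since \<open>F f \<in> L\<^sup>2\<close>, the
  differences of translates converge to \<open>F f\<close> in norm.
\<close>

lemma hankel_integral_imp_operator:
  assumes f: "f \<in> L2 Rplus" and Ff: "F f \<in> L2 Rplus"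
  shows "(f, F f) \<in> hankel_operator \<mu>"
proof -
  define a where "a n = inverse (real (Suc n))" for n
  define b where "b n = real n + 1" for n
  define D where "D n t = F f (t + a n) - F f (t + b n)" for n t
  have a: "0 < a n" "a n \<le> 1" for n by (simp_all add: a_def inverse_le_1_iff)
  have b: "1 \<le> b n" for n by (simp add: b_def)
  have ab: "a n \<le> b n" for n using a(2)[of n] b[of n] by simp
  have a0: "a \<longlonglongrightarrow> 0" unfolding a_def[abs_def] by (rule LIMSEQ_inverse_real_of_nat)
  have binf: "filterlim b at_top sequentially"
    unfolding b_def[abs_def] by (rule filterlim_at_top_mono[OF filterlim_real_sequentially]) simp
  have SL: "shiftL (a n) (F f) \<in> L2 Rplus" "shiftL (b n) (F f) \<in> L2 Rplus" for n
    using a(1)[of n] b[of n] by (auto intro!: shiftL_L2(1)[OF Ff])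
  have DL: "D n \<in> L2 Rplus" for n unfolding D_def by (rule L2_diff[OF SL])
  have Dlim: "(\<lambda>n. l2_norm Rplus (\<lambda>t. D n t - F f t)) \<longlonglongrightarrow> 0"
  proof (rule tendsto_sandwich[OF _ _ tendsto_const])
    show "\<forall>\<^sub>F n in sequentially. l2_norm Rplus (\<lambda>t. D n t - F f t)
        \<le> l2_norm Rplus (\<lambda>t. F f (t + a n) - F f t) + l2_norm Rplus (shiftL (b n) (F f))"
    proof (intro always_eventually allI)
      fix n
      have "l2_norm Rplus (\<lambda>t. D n t - F f t) = l2_norm Rplus (\<lambda>t. (F f (t + a n) - F f t) + (- 1) * F f (t + b n))"
        by (simp add: D_def algebra_simps)
      also have "\<dots> \<le> l2_norm Rplus (\<lambda>t. F f (t + a n) - F f t) + l2_norm Rplus (\<lambda>t. (- 1) * F f (t + b n))"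
        by (intro l2_norm_triangle L2_diff L2_cmult SL Ff)
      also have "l2_norm Rplus (\<lambda>t. (- 1) * F f (t + b n)) = l2_norm Rplus (shiftL (b n) (F f))"
        unfolding l2_norm_cmult by simp
      finally show "l2_norm Rplus (\<lambda>t. D n t - F f t)
        \<le> l2_norm Rplus (\<lambda>t. F f (t + a n) - F f t) + l2_norm Rplus (shiftL (b n) (F f))" .
    qed
    have "(\<lambda>n. l2_norm Rplus (\<lambda>t. F f (t + a n) - F f t)) \<longlonglongrightarrow> 0"
      by (rule shiftL_tendsto[OF Ff a0]) (use a in \<open>auto intro: less_imp_le\<close>)
    moreover have "(\<lambda>n. l2_norm Rplus (shiftL (b n) (F f))) \<longlonglongrightarrow> 0"
      by (rule shiftL_at_top[OF Ff binf]) (use b in \<open>auto intro: order_trans[of 0 1]\<close>)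
    ultimately show "(\<lambda>n. l2_norm Rplus (\<lambda>t. F f (t + a n) - F f t) + l2_norm Rplus (shiftL (b n) (F f))) \<longlonglongrightarrow> 0"
      using tendsto_add by fastforce
  qed simp
  have inner_lim: "(\<lambda>n. l2_inner Rplus (D n) \<phi>) \<longlonglongrightarrow> l2_inner Rplus (F f) \<phi>" if "\<phi> \<in> L2 Rplus" for \<phi>
    by (rule l2_inner_tendsto_left[OF DL Ff that Dlim])
  have mlim: "(\<lambda>n. multiplier (a n) (b n) x) \<longlonglongrightarrow> 1" if x: "0 < x" for x
  proof -
    have "filterlim (\<lambda>n. b n * x) at_top sequentially"
      using filterlim_at_top_mult_tendsto_pos[OF tendsto_const x binf] by simp
    then have "(\<lambda>n. exp (- (b n * x))) \<longlonglongrightarrow> 0"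
      by (intro filterlim_compose[OF exp_at_bot]) (simp add: filterlim_uminus_at_top)
    then have "(\<lambda>n. exp (- a n * x) - exp (- (b n * x))) \<longlonglongrightarrow> exp (- 0 * x) - 0"
      by (intro tendsto_diff tendsto_exp tendsto_mult tendsto_minus a0 tendsto_const)
    then show ?thesis by (simp add: multiplier_def)
  qed
  have Lf [measurable]: "laplace f \<in> borel_measurable \<nu>"
    using f by (intro laplace_measurable) auto
  \<comment> \<open>Fatou: the weighted forms of \<open>f\<close> converge to \<open>\<langle>F f, f\<rangle>\<close>, which bounds the form itself.\<close>
  have "laplace f \<in> L2 \<nu>"
    unfolding L2_iff_nn_integral
  proof (intro conjI Lf)
    let ?B = "\<lambda>n. multiplier (a n) (b n)"
    have bound: "(\<integral>\<^sup>+x. ennreal (?B n x * (cmod (laplace f x))\<^sup>2) \<partial>\<nu>) = ennreal (Re (l2_inner Rplus (D n) f))" for n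
    proof -
      have sq: "?B n x *\<^sub>R (laplace f x * cnj (laplace f x)) = of_real (?B n x * (cmod (laplace f x))\<^sup>2)" for x
        by (simp add: scaleR_conv_of_real flip: complex_norm_square)
      have int: "integrable \<nu> (\<lambda>x. complex_of_real (?B n x * (cmod (laplace f x))\<^sup>2))"
        using multiplier_pairing(1)[OF a(1)[of n] ab f f] unfolding sq .
      then have intr: "integrable \<nu> (\<lambda>x. ?B n x * (cmod (laplace f x))\<^sup>2)"
        by (simp only: complex_of_real_integrable_eq)
      have "complex_of_real (\<integral>x. ?B n x * (cmod (laplace f x))\<^sup>2 \<partial>\<nu>) = l2_inner Rplus (D n) f"
        using multiplier_pairing(2)[OF a(1)[of n] ab f f] unfolding sq integral_complex_of_real
        by (simp add: l2_inner_def D_def)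
      then have "(\<integral>x. ?B n x * (cmod (laplace f x))\<^sup>2 \<partial>\<nu>) = Re (l2_inner Rplus (D n) f)"
        by (metis Re_complex_of_real)
      moreover have "AE x in \<nu>. 0 \<le> ?B n x * (cmod (laplace f x))\<^sup>2"
        by (rule AE_I2) (use multiplier_bounds(1)[OF a(1) ab] in simp)
      ultimately show ?thesis using nn_integral_eq_integral[OF intr] by simp
    qed
    have lim1: "(\<lambda>n. ennreal (?B n x * (cmod (laplace f x))\<^sup>2)) \<longlonglongrightarrow> ennreal ((cmod (laplace f x))\<^sup>2)" if "0 < x" for x
      using tendsto_mult_right[OF mlim[OF that], of "(cmod (laplace f x))\<^sup>2"] by (intro tendsto_ennrealI) simp
    have "(\<integral>\<^sup>+x. ennreal ((cmod (laplace f x))\<^sup>2) \<partial>\<nu>)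
        = (\<integral>\<^sup>+x. liminf (\<lambda>n. ennreal (?B n x * (cmod (laplace f x))\<^sup>2)) \<partial>\<nu>)"
      by (intro nn_integral_cong lim_imp_Liminf[symmetric] lim1) simp_all
    also have "\<dots> \<le> liminf (\<lambda>n. \<integral>\<^sup>+x. ennreal (?B n x * (cmod (laplace f x))\<^sup>2) \<partial>\<nu>)"
      by (rule nn_integral_liminf) measurable
    also have "\<dots> = liminf (\<lambda>n. ennreal (Re (l2_inner Rplus (D n) f)))" unfolding bound ..
    also have "\<dots> = ennreal (Re (l2_inner Rplus (F f) f))"
      by (intro lim_imp_Liminf tendsto_ennrealI tendsto_Re inner_lim f) simp
    also have "\<dots> < \<infinity>" by simp
    finally show "(\<integral>\<^sup>+x. ennreal ((cmod (laplace f x))\<^sup>2) \<partial>\<nu>) < \<infinity>" .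
  qed
  then have fdom: "f \<in> hankel_form_dom \<mu>" using f by (simp add: hankel_form_dom_iff)
  show ?thesis
    unfolding hankel_operator_form_iff
  proof (intro conjI ballI fdom Ff)
    fix \<phi> assume "\<phi> \<in> hankel_form_dom \<mu>"
    then have \<phi>: "\<phi> \<in> L2 Rplus" "laplace \<phi> \<in> L2 \<nu>" by (auto simp: hankel_form_dom_iff)
    have prod: "integrable \<nu> (\<lambda>x. laplace f x * cnj (laplace \<phi> x))"
      by (rule L2_mult_cnj_integrable[OF \<open>laplace f \<in> L2 \<nu>\<close> \<phi>(2)])
    have "(\<lambda>n. \<integral>x. multiplier (a n) (b n) x *\<^sub>R (laplace f x * cnj (laplace \<phi> x)) \<partial>\<nu>)
        \<longlonglongrightarrow> (\<integral>x. laplace f x * cnj (laplace \<phi> x) \<partial>\<nu>)"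
    proof (rule integral_dominated_convergence[where w = "\<lambda>x. norm (laplace f x * cnj (laplace \<phi> x))"])
      show "(\<lambda>x. laplace f x * cnj (laplace \<phi> x)) \<in> borel_measurable \<nu>" using prod by auto
      show "(\<lambda>x. multiplier (a n) (b n) x *\<^sub>R (laplace f x * cnj (laplace \<phi> x))) \<in> borel_measurable \<nu>" for n
        using multiplier_pairing(1)[OF a(1) ab f \<phi>(1)] by auto
      show "integrable \<nu> (\<lambda>x. norm (laplace f x * cnj (laplace \<phi> x)))" by (rule integrable_norm[OF prod])
      show "AE x in \<nu>. (\<lambda>n. multiplier (a n) (b n) x *\<^sub>R (laplace f x * cnj (laplace \<phi> x))) \<longlonglongrightarrow> laplace f x * cnj (laplace \<phi> x)"
      proof (rule AE_I2)
        fix x assume "x \<in> space \<nu>"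
        then have "(\<lambda>n. multiplier (a n) (b n) x) \<longlonglongrightarrow> 1" by (intro mlim) simp
        then have "(\<lambda>n. multiplier (a n) (b n) x *\<^sub>R (laplace f x * cnj (laplace \<phi> x))) \<longlonglongrightarrow> 1 *\<^sub>R (laplace f x * cnj (laplace \<phi> x))"
          by (intro tendsto_scaleR tendsto_const)
        then show "(\<lambda>n. multiplier (a n) (b n) x *\<^sub>R (laplace f x * cnj (laplace \<phi> x))) \<longlonglongrightarrow> laplace f x * cnj (laplace \<phi> x)" by simp
      qed
      show "AE x in \<nu>. norm (multiplier (a n) (b n) x *\<^sub>R (laplace f x * cnj (laplace \<phi> x))) \<le> norm (laplace f x * cnj (laplace \<phi> x))" for n
      proof (rule AE_I2)
        fix x assume "x \<in> space \<nu>"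
        then have "\<bar>multiplier (a n) (b n) x\<bar> \<le> 1" using multiplier_bounds(1,2)[OF a(1)[of n] ab, of x] by simp
        then show "norm (multiplier (a n) (b n) x *\<^sub>R (laplace f x * cnj (laplace \<phi> x))) \<le> norm (laplace f x * cnj (laplace \<phi> x))"
          unfolding norm_scaleR by (rule mult_left_le_one_le[OF norm_ge_zero abs_ge_zero])
      qed
    qed
    moreover have "(\<lambda>n. \<integral>x. multiplier (a n) (b n) x *\<^sub>R (laplace f x * cnj (laplace \<phi> x)) \<partial>\<nu>) = (\<lambda>n. l2_inner Rplus (D n) \<phi>)"
      by (simp add: multiplier_pairing(2)[OF a(1) ab f \<phi>(1)] l2_inner_def D_def)
    ultimately show "l2_inner \<nu> (laplace f) (laplace \<phi>) = l2_inner Rplus (F f) \<phi>"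
      using inner_lim[OF \<phi>(1)] unfolding l2_inner_def[of \<nu>] by (metis LIMSEQ_unique)
  qed
qed

text \<open>
  Square integrability of \<open>F f\<close> is contained in the right-hand side, since \<open>g\<close> is in \<open>L\<^sup>2\<close>.
\<close>

lemma hankel_operator_iff:
  "(f, g) \<in> hankel_operator \<mu> \<longleftrightarrow> f \<in> L2 Rplus \<and> g \<in> L2 Rplus \<and> (AE t in Rplus. g t = F f t)"
proof
  assume "(f, g) \<in> hankel_operator \<mu>"
  then show "f \<in> L2 Rplus \<and> g \<in> L2 Rplus \<and> (AE t in Rplus. g t = F f t)"
    using operator_imp_hankel_integral(1) by (auto simp: hankel_operator_form_iff hankel_form_dom_iff)
next
  assume *: "f \<in> L2 Rplus \<and> g \<in> L2 Rplus \<and> (AE t in Rplus. g t = F f t)"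
  have Ff: "F f \<in> L2 Rplus"
  proof (rule L2_bounded)
    show "F f \<in> borel_measurable Rplus" by (rule borel_measurable_Rplus[OF hankel_integral_measurable]) (use * in simp)
    show "AE t in Rplus. cmod (F f t) \<le> cmod (g t)" using * by (auto elim: eventually_mono)
  qed (use * in simp)
  have op: "(f, F f) \<in> hankel_operator \<mu>" by (rule hankel_integral_imp_operator[OF _ Ff]) (use * in simp)
  have "l2_inner Rplus g \<phi> = l2_inner Rplus (F f) \<phi>" if "\<phi> \<in> L2 Rplus" for \<phi>
    unfolding l2_inner_def
  proof (rule integral_cong_AE)
    have [measurable]: "g \<in> borel_measurable Rplus" "\<phi> \<in> borel_measurable Rplus" "F f \<in> borel_measurable Rplus"
      using * that Ff by auto
    show "(\<lambda>t. g t * cnj (\<phi> t)) \<in> borel_measurable Rplus" "(\<lambda>t. F f t * cnj (\<phi> t)) \<in> borel_measurable Rplus"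
      by measurable
    show "AE t in Rplus. g t * cnj (\<phi> t) = F f t * cnj (\<phi> t)" using * by (auto elim: eventually_mono)
  qed
  then show "(f, g) \<in> hankel_operator \<mu>" using op * by (auto simp: hankel_operator_form_iff hankel_form_dom_iff)
qed

lemma hankel_domain: "Domain (hankel_operator \<mu>) = {f \<in> L2 Rplus. F f \<in> L2 Rplus}"
proof (intro equalityI subsetI)
  fix f assume "f \<in> Domain (hankel_operator \<mu>)"
  then obtain g where "(f, g) \<in> hankel_operator \<mu>" by auto
  then show "f \<in> {f \<in> L2 Rplus. F f \<in> L2 Rplus}"
    using operator_imp_hankel_integral(2) by (simp add: hankel_operator_iff)
next
  fix f assume "f \<in> {f \<in> L2 Rplus. F f \<in> L2 Rplus}"
  then have "(f, F f) \<in> hankel_operator \<mu>" by (intro hankel_integral_imp_operator) auto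
  then show "f \<in> Domain (hankel_operator \<mu>)" by (rule DomainI)
qed

lemma hankel_op_app:
  assumes "f \<in> L2 Rplus" "F f \<in> L2 Rplus"
  shows "(f, op_app (hankel_operator \<mu>) f) \<in> hankel_operator \<mu>"
  unfolding op_app_def
  by (rule someI[where P = "\<lambda>g. (f, g) \<in> hankel_operator \<mu>"]) (rule hankel_integral_imp_operator[OF assms])

lemma hankel_integral_C_comp_L2:
  assumes "\<phi> \<in> C_comp"
  shows "F \<phi> \<in> L2 Rplus"
proof -
  obtain a b where ab: "0 < a" "\<And>t. t \<notin> {a..b} \<Longrightarrow> \<phi> t = 0" using C_compE[OF assms] by metis
  have "\<phi> \<in> L2 Rplus" using assms C_comp_L2 by auto
  from compact_support_hankel_L2[OF this ab] show ?thesis .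
qed

section \<open>Density in the graph norm\<close>

lemma hankel_regularize:
  assumes "f \<in> L2 Rplus" "0 \<le> \<epsilon>" "0 \<le> l" "0 < t"
  shows "F (regularize \<epsilon> l N f) t = (\<Sum>k\<in>{1::nat..N}. of_real (1 / real N) * (F f (t + \<epsilon>) - F f (t + (\<epsilon> + real k * l))))"
proof -
  have S: "shiftR \<epsilon> f \<in> L2 Rplus" "shiftR (\<epsilon> + real k * l) f \<in> L2 Rplus" for k
    using assms by (auto intro!: shiftR_L2(1))
  have "F (regularize \<epsilon> l N f) t
      = (\<Sum>k\<in>{1::nat..N}. F (\<lambda>s. of_real (1 / real N) * (shiftR \<epsilon> f s - shiftR (\<epsilon> + real k * l) f s)) t)"
    unfolding regularize_def[abs_def] by (rule hankel_integral_sum[OF _ assms(4)]) (intro L2_cmult L2_diff S)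
  also have "\<dots> = (\<Sum>k\<in>{1::nat..N}. of_real (1 / real N) * (F f (t + \<epsilon>) - F f (t + (\<epsilon> + real k * l))))"
    by (intro sum.cong refl)
       (use assms in \<open>simp only: hankel_integral_cmult hankel_integral_diff[OF S assms(4)] hankel_integral_shiftR add_nonneg_nonneg mult_nonneg_nonneg of_nat_0_le_iff\<close>)
  finally show ?thesis .
qed

text \<open>
  The parameters of \<open>regularize\<close> have to be chosen in the right order: \<open>\<epsilon>\<close> from the continuity of
  translations; then a smooth \<open>\<psi>0\<close> close to \<open>f\<close> and \<open>N\<close>, \<open>l\<close> depending on the norm and support of \<open>\<psi>0\<close>; and
  only then the function \<open>\<psi>\<close> to be regularized, whose required distance to \<open>f\<close> depends on the norm
  bounds for the operators with parameters \<open>\<epsilon>\<close> and \<open>l\<close>. The function \<open>\<psi>0\<close> only serves to show that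
  the average of the translates of \<open>\<psi>\<close> is small.
\<close>

lemma C_comp_graph_dense:
  assumes f: "f \<in> L2 Rplus" and Ff: "F f \<in> L2 Rplus" and e: "0 < e"
  obtains v where "v \<in> C_comp" "l2_norm Rplus (\<lambda>t. f t - v t) < e" "l2_norm Rplus (\<lambda>t. F f t - F v t) < e"
proof -
  define d where "d = e / 6"
  have d: "0 < d" "5 * d < e" using e by (auto simp: d_def)
  define c where "c n = inverse (real (Suc n))" for n
  have c: "c \<longlonglongrightarrow> 0" "0 < c n" "c n \<le> 1" for n
    unfolding c_def[abs_def] by (rule LIMSEQ_inverse_real_of_nat) (auto simp: inverse_le_1_iff)
  have "\<forall>\<^sub>F n in sequentially. l2_norm Rplus (\<lambda>t. F f (t + c n) - F f t) < d"
    by (rule order_tendstoD(2)[OF shiftL_tendsto[OF Ff c(1)] d(1)]) (use c in \<open>auto intro: less_imp_le\<close>)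
  moreover have "\<forall>\<^sub>F n in sequentially. l2_norm Rplus (\<lambda>t. shiftR (c n) f t - f t) < d"
    by (rule order_tendstoD(2)[OF shiftR_tendsto[OF f c(1)] d(1)]) (use c in \<open>auto intro: less_imp_le\<close>)
  ultimately have "\<forall>\<^sub>F n in sequentially. l2_norm Rplus (\<lambda>t. F f (t + c n) - F f t) < d \<and> l2_norm Rplus (\<lambda>t. shiftR (c n) f t - f t) < d"
    by (rule eventually_conj)
  then obtain n where n: "l2_norm Rplus (\<lambda>t. F f (t + c n) - F f t) < d" "l2_norm Rplus (\<lambda>t. shiftR (c n) f t - f t) < d"
    using eventually_happens'[OF sequentially_bot] by blast
  define \<epsilon> where "\<epsilon> = c n"
  have eps: "0 < \<epsilon>" "l2_norm Rplus (\<lambda>t. F f (t + \<epsilon>) - F f t) < d" "l2_norm Rplus (\<lambda>t. shiftR \<epsilon> f t - f t) < d"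
    using n c by (auto simp: \<epsilon>_def)
  obtain \<psi>0 where \<psi>0: "\<psi>0 \<in> C_comp" "l2_norm Rplus (\<lambda>t. f t - \<psi>0 t) < d" using C_comp_approx[OF f d(1)] by metis
  have \<psi>0L: "\<psi>0 \<in> L2 Rplus" using \<psi>0 C_comp_L2 by auto
  \<comment> \<open>so that \<open>\<parallel>\<psi>0\<parallel> / \<surd>N < d\<close>, the bound for the average of disjoint translates of \<open>\<psi>0\<close>\<close>
  obtain N :: nat where N: "(l2_norm Rplus \<psi>0 / d)\<^sup>2 < real N" using reals_Archimedean2 by blast
  have "(l2_norm Rplus \<psi>0 / d)\<^sup>2 \<ge> 0" by simp
  then have N0: "0 < N" using N by (metis of_nat_0_less_iff order_le_less_trans)
  have "l2_norm Rplus \<psi>0 / d < sqrt N" by (rule real_less_rsqrt[OF N])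
  then have Nd: "l2_norm Rplus \<psi>0 / sqrt N < d" using d N0 by (simp add: field_simps)
  obtain a b where ab: "0 < a" "a \<le> b" "\<And>t. t \<notin> {a..b} \<Longrightarrow> \<psi>0 t = 0" using C_compE[OF \<psi>0(1)] by metis
  have "(\<lambda>m. l2_norm Rplus (shiftL (b + real m) (F f))) \<longlonglongrightarrow> 0"
    by (rule shiftL_at_top[OF Ff filterlim_at_top_mono[OF filterlim_real_sequentially]]) (use ab in auto)
  from order_tendstoD(2)[OF this d(1)] obtain m where m: "l2_norm Rplus (shiftL (b + real m) (F f)) < d"
    using eventually_happens'[OF sequentially_bot] by blast
  \<comment> \<open>\<open>l\<close> exceeds the length of the support of \<open>\<psi>0\<close>, and \<open>F f\<close> has small norm beyond \<open>l\<close>.\<close>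
  define l where "l = b + real m"
  have l: "0 \<le> l" "b \<le> l" "l2_norm Rplus (shiftL l (F f)) < d" using m ab by (auto simp: l_def)
  define C where "C = (\<Sum>k\<in>{1::nat..N}. multiplier_mass \<epsilon> (\<epsilon> + real k * l))"
  have C: "0 \<le> C" unfolding C_def by (intro sum_nonneg) simp
  have "0 < min d (d / (C + 1))" using d C by simp
  then obtain \<psi> where \<psi>: "\<psi> \<in> C_comp" "l2_norm Rplus (\<lambda>t. f t - \<psi> t) < min d (d / (C + 1))"
    using C_comp_approx[OF f] by metis
  have \<psi>L: "\<psi> \<in> L2 Rplus" using \<psi> C_comp_L2 by auto
  have r: "0 \<le> \<epsilon> + real k * l" for k using eps l by simp
  let ?v = "regularize \<epsilon> l N \<psi>"
  have v: "?v \<in> C_comp" using eps l by (intro regularize_C_comp \<psi>) auto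
  have avg: "(\<Sum>k\<in>{1::nat..N}. of_real (1 / real N) * z) = z" for z :: complex using N0 by simp
  define A where "A u t = (\<Sum>k\<in>{1::nat..N}. of_real (1 / real N) * shiftR (\<epsilon> + real k * l) u t)" for u t
  have AL: "A u \<in> L2 Rplus" if "u \<in> L2 Rplus" for u
    unfolding A_def[abs_def] by (intro L2_sum L2_cmult shiftR_L2(1)[OF that r])
  have v_eq: "?v t = shiftR \<epsilon> \<psi> t - A \<psi> t" for t
    unfolding regularize_def A_def right_diff_distrib sum_subtractf avg ..
  have A_diff: "A (\<lambda>t. u t - w t) t = A u t - A w t" for u w t
    unfolding A_def shiftR_diff right_diff_distrib sum_subtractf ..
  have f\<psi>: "(\<lambda>t. f t - \<psi> t) \<in> L2 Rplus" by (rule L2_diff[OF f \<psi>L])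
  \<comment> \<open>\<open>f - v = (f - S\<^sub>\<epsilon> f) + S\<^sub>\<epsilon> (f - \<psi>) + A (\<psi> - \<psi>0) + A \<psi>0\<close>; the terms have norm at most \<open>d\<close>, \<open>d\<close>, \<open>2 d\<close>, \<open>d\<close>.\<close>
  have 1: "l2_norm Rplus (\<lambda>t. f t - ?v t) < e"
  proof -
    have SfL: "shiftR \<epsilon> f \<in> L2 Rplus" "shiftR \<epsilon> (\<lambda>t. f t - \<psi> t) \<in> L2 Rplus"
      using eps by (auto intro!: shiftR_L2(1) f f\<psi>)
    have P: "(\<lambda>t. \<psi> t - \<psi>0 t) \<in> L2 Rplus" by (rule L2_diff[OF \<psi>L \<psi>0L])
    have "l2_norm Rplus (\<lambda>t. f t - ?v t)
        = l2_norm Rplus (\<lambda>t. ((f t - shiftR \<epsilon> f t) + shiftR \<epsilon> (\<lambda>t. f t - \<psi> t) t) + (A (\<lambda>t. \<psi> t - \<psi>0 t) t + A \<psi>0 t))"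
      by (simp add: v_eq shiftR_diff A_diff algebra_simps)
    also have "\<dots> \<le> l2_norm Rplus (\<lambda>t. (f t - shiftR \<epsilon> f t) + shiftR \<epsilon> (\<lambda>t. f t - \<psi> t) t)
        + l2_norm Rplus (\<lambda>t. A (\<lambda>t. \<psi> t - \<psi>0 t) t + A \<psi>0 t)"
      by (intro l2_norm_triangle L2_add L2_diff f SfL AL P \<psi>0L)
    also have "l2_norm Rplus (\<lambda>t. (f t - shiftR \<epsilon> f t) + shiftR \<epsilon> (\<lambda>t. f t - \<psi> t) t)
        \<le> l2_norm Rplus (\<lambda>t. f t - shiftR \<epsilon> f t) + l2_norm Rplus (shiftR \<epsilon> (\<lambda>t. f t - \<psi> t))"
      by (intro l2_norm_triangle L2_diff f SfL)
    also have "l2_norm Rplus (shiftR \<epsilon> (\<lambda>t. f t - \<psi> t)) = l2_norm Rplus (\<lambda>t. f t - \<psi> t)"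
      using eps by (intro shiftR_L2(2) f\<psi>) auto
    also have "l2_norm Rplus (\<lambda>t. A (\<lambda>t. \<psi> t - \<psi>0 t) t + A \<psi>0 t)
        \<le> l2_norm Rplus (A (\<lambda>t. \<psi> t - \<psi>0 t)) + l2_norm Rplus (A \<psi>0)"
      by (intro l2_norm_triangle AL P \<psi>0L)
    also have "l2_norm Rplus (A \<psi>0) = l2_norm Rplus \<psi>0 / sqrt N"
      unfolding A_def[abs_def]
      by (rule norm_average_far_translates[OF \<psi>0L ab(1)]) (use ab l eps N0 in auto)
    also have "l2_norm Rplus (A (\<lambda>t. \<psi> t - \<psi>0 t)) \<le> l2_norm Rplus (\<lambda>t. \<psi> t - \<psi>0 t)"
      unfolding A_def[abs_def]
      by (rule average_norm_le[OF shiftR_L2(1)[OF P r] _ N0]) (simp add: shiftR_L2(2)[OF P r])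
    also have "l2_norm Rplus (\<lambda>t. \<psi> t - \<psi>0 t) \<le> l2_norm Rplus (\<lambda>t. \<psi> t - f t) + l2_norm Rplus (\<lambda>t. f t - \<psi>0 t)"
      by (rule l2_norm_diff_triangle[OF \<psi>L f \<psi>0L])
    finally show ?thesis
      using eps(3) \<psi>(2) \<psi>0(2) Nd d(2)
      by (simp add: l2_norm_minus_commute[of _ f "shiftR \<epsilon> f"] l2_norm_minus_commute[of _ \<psi> f])
  qed
  \<comment> \<open>\<open>F f - F v\<close> is \<open>F f - F f (\<cdot> + \<epsilon>)\<close> plus averages of \<open>F f (\<cdot> + \<epsilon> + k l)\<close> and of the bounded differences
      applied to \<open>f - \<psi>\<close>; each of the three has norm at most \<open>d\<close>.\<close>
  have 2: "l2_norm Rplus (\<lambda>t. F f t - F ?v t) < e"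
  proof -
    define w where "w t = f t - \<psi> t" for t
    have wL: "w \<in> L2 Rplus" unfolding w_def[abs_def] by (rule f\<psi>)
    define D where "D k t = F w (t + \<epsilon>) - F w (t + (\<epsilon> + real k * l))" for k t
    have le: "\<epsilon> \<le> \<epsilon> + real k * l" for k using l by simp
    have DL: "D k \<in> L2 Rplus" "l2_norm Rplus (D k) \<le> multiplier_mass \<epsilon> (\<epsilon> + real k * l) * l2_norm Rplus w" for k
      unfolding D_def[abs_def] by (rule hankel_difference_bounded[OF eps(1) le wL])+
    have DB: "l2_norm Rplus (D k) \<le> d" if "k \<in> {1::nat..N}" for k
    proof -
      have "multiplier_mass \<epsilon> (\<epsilon> + real k * l) \<le> C"
        unfolding C_def by (rule member_le_sum[OF that]) auto
      then have "l2_norm Rplus (D k) \<le> C * l2_norm Rplus w"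
        using DL(2)[of k] by (meson l2_norm_nonneg mult_right_mono order_trans)
      also have "\<dots> \<le> (C + 1) * l2_norm Rplus w" by (intro mult_right_mono) auto
      also have "\<dots> \<le> (C + 1) * (d / (C + 1))"
        using \<psi>(2) C by (intro mult_left_mono) (auto simp: w_def[abs_def])
      also have "\<dots> = d" using C by simp
      finally show ?thesis .
    qed
    have SL: "shiftL \<epsilon> (F f) \<in> L2 Rplus" "shiftL (\<epsilon> + real k * l) (F f) \<in> L2 Rplus" for k
      by (rule shiftL_L2(1)[OF Ff], use eps in simp) (rule shiftL_L2(1)[OF Ff r])
    have SB: "l2_norm Rplus (shiftL (\<epsilon> + real k * l) (F f)) \<le> d" if "k \<in> {1::nat..N}" for k
    proof -
      have "l \<le> real k * l" using mult_right_mono[of 1 "real k" l] that l by simp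
      then have nn: "0 \<le> \<epsilon> + real k * l - l" using eps by simp
      have "l2_norm Rplus (shiftL (\<epsilon> + real k * l - l) (shiftL l (F f))) \<le> l2_norm Rplus (shiftL l (F f))"
        by (rule shiftL_L2(2)[OF shiftL_L2(1)[OF Ff l(1)] nn])
      then show ?thesis using l(3) by simp
    qed
    define E where "E t = (\<Sum>k\<in>{1::nat..N}. of_real (1 / real N) * F f (t + (\<epsilon> + real k * l)))
        + (\<Sum>k\<in>{1::nat..N}. of_real (1 / real N) * D k t)" for t
    have EL: "E \<in> L2 Rplus" unfolding E_def[abs_def] by (intro L2_add L2_sum L2_cmult SL DL)
    have "F f t - F ?v t = (F f t - F f (t + \<epsilon>)) + E t" if t: "0 < t" for t
    proof -
      have pos: "0 < t + \<epsilon>" "0 < t + (\<epsilon> + real k * l)" for k using t eps r[of k] by auto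
      have "D k t = (F f (t + \<epsilon>) - F f (t + (\<epsilon> + real k * l))) - (F \<psi> (t + \<epsilon>) - F \<psi> (t + (\<epsilon> + real k * l)))" for k
        unfolding D_def w_def[abs_def] hankel_integral_diff[OF f \<psi>L pos(1)] hankel_integral_diff[OF f \<psi>L pos(2)] by simp
      then have "E t = F f (t + \<epsilon>) - (\<Sum>k\<in>{1::nat..N}. of_real (1 / real N) * (F \<psi> (t + \<epsilon>) - F \<psi> (t + (\<epsilon> + real k * l))))"
        unfolding E_def by (simp only: right_diff_distrib sum_subtractf avg) simp
      then show ?thesis
        using hankel_regularize[OF \<psi>L less_imp_le[OF eps(1)] l(1) t, of N] by simp
    qed
    then have AE: "AE t in Rplus. F f t - F ?v t = (F f t - F f (t + \<epsilon>)) + E t" by (rule AE_Rplus_pos)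
    have "l2_norm Rplus (\<lambda>t. F f t - F ?v t) = l2_norm Rplus (\<lambda>t. (F f t - F f (t + \<epsilon>)) + E t)"
      by (rule l2_norm_cong_AE[OF _ _ AE]) (intro L2_diff L2_add Ff hankel_integral_C_comp_L2 v SL EL)+
    also have "\<dots> \<le> l2_norm Rplus (\<lambda>t. F f t - F f (t + \<epsilon>)) + l2_norm Rplus E"
      by (intro l2_norm_triangle L2_diff Ff SL EL)
    also have "l2_norm Rplus E \<le> l2_norm Rplus (\<lambda>t. \<Sum>k\<in>{1::nat..N}. of_real (1 / real N) * F f (t + (\<epsilon> + real k * l)))
        + l2_norm Rplus (\<lambda>t. \<Sum>k\<in>{1::nat..N}. of_real (1 / real N) * D k t)"
      unfolding E_def[abs_def] by (intro l2_norm_triangle L2_sum L2_cmult SL DL)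
    also have "l2_norm Rplus (\<lambda>t. \<Sum>k\<in>{1::nat..N}. of_real (1 / real N) * F f (t + (\<epsilon> + real k * l))) \<le> d"
      by (rule average_norm_le[OF SL(2) SB N0])
    also have "l2_norm Rplus (\<lambda>t. \<Sum>k\<in>{1::nat..N}. of_real (1 / real N) * D k t) \<le> d"
      by (rule average_norm_le[OF DL(1) DB N0])
    finally show ?thesis
      using eps(2) d by (simp add: l2_norm_minus_commute[of _ "F f"])
  qed
  show ?thesis by (rule that[OF v 1 2])
qed

lemma C_comp_graph_norm_dense:
  assumes "f \<in> Domain (hankel_operator \<mu>)" "0 < e"
  shows "\<exists>\<phi>\<in>C_comp. graph_norm Rplus (hankel_operator \<mu>) (\<lambda>t. f t - \<phi> t) < e"
proof -
  have f: "f \<in> L2 Rplus" "F f \<in> L2 Rplus" using assms(1) by (auto simp: hankel_domain)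
  have "0 < e / 2" using assms(2) by simp
  then obtain v where v: "v \<in> C_comp" "l2_norm Rplus (\<lambda>t. f t - v t) < e / 2" "l2_norm Rplus (\<lambda>t. F f t - F v t) < e / 2"
    using C_comp_graph_dense[OF f] by metis
  have vL: "v \<in> L2 Rplus" "F v \<in> L2 Rplus" using v C_comp_L2 hankel_integral_C_comp_L2 by auto
  let ?w = "\<lambda>t. f t - v t"
  have w: "?w \<in> L2 Rplus" by (rule L2_diff[OF f(1) vL(1)])
  have FvL: "(\<lambda>t. F f t - F v t) \<in> L2 Rplus" by (rule L2_diff[OF f(2) vL(2)])
  have AE: "AE t in Rplus. F ?w t = F f t - F v t"
    by (rule AE_Rplus_pos) (rule hankel_integral_diff[OF f(1) vL(1)])
  have "F ?w \<in> L2 Rplus"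
  proof (rule L2_bounded[OF _ FvL])
    show "F ?w \<in> borel_measurable Rplus" by (rule borel_measurable_Rplus[OF hankel_integral_measurable[OF w]])
    show "AE t in Rplus. cmod (F ?w t) \<le> cmod (F f t - F v t)" using AE by eventually_elim simp
  qed
  from hankel_op_app[OF w this] have op: "op_app (hankel_operator \<mu>) ?w \<in> L2 Rplus"
    "AE t in Rplus. op_app (hankel_operator \<mu>) ?w t = F ?w t"
    by (auto simp: hankel_operator_iff)
  have "AE t in Rplus. op_app (hankel_operator \<mu>) ?w t = F f t - F v t"
    using op(2) AE by eventually_elim simp
  then have "l2_norm Rplus (op_app (hankel_operator \<mu>) ?w) = l2_norm Rplus (\<lambda>t. F f t - F v t)"
    by (rule l2_norm_cong_AE[OF op(1) FvL])
  then have "graph_norm Rplus (hankel_operator \<mu>) ?w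
      = sqrt ((l2_norm Rplus ?w)\<^sup>2 + (l2_norm Rplus (\<lambda>t. F f t - F v t))\<^sup>2)"
    by (simp add: graph_norm_def)
  also have "\<dots> \<le> l2_norm Rplus ?w + l2_norm Rplus (\<lambda>t. F f t - F v t)"
    by (rule sqrt_sum_squares_le_sum) auto
  also have "\<dots> < e" using v by simp
  finally show ?thesis by (intro bexI[of _ v] v)
qed

section \<open>Essential self-adjointness\<close>

lemma hankel_symmetric: "op_symmetric Rplus (hankel_operator \<mu>)"
  unfolding op_symmetric_def
proof (clarify)
  fix f f' g g' assume f: "(f, f') \<in> hankel_operator \<mu>" and g: "(g, g') \<in> hankel_operator \<mu>"
  have "l2_inner Rplus f' g = l2_inner \<nu> (laplace f) (laplace g)" using f g by (auto simp: hankel_operator_form_iff)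
  also have "\<dots> = cnj (l2_inner \<nu> (laplace g) (laplace f))" by (rule l2_inner_commute)
  also have "l2_inner \<nu> (laplace g) (laplace f) = l2_inner Rplus g' f" using f g by (auto simp: hankel_operator_form_iff)
  also have "cnj (l2_inner Rplus g' f) = l2_inner Rplus f g'" by (rule l2_inner_commute[symmetric])
  finally show "l2_inner Rplus f' g = l2_inner Rplus f g'" .
qed

lemma hankel_operator_L2: "hankel_operator \<mu> \<subseteq> L2 Rplus \<times> L2 Rplus"
  by (auto simp: hankel_operator_iff)

abbreviation minimal_operator :: "real l2_operator" where "minimal_operator \<equiv> op_restrict (hankel_operator \<mu>) C_comp"

lemma minimal_operator_iff: "(f, g) \<in> minimal_operator \<longleftrightarrow> (f, g) \<in> hankel_operator \<mu> \<and> f \<in> C_comp"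
  by (auto simp: op_restrict_def)

lemma C_comp_minimal_operator: "v \<in> C_comp \<Longrightarrow> (v, F v) \<in> minimal_operator"
  using C_comp_L2 by (auto simp: minimal_operator_iff intro: hankel_integral_imp_operator hankel_integral_C_comp_L2)

lemma minimal_operator_subset: "minimal_operator \<subseteq> hankel_operator \<mu>"
  by (auto simp: op_restrict_def)

text \<open>
  For \<open>(g, g')\<close> in the adjoint the relation \<open>\<langle>F v, g\<rangle> = \<langle>v, g'\<rangle>\<close> extends from smooth \<open>v\<close> to every \<open>\<phi>\<close> in
  the domain of the Hankel operator by density in the graph norm. Taking for \<open>\<phi>\<close> the functions with
  compact support, where the integrals may be exchanged for any \<open>g\<close>, gives \<open>g' = F g\<close>.
\<close>

lemma adjoint_minimal_operator: "op_adjoint Rplus minimal_operator = hankel_operator \<mu>"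
proof
  show "hankel_operator \<mu> \<subseteq> op_adjoint Rplus minimal_operator"
    using op_symmetric_subset_adjoint[OF hankel_symmetric hankel_operator_L2]
      op_adjoint_antimono[OF minimal_operator_subset] by (rule order_trans)
  show "op_adjoint Rplus minimal_operator \<subseteq> hankel_operator \<mu>"
  proof (rule subrelI)
    fix g g' assume "(g, g') \<in> op_adjoint Rplus minimal_operator"
    then have g: "g \<in> L2 Rplus" "g' \<in> L2 Rplus"
      and adj: "\<And>v. v \<in> C_comp \<Longrightarrow> l2_inner Rplus (F v) g = l2_inner Rplus v g'"
      using C_comp_minimal_operator unfolding op_adjoint_def by (simp_all add: split_beta) fastforce
    have "AE t in Rplus. g' t = F g t"
    proof (rule hankel_integral_AE_eqI[OF g])
      fix \<phi> a b assume \<phi>: "\<phi> \<in> L2 Rplus" "0 < a" and supp: "\<And>t. t \<notin> {a..b} \<Longrightarrow> \<phi> t = 0"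
      have F\<phi>: "F \<phi> \<in> L2 Rplus" by (rule compact_support_hankel_L2[OF \<phi> supp])
      have "cmod (l2_inner Rplus (F \<phi>) g - l2_inner Rplus \<phi> g') \<le> 0 + e" if e: "0 < e" for e
      proof -
        define K where "K = l2_norm Rplus g + l2_norm Rplus g' + 1"
        have K: "K > 0" by (simp add: K_def add_nonneg_pos)
        then have eK: "0 < e / K" using e by simp
        obtain v where v: "v \<in> C_comp" "l2_norm Rplus (\<lambda>t. \<phi> t - v t) < e / K" "l2_norm Rplus (\<lambda>t. F \<phi> t - F v t) < e / K"
          using C_comp_graph_dense[OF \<phi>(1) F\<phi> eK] by metis
        have vL: "v \<in> L2 Rplus" "F v \<in> L2 Rplus" using v C_comp_L2 hankel_integral_C_comp_L2 by auto
        have "l2_inner Rplus (F \<phi>) g - l2_inner Rplus \<phi> g'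
          = l2_inner Rplus (\<lambda>t. F \<phi> t - F v t) g - l2_inner Rplus (\<lambda>t. \<phi> t - v t) g'"
          using adj[OF v(1)] by (simp add: l2_inner_diff_left F\<phi> vL g \<phi>)
        then have "cmod (l2_inner Rplus (F \<phi>) g - l2_inner Rplus \<phi> g')
          \<le> cmod (l2_inner Rplus (\<lambda>t. F \<phi> t - F v t) g) + cmod (l2_inner Rplus (\<lambda>t. \<phi> t - v t) g')"
          by (simp only: norm_triangle_ineq4)
        also have "\<dots> \<le> l2_norm Rplus (\<lambda>t. F \<phi> t - F v t) * l2_norm Rplus g + l2_norm Rplus (\<lambda>t. \<phi> t - v t) * l2_norm Rplus g'"
          by (intro add_mono l2_Cauchy_Schwarz L2_diff F\<phi> vL g \<phi>)
        also have "\<dots> \<le> e / K * l2_norm Rplus g + e / K * l2_norm Rplus g'"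
          using v by (intro add_mono mult_right_mono) auto
        also have "\<dots> \<le> e / K * K"
          unfolding distrib_left[symmetric] using eK by (intro mult_left_mono) (auto simp: K_def)
        also have "\<dots> = e" using K by simp
        finally show ?thesis by simp
      qed
      then have "cmod (l2_inner Rplus (F \<phi>) g - l2_inner Rplus \<phi> g') \<le> 0" by (rule field_le_epsilon)
      then have eq: "l2_inner Rplus (F \<phi>) g = l2_inner Rplus \<phi> g'" by simp
      have "(\<integral>t. F g t * cnj (\<phi> t) \<partial>Rplus) = l2_inner \<nu> (laplace g) (laplace \<phi>)"
        by (rule compact_support_pairing(2)[OF \<phi> supp g(1), symmetric])
      also have "\<dots> = cnj (l2_inner \<nu> (laplace \<phi>) (laplace g))" by (rule l2_inner_commute)
      also have "l2_inner \<nu> (laplace \<phi>) (laplace g) = l2_inner Rplus (F \<phi>) g"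
        by (rule compact_support_pairing(3)[OF \<phi> supp g(1)])
      also have "cnj \<dots> = l2_inner Rplus g' \<phi>" unfolding eq by (rule l2_inner_commute[symmetric])
      finally show "(\<integral>t. F g t * cnj (\<phi> t) \<partial>Rplus) = l2_inner Rplus g' \<phi>" .
    qed
    then show "(g, g') \<in> hankel_operator \<mu>" using g by (simp add: hankel_operator_iff)
  qed
qed

lemma adjoint_hankel: "op_adjoint Rplus (hankel_operator \<mu>) = hankel_operator \<mu>"
proof
  have "op_adjoint Rplus (hankel_operator \<mu>) \<subseteq> op_adjoint Rplus minimal_operator"
    by (rule op_adjoint_antimono[OF minimal_operator_subset])
  then show "op_adjoint Rplus (hankel_operator \<mu>) \<subseteq> hankel_operator \<mu>" by (simp add: adjoint_minimal_operator)
  show "hankel_operator \<mu> \<subseteq> op_adjoint Rplus (hankel_operator \<mu>)"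
    by (rule op_symmetric_subset_adjoint[OF hankel_symmetric hankel_operator_L2])
qed

lemma minimal_operator_symmetric: "op_symmetric Rplus minimal_operator"
  by (rule op_symmetric_subset[OF hankel_symmetric minimal_operator_subset])

text \<open>
  Symmetry puts the closure inside the adjoint, which is the Hankel operator; the other inclusion is
  density in the graph norm.
\<close>

lemma closure_minimal_operator: "op_closure Rplus minimal_operator = hankel_operator \<mu>"
proof
  have "minimal_operator \<subseteq> L2 Rplus \<times> L2 Rplus" using minimal_operator_subset hankel_operator_L2 by (rule order_trans)
  then show "op_closure Rplus minimal_operator \<subseteq> hankel_operator \<mu>"
    using op_closure_subset_adjoint[OF minimal_operator_symmetric] by (simp add: adjoint_minimal_operator)
  show "hankel_operator \<mu> \<subseteq> op_closure Rplus minimal_operator"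
  proof (rule subrelI)
    fix f f' assume ff: "(f, f') \<in> hankel_operator \<mu>"
    then have f: "f \<in> L2 Rplus" "f' \<in> L2 Rplus" and AE: "AE t in Rplus. f' t = F f t"
      by (auto simp: hankel_operator_iff)
    have Ff: "F f \<in> L2 Rplus" by (rule operator_imp_hankel_integral(2)[OF ff])
    have "\<exists>(g, g')\<in>minimal_operator. l2_norm Rplus (\<lambda>x. f x - g x) < e \<and> l2_norm Rplus (\<lambda>x. f' x - g' x) < e" if e: "0 < e" for e
    proof -
      obtain v where v: "v \<in> C_comp" "l2_norm Rplus (\<lambda>t. f t - v t) < e" "l2_norm Rplus (\<lambda>t. F f t - F v t) < e"
        using C_comp_graph_dense[OF f(1) Ff e] by metis
      have "l2_norm Rplus (\<lambda>t. f' t - F v t) = l2_norm Rplus (\<lambda>t. F f t - F v t)"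
      proof (rule l2_norm_cong_AE)
        show "AE t in Rplus. f' t - F v t = F f t - F v t" using AE by eventually_elim simp
      qed (intro L2_diff f Ff hankel_integral_C_comp_L2 v)+
      then show ?thesis using v C_comp_minimal_operator[OF v(1)] by (intro bexI[of _ "(v, F v)"]) auto
    qed
    then show "(f, f') \<in> op_closure Rplus minimal_operator" using f by (simp add: op_closure_def)
  qed
qed

lemma C_comp_domain: "C_comp \<subseteq> Domain (hankel_operator \<mu>)"
  using C_comp_minimal_operator by (auto simp: minimal_operator_iff)

lemma minimal_operator_essentially_self_adjoint: "essentially_self_adjoint Rplus minimal_operator"
  unfolding essentially_self_adjoint_def self_adjoint_def closure_minimal_operator
proof (intro conjI minimal_operator_symmetric adjoint_hankel densely_defined_of_C_comp C_comp_domain)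
  show "C_comp \<subseteq> Domain minimal_operator" using C_comp_minimal_operator by auto
  show "Domain minimal_operator \<subseteq> L2 Rplus" using C_comp_L2 by (auto simp: minimal_operator_iff)
  show "Domain (hankel_operator \<mu>) \<subseteq> L2 Rplus" using hankel_operator_L2 by auto
qed

end

theorem theorem2p2:
  fixes \<mu> :: "real measure"
  assumes "\<mu> \<in> hankel_measures"
    and "\<And>t. t > 0 \<Longrightarrow> (\<integral>\<^sup>+s. ennreal (\<bar>hankel_kernel \<mu> (t + s)\<bar>\<^sup>2) \<partial>Rplus) < \<infinity>"
  shows "(\<forall>f\<in>L2 Rplus. \<forall>t>0. integrable Rplus (\<lambda>s. hankel_kernel \<mu> (t + s) *\<^sub>R f s)) \<and>
     (Domain (hankel_operator \<mu>) = {f \<in> L2 Rplus. hankel_integral \<mu> f \<in> L2 Rplus}) \<and>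
     (\<forall>f\<in>L2 Rplus. hankel_integral \<mu> f \<in> L2 Rplus \<longrightarrow>
           (AE t in Rplus. op_app (hankel_operator \<mu>) f t = hankel_integral \<mu> f t)) \<and>
     (C_comp \<subseteq> Domain (hankel_operator \<mu>)) \<and>
     (\<forall>f\<in>Domain (hankel_operator \<mu>). \<forall>e>0. \<exists>\<phi>\<in>C_comp.
           graph_norm Rplus (hankel_operator \<mu>) (\<lambda>t. f t - \<phi> t) < e) \<and>
     (essentially_self_adjoint Rplus (op_restrict (hankel_operator \<mu>) C_comp))"
proof -
  interpret hankel_setting \<mu> by (unfold_locales) (fact assms)+
  show ?thesis
  proof (intro conjI ballI allI impI)
    show "AE t in Rplus. op_app (hankel_operator \<mu>) f t = hankel_integral \<mu> f t"
      if "f \<in> L2 Rplus" "hankel_integral \<mu> f \<in> L2 Rplus" for f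
      using hankel_op_app[OF that] by (simp add: hankel_operator_iff)
  qed (fact hankel_integrable hankel_domain C_comp_domain C_comp_graph_norm_dense minimal_operator_essentially_self_adjoint)+
qed

end
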